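(* The pair $(\mathcal{T},\cong_t)$ is Borel bireducible with $(\mathrm{LO},\cong_{L_0})$; that is, $(\mathcal{T},\cong_t)\leq_B(\mathrm{LO},\cong_{L_0})$ and $(\mathrm{LO},\cong_{L_0})\leq_B(\mathcal{T},\cong_t)$.
   Context: A continuous t-norm on $[0,1]$ is a continuous map $*\colon[0,1]\times[0,1]\to[0,1]$ such that $([0,1],*,1)$ is a commutative monoid and $p*q\le p'*q'$ whenever $p\le p'$ and $q\le q'$. Let $\mathcal{T}$ be the set of continuous t-norms on $[0,1]$, equipped with the topology of the sup metric $d_\infty(f_1,f_2)=\sup\{|f_1(x,y)-f_2(x,y)|: x,y\in[0,1]\}$ (it is a Polish space). Two continuous t-norms $*,\bullet$ are isomorphic, $*\cong_t\bullet$, if there is an order isomorphism $\phi\colon[0,1]\to[0,1]$ with $\phi(x*y)=\phi(x)\bullet\phi(y)$ for all $x,y$. Let $\omega=\{0,1,2,\dots\}$ and let $\mathrm{LO}\subseteq 2^{\omega\times\omega}$ be the set of strict linear orders on $\omega$ (a closed subset of $2^{\omega\times\omega}$ with the product topology, $2=\{0,1\}$ discrete); for $<_1,<_2\in\mathrm{LO}$, $<_1\cong_{L_0}<_2$ iff $(\omega,<_1)$ and $(\omega,<_2)$ are order isomorphic. For equivalence relations $E$ on a Polish space $X$ and $F$ on a Polish space $Y$, $(X,E)\le_B(Y,F)$ means there is a Borel function $f\colon X\to Y$ with $x_1Ex_2\iff f(x_1)Ff(x_2)$ for all $x_1,x_2\in X$. *)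

theory Defs
  imports "HOL-Analysis.Analysis"
begin

section \<open>Borel reducibility\<close>

definition borel_of_topology :: "'a topology \<Rightarrow> 'a measure" where
  "borel_of_topology X = sigma (topspace X) {U. openin X U}"

definition Borel_reducible ::
    "'a topology \<Rightarrow> ('a \<Rightarrow> 'a \<Rightarrow> bool) \<Rightarrow> 'b topology \<Rightarrow> ('b \<Rightarrow> 'b \<Rightarrow> bool) \<Rightarrow> bool" where
  "Borel_reducible X E Y F \<longleftrightarrow>
     (\<exists>f. f \<in> measurable (borel_of_topology X) (borel_of_topology Y) \<and>
          (\<forall>x1\<in>topspace X. \<forall>x2\<in>topspace X. E x1 x2 \<longleftrightarrow> F (f x1) (f x2)))"

text \<open>The two \<sigma>-algebras live on the expected carriers, so a measurable map sends
  \<^term>\<open>topspace X\<close> into \<^term>\<open>topspace Y\<close>.\<close>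

lemma space_borel_of_topology [simp]: "space (borel_of_topology X) = topspace X"
  by (simp add: borel_of_topology_def space_measure_of_conv)

lemma sets_borel_of_topology:
  "sets (borel_of_topology X) = sigma_sets (topspace X) {U. openin X U}"
  unfolding borel_of_topology_def by (rule sets_measure_of) (auto dest: openin_subset)


section \<open>The space of continuous t-norms\<close>

abbreviation unit_square :: "(real \<times> real) set" where
  "unit_square \<equiv> {0..1} \<times> {0..1}"

definition continuous_tnorm :: "(real \<times> real \<Rightarrow> real) \<Rightarrow> bool" where
  "continuous_tnorm f \<longleftrightarrow>
     f \<in> unit_square \<rightarrow> {0..1} \<and>
     continuous_on unit_square f \<and>
     (\<forall>x\<in>{0..1}. \<forall>y\<in>{0..1}. \<forall>z\<in>{0..1}. f (f (x, y), z) = f (x, f (y, z))) \<and>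
     (\<forall>x\<in>{0..1}. \<forall>y\<in>{0..1}. f (x, y) = f (y, x)) \<and>
     (\<forall>x\<in>{0..1}. f (1, x) = x) \<and>
     (\<forall>p\<in>{0..1}. \<forall>p'\<in>{0..1}. \<forall>q\<in>{0..1}. \<forall>q'\<in>{0..1}.
        p \<le> p' \<and> q \<le> q' \<longrightarrow> f (p, q) \<le> f (p', q'))"

text \<open>Elements of \<^const>\<open>cfunspace\<close> are extensional, that is \<^const>\<open>undefined\<close> off the unit
  square, so every t-norm on the unit interval has exactly one representative.\<close>

definition tnorm_metric :: "(real \<times> real \<Rightarrow> real) metric" where
  "tnorm_metric =
     submetric (cfunspace (top_of_set unit_square) euclidean_metric) (Collect continuous_tnorm)"

definition tnorm_space :: "(real \<times> real \<Rightarrow> real) topology" where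
  "tnorm_space = mtopology_of tnorm_metric"

definition tnorm_isomorphic :: "(real \<times> real \<Rightarrow> real) \<Rightarrow> (real \<times> real \<Rightarrow> real) \<Rightarrow> bool" where
  "tnorm_isomorphic f g \<longleftrightarrow>
     (\<exists>\<phi>. bij_betw \<phi> {0..1} {0..1} \<and>
          (\<forall>x\<in>{0..1}. \<forall>y\<in>{0..1}. x \<le> y \<longleftrightarrow> \<phi> x \<le> \<phi> y) \<and>
          (\<forall>x\<in>{0..1}. \<forall>y\<in>{0..1}. \<phi> (f (x, y)) = g (\<phi> x, \<phi> y)))"

lemma mspace_tnorm_metric:
  "mspace tnorm_metric = {f. continuous_tnorm f \<and> f \<in> extensional unit_square}"
proof -
  have *: "bounded (f ` unit_square) \<and> continuous_on unit_square f" if "continuous_tnorm f" for f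
    using that bounded_subset[of "{0..1::real}" "f ` unit_square"]
    unfolding continuous_tnorm_def by (simp add: image_subset_iff_funcset)
  show ?thesis
    unfolding tnorm_metric_def by (auto dest: *)
qed

lemma topspace_tnorm_space:
  "topspace tnorm_space = {f. continuous_tnorm f \<and> f \<in> extensional unit_square}"
  by (simp add: tnorm_space_def mspace_tnorm_metric)

lemma mdist_tnorm_metric:
  assumes "f \<in> mspace tnorm_metric" "g \<in> mspace tnorm_metric"
  shows "mdist tnorm_metric f g = (SUP p\<in>unit_square. \<bar>f p - g p\<bar>)"
proof -
  have "h \<in> Metric_space.fspace UNIV dist unit_square" if "h \<in> mspace tnorm_metric" for h
    using that unfolding tnorm_metric_def cfunspace_def by simp
  then show ?thesis
    using assms unfolding tnorm_metric_def
    by (simp add: mdist_cfunspace_eq_mdist_funspace Metric_space.fdist_def[OF Met_TC.Metric_space_axioms]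
        dist_real_def)
qed


section \<open>The space of strict linear orders on the natural numbers\<close>

definition LO :: "(nat \<times> nat \<Rightarrow> bool) set" where
  "LO = {r. irreflp (curry r) \<and> transp (curry r) \<and> totalp (curry r)}"

definition LO_space :: "(nat \<times> nat \<Rightarrow> bool) topology" where
  "LO_space = subtopology (product_topology (\<lambda>_. discrete_topology UNIV) UNIV) LO"

definition LO_isomorphic :: "(nat \<times> nat \<Rightarrow> bool) \<Rightarrow> (nat \<times> nat \<Rightarrow> bool) \<Rightarrow> bool" where
  "LO_isomorphic r s \<longleftrightarrow>
     (\<exists>\<pi>. bij \<pi> \<and> (\<forall>m n. r (m, n) \<longleftrightarrow> s (\<pi> m, \<pi> n)))"

lemma topspace_LO_space: "topspace LO_space = LO"
  by (simp add: LO_space_def)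

end

theory Submission
  imports Defs "HOL-Real_Asymp.Real_Asymp"
begin

text \<open>By the Mostert--Shields decomposition a continuous t-norm is determined, up to isomorphism, by the
  order of its components: the components of the open set of non-idempotents, each of which is
  either nilpotent (Lukasiewicz) or strict (product), and the components of the interior of the
  set of idempotents, on which the t-norm is the minimum. Their union is dense, so an order
  isomorphism between the labelled orders of components lifts to the unit interval: on
  Archimedean components through additive generators, elsewhere affinely, and then by density.
  Each component is represented by the first rational in it, so the order of components is Borel
  in the t-norm; a label \<open>k\<close> is stored in a linear order by replacing the component
  with a chain of \<open>k + 2\<close> points followed by a copy of the rationals.

  Conversely, a linear order on the natural numbers yields intervals of length \<open>2 ^ - (n + 1)\<close>
  in the prescribed order, whose union is dense in the unit interval. The ordinal sum of
  Lukasiewicz t-norms on them depends continuously on the order, and an isomorphism of ordinal sums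
  permutes the intervals because it preserves idempotents.\<close>

section \<open>Additive generators of Archimedean intervals\<close>

text \<open>The dense set of component points is not closed under the t-norm: in a nilpotent
  component a product can drop to the left end point, which lies in no component. Homomorphy is
  therefore expressed by the relation \<open>f (x, y) \<le> z\<close> between three points of the
  dense set. A generator turns it into \<open>g z \<le> g x + g y\<close> without any truncation at
  the bottom, and by density it determines the product. Once a bounded generator is scaled to the
  range (0,1), any two components of the same type can be matched, so a label with finitely many
  values suffices. Intervals of idempotents have to count as components: otherwise two summands
  meeting in one point could not be told from two summands with such an interval between them. In
  the other direction the lengths belong to the indices and not to the positions in the order, so an
  isomorphism of orders changes lengths. Lukasiewicz summands can be rescaled, and the decay of the
  lengths makes late indices negligible in the sup metric.\<close>

lemma dyadic_le_iff: "real (2 ^ n * k) \<le> real (2 ^ m * K) \<longleftrightarrow> real k / 2 ^ m \<le> real K / 2 ^ n"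
proof -
  have "real k / 2 ^ m = real (2 ^ n * k) / 2 ^ (n + m)" "real K / 2 ^ n = real (2 ^ m * K) / 2 ^ (n + m)"
    by (simp_all add: power_add)
  then show ?thesis by (simp only: divide_le_cancel) simp
qed

text \<open>The last assumption is the Archimedean property: no idempotents strictly between the
  ends. The ends are idempotent, \<open>b\<close> as unit and \<open>a\<close> as zero
  (\<open>mul_bot\<close>).\<close>

locale archimedean_interval =
  fixes mul :: "real \<Rightarrow> real \<Rightarrow> real" (infixl "\<odot>" 70) and a b :: real
  assumes a_less_b: "a < b"
    and closed: "x \<in> {a..b} \<Longrightarrow> y \<in> {a..b} \<Longrightarrow> x \<odot> y \<in> {a..b}"
    and assoc: "x \<in> {a..b} \<Longrightarrow> y \<in> {a..b} \<Longrightarrow> z \<in> {a..b} \<Longrightarrow> (x \<odot> y) \<odot> z = x \<odot> (y \<odot> z)"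
    and commute: "x \<in> {a..b} \<Longrightarrow> y \<in> {a..b} \<Longrightarrow> x \<odot> y = y \<odot> x"
    and unit: "x \<in> {a..b} \<Longrightarrow> b \<odot> x = x"
    and mono: "x \<in> {a..b} \<Longrightarrow> x' \<in> {a..b} \<Longrightarrow> y \<in> {a..b} \<Longrightarrow> y' \<in> {a..b} \<Longrightarrow>
      x \<le> x' \<Longrightarrow> y \<le> y' \<Longrightarrow> x \<odot> y \<le> x' \<odot> y'"
    and cont: "continuous_on ({a..b} \<times> {a..b}) (\<lambda>p. fst p \<odot> snd p)"
    and nonidem: "a < x \<Longrightarrow> x < b \<Longrightarrow> x \<odot> x < x"
begin

lemma tendsto_mul:
  assumes "X \<longlonglongrightarrow> x" "Y \<longlonglongrightarrow> y" "\<And>n. X n \<in> {a..b}" "\<And>n. Y n \<in> {a..b}"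
  shows "(\<lambda>n. X n \<odot> Y n) \<longlonglongrightarrow> x \<odot> y"
proof -
  have "x \<in> {a..b}" "y \<in> {a..b}"
    using assms closed_sequentially[of "{a..b}"] by (metis closed_atLeastAtMost)+
  then have "(x, y) \<in> {a..b} \<times> {a..b}" "\<forall>n. (X n, Y n) \<in> {a..b} \<times> {a..b}"
    using assms by auto
  moreover have "(\<lambda>n. (X n, Y n)) \<longlonglongrightarrow> (x, y)"
    by (intro tendsto_Pair assms)
  ultimately have "((\<lambda>p. fst p \<odot> snd p) \<circ> (\<lambda>n. (X n, Y n))) \<longlonglongrightarrow> fst (x, y) \<odot> snd (x, y)"
    using cont[unfolded continuous_on_sequentially, rule_format, of "(x, y)" "\<lambda>n. (X n, Y n)"] by simp
  then show ?thesis by (simp add: o_def)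
qed

lemma mul_le: "x \<in> {a..b} \<Longrightarrow> y \<in> {a..b} \<Longrightarrow> x \<odot> y \<le> x"
  using mono[of x x y b] unit[of x] commute[of x b] a_less_b by auto

lemma mul_bot: "x \<in> {a..b} \<Longrightarrow> x \<odot> a = a"
  using mul_le[of a x] closed[of a x] commute[of x a] a_less_b by fastforce

text \<open>Intermediate value theorem: \<open>y \<odot> z\<close> runs continuously from
  \<open>a\<close> to \<open>y\<close> as \<open>z\<close> runs from \<open>a\<close> to
  \<open>b\<close>. Thus the order is the divisibility order.\<close>

lemma divides:
  assumes "x \<in> {a..b}" "y \<in> {a..b}" "x \<le> y"
  obtains z where "z \<in> {a..b}" "y \<odot> z = x"
proof -
  have "continuous_on {a..b} ((\<lambda>p. fst p \<odot> snd p) \<circ> (\<lambda>z. (y, z)))"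
    by (rule continuous_on_compose[OF _ continuous_on_subset[OF cont]])
       (use assms in \<open>auto intro!: continuous_intros\<close>)
  then have "continuous_on {a..b} (\<lambda>z. y \<odot> z)"
    by (simp add: o_def)
  moreover have "y \<odot> a \<le> x" "x \<le> y \<odot> b"
    using assms mul_bot[of y] unit[of y] commute[of y b] a_less_b by auto
  ultimately show ?thesis
    using IVT'[of "\<lambda>z. y \<odot> z" a x b] a_less_b that by auto
qed

lemma root_exists:
  assumes "a < x" "x < b"
  obtains y where "a < y" "y < b" "y \<odot> y = x"
proof -
  have "continuous_on {a..b} ((\<lambda>p. fst p \<odot> snd p) \<circ> (\<lambda>z. (z, z)))"
    by (rule continuous_on_compose[OF _ continuous_on_subset[OF cont]])
       (auto intro!: continuous_intros)
  then have "continuous_on {a..b} (\<lambda>z. z \<odot> z)"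
    by (simp add: o_def)
  moreover have "a \<odot> a \<le> x" "x \<le> b \<odot> b"
    using assms mul_bot[of a] unit[of b] a_less_b by auto
  ultimately obtain y where y: "a \<le> y" "y \<le> b" "y \<odot> y = x"
    using IVT'[of "\<lambda>z. z \<odot> z" a x b] a_less_b by auto
  have "y \<noteq> a" "y \<noteq> b"
    using y assms mul_bot[of a] unit[of b] a_less_b by auto
  with y show ?thesis by (intro that[of y]) auto
qed

abbreviation pw :: "real \<Rightarrow> nat \<Rightarrow> real" where
  "pw x n \<equiv> (((\<odot>) x) ^^ n) b"

lemma pw_closed: "x \<in> {a..b} \<Longrightarrow> pw x n \<in> {a..b}"
  by (induction n) (use closed a_less_b in auto)

lemma pw_one: "x \<in> {a..b} \<Longrightarrow> pw x 1 = x"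
  using unit commute[of x b] a_less_b by auto

lemma pw_add: "x \<in> {a..b} \<Longrightarrow> pw x (m + n) = pw x m \<odot> pw x n"
proof (induction m)
  case 0 then show ?case using unit pw_closed[of x n] by auto
next
  case (Suc m) then show ?case using assoc[of x "pw x m" "pw x n"] pw_closed[of x] by simp
qed

lemma pw_mult: "x \<in> {a..b} \<Longrightarrow> pw x (m * n) = pw (pw x m) n"
  by (induction n) (auto simp: pw_add)

lemma pw_antimono: "x \<in> {a..b} \<Longrightarrow> m \<le> n \<Longrightarrow> pw x n \<le> pw x m"
  using pw_add[of x m "n - m"] mul_le[of "pw x m" "pw x (n - m)"] pw_closed[of x] by simp

text \<open>The decreasing powers have a limit \<open>p\<close>. The subsequence of even exponents
  shows that \<open>p\<close> is idempotent, and \<open>p < b\<close> leaves only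
  \<open>a\<close>.\<close>

lemma pw_tendsto:
  assumes "a \<le> x" "x < b"
  shows "pw x \<longlonglongrightarrow> a"
proof -
  have x: "x \<in> {a..b}" using assms by auto
  have dec: "decseq (pw x)"
    using pw_antimono[OF x] by (auto simp: decseq_def)
  have *: "\<forall>n. a \<le> pw x n" using pw_closed[OF x] by auto
  obtain p where p: "pw x \<longlonglongrightarrow> p" "\<And>n. p \<le> pw x n"
    using decseq_convergent[OF dec *] by auto
  have "a \<le> p" using LIMSEQ_le_const[OF p(1)] * by auto
  have "p < b" using p(2)[of 1] pw_one[OF x] assms by auto
  have "strict_mono (\<lambda>n::nat. n + n)" by (auto simp: strict_mono_def)
  from LIMSEQ_subseq_LIMSEQ[OF p(1) this] have "(\<lambda>n. pw x (n + n)) \<longlonglongrightarrow> p"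
    by (simp add: o_def)
  moreover have "(\<lambda>n. pw x n \<odot> pw x n) \<longlonglongrightarrow> p \<odot> p"
    by (rule tendsto_mul) (use p pw_closed[OF x] in auto)
  ultimately have "p \<odot> p = p"
    using pw_add[OF x] LIMSEQ_unique by (metis (no_types, lifting) ext)
  then have "p = a" using nonidem[of p] \<open>a \<le> p\<close> \<open>p < b\<close> by force
  with p show ?thesis by auto
qed

text \<open>If \<open>y\<close> fixed \<open>x\<close>, so would every power of \<open>y\<close>,
  and in the limit \<open>a\<close> would, forcing \<open>x = a\<close>.\<close>

lemma mul_less:
  assumes "a < x" "x \<le> b" "a \<le> y" "y < b"
  shows "x \<odot> y < x"
proof (rule ccontr)
  assume "\<not> ?thesis"
  then have eq: "x \<odot> y = x" using mul_le[of x y] assms by auto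
  have "x \<odot> pw y n = x" for n
  proof (induction n)
    case 0 then show ?case using unit commute[of x b] assms by auto
  next
    case (Suc n)
    have "x \<odot> (y \<odot> pw y n) = (x \<odot> y) \<odot> pw y n"
      by (rule assoc[symmetric]) (use assms pw_closed[of y n] in auto)
    then show ?case using Suc eq by simp
  qed
  moreover have "(\<lambda>n. x \<odot> pw y n) \<longlonglongrightarrow> x \<odot> a"
    by (rule tendsto_mul) (use assms pw_tendsto pw_closed[of y] in auto)
  ultimately show False
    using mul_bot[of x] assms by (simp add: LIMSEQ_const_iff)
qed

text \<open>Powers of a nilpotent element become constant once they reach \<open>a\<close>, so a
  weak inequality between powers compares the exponents only while the larger power is above
  \<open>a\<close>.\<close>

lemma pw_less_cancel:
  assumes "a \<le> x" "x < b" "pw x n < pw x m \<or> (pw x n \<le> pw x m \<and> a < pw x m)"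
  shows "m \<le> n"
proof (rule ccontr)
  assume "\<not> m \<le> n"
  then have n: "Suc n \<le> m" by auto
  have x: "x \<in> {a..b}" using assms by auto
  have le: "pw x m \<le> pw x n" using pw_antimono[OF x, of n m] n by auto
  then have an: "a < pw x n" using assms(3) by auto
  have "pw x (Suc n) < pw x n"
    using mul_less[OF an _ assms(1,2)] pw_closed[OF x, of n] commute[OF x, of "pw x n"] by auto
  then show False using pw_antimono[OF x n] assms(3) le by auto
qed

end

section \<open>Dyadic exponents and the generator\<close>

locale archimedean_roots = archimedean_interval +
  fixes u :: "nat \<Rightarrow> real"
  assumes u_bounds: "a < u n" "u n < b"
    and u_Suc: "u (Suc n) \<odot> u (Suc n) = u n"
begin

lemma u_in: "u n \<in> {a..b}"
  using u_bounds[of n] by auto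

lemma u_le [simp]: "a \<le> u n" "u n \<le> b"
  using u_in[of n] by auto

lemma u_shift: "pw (u (n + m)) (2 ^ m) = u n"
proof (induction m)
  case 0 then show ?case using pw_one[OF u_in] by auto
next
  case (Suc m)
  have "pw (u (Suc (n + m))) (2 * 2 ^ m) = pw (pw (u (Suc (n + m))) 2) (2 ^ m)"
    by (rule pw_mult) simp
  also have "pw (u (Suc (n + m))) 2 = u (n + m)"
    using pw_add[OF u_in[of "Suc (n + m)"], of 1 1] pw_one[OF u_in[of "Suc (n+m)"]] u_Suc
    by (metis one_add_one)
  finally show ?case using Suc by simp
qed

text \<open>Together with \<open>pw_u_shift'\<close> this brings powers of different roots to the
  common base \<open>u (n + m)\<close>, like fractions to a common denominator.\<close>

lemma pw_u_shift: "pw (u (n + m)) (2 ^ m * k) = pw (u n) k"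
  using pw_mult[OF u_in[of "n + m"], of "2 ^ m" k] u_shift[where n = n and m = m] by simp

lemma pw_u_shift': "pw (u (n + m)) (2 ^ n * k) = pw (u m) k"
  unfolding add.commute[of n m] by (rule pw_u_shift)

text \<open>Passing to the limit in \<open>u_Suc\<close> makes the limit idempotent, and it is at
  least \<open>u 0\<close>, hence above \<open>a\<close>.\<close>

lemma u_tendsto: "u \<longlonglongrightarrow> b"
proof -
  have inc: "incseq u"
    by (rule incseq_SucI) (metis mul_le u_Suc u_in)
  have "\<And>n. u n \<le> b" using u_bounds less_imp_le by auto
  from incseq_convergent[OF inc, of b] this obtain p where p: "u \<longlonglongrightarrow> p" "\<And>n. u n \<le> p"
    by auto
  have "p \<le> b" using LIMSEQ_le_const2[OF p(1)] \<open>\<And>n. u n \<le> b\<close> by auto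
  have "a < p" using p(2)[of 0] u_bounds(1)[of 0] by auto
  have "(\<lambda>n. u (Suc n) \<odot> u (Suc n)) \<longlonglongrightarrow> p \<odot> p"
    by (rule tendsto_mul) (use p LIMSEQ_Suc u_in in auto)
  then have "p \<odot> p = p" using u_Suc p(1) LIMSEQ_unique by auto
  then have "p = b" using nonidem[of p] \<open>a < p\<close> \<open>p \<le> b\<close> by force
  with p show ?thesis by simp
qed

lemma u_eventually_ge:
  assumes "w < b"
  obtains n where "w \<le> u n"
proof -
  have "eventually (\<lambda>n. w < u n) sequentially"
    by (rule order_tendstoD(1)[OF u_tendsto assms])
  then have "\<exists>n. w < u n" by (rule eventually_happens'[OF sequentially_bot])
  then show ?thesis using that less_imp_le by blast
qed

text \<open>As \<^term>\<open>u n\<close> is an iterated square root of \<^term>\<open>u 0\<close>, the element \<^term>\<open>pw (u n) k\<close> is the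
  power of \<^term>\<open>u 0\<close> with exponent \<^term>\<open>real k / 2 ^ n\<close>.\<close>

definition degs :: "real \<Rightarrow> real set" where
  "degs x = {real k / 2 ^ n | k n. x \<le> pw (u n) k}"

text \<open>The logarithm of \<open>x\<close> to the base \<open>u 0\<close>. It is meaningful only
  above \<open>a\<close>: every power is at least \<open>a\<close>, so \<open>degs a\<close> is
  unbounded.\<close>

definition gen :: "real \<Rightarrow> real" where
  "gen x = Sup (degs x)"

lemma degs_zero: "x \<le> b \<Longrightarrow> 0 \<in> degs x"
  unfolding degs_def by (auto intro!: exI[of _ 0])

lemma exists_pw_less:
  assumes "a < x"
  obtains K where "pw (u n) K < x"
proof -
  have "eventually (\<lambda>K. pw (u n) K < x) sequentially"
    by (rule order_tendstoD(2)[OF pw_tendsto assms]) (use u_bounds in auto)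
  then have "\<exists>K. pw (u n) K < x" by (rule eventually_happens'[OF sequentially_bot])
  then show ?thesis using that by blast
qed

text \<open>Both powers are rewritten over the root \<open>u (n + m)\<close>, where
  \<open>pw_less_cancel\<close> compares the exponents.\<close>

lemma degs_lessD:
  assumes x: "a < x" and K: "pw (u n) K < x" and d: "d \<in> degs x"
  shows "d \<le> K / 2 ^ n"
proof -
  obtain k m where k: "d = real k / 2 ^ m" "x \<le> pw (u m) k"
    using d unfolding degs_def by auto
  have "pw (u (n + m)) (2 ^ m * K) < pw (u (n + m)) (2 ^ n * k)"
    using less_le_trans[OF K k(2)] by (subst pw_u_shift, subst pw_u_shift')
  then have "2 ^ n * k \<le> 2 ^ m * K"
    by (intro pw_less_cancel[OF u_le(1) u_bounds(2)] disjI1)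
  then have "real (2 ^ n * k) \<le> real (2 ^ m * K)"
    by (rule of_nat_mono)
  then show ?thesis
    unfolding k(1) by (simp only: dyadic_le_iff)
qed
lemma degs_bdd:
  assumes "a < x"
  shows "bdd_above (degs x)"
proof -
  obtain K where "pw (u 0) K < x" using exists_pw_less[OF assms] by blast
  then show ?thesis using degs_lessD[OF assms] by (intro bdd_aboveI) blast
qed

lemma gen_upper: "a < x \<Longrightarrow> d \<in> degs x \<Longrightarrow> d \<le> gen x"
  unfolding gen_def by (rule cSup_upper) (auto simp: degs_bdd)

lemma gen_least: "x \<le> b \<Longrightarrow> (\<And>d. d \<in> degs x \<Longrightarrow> d \<le> c) \<Longrightarrow> gen x \<le> c"
  unfolding gen_def by (rule cSup_least) (use degs_zero in auto)

lemma gen_approx: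
  assumes "a < x" "x \<le> b"
  obtains k where "x \<le> pw (u n) k" "pw (u n) (Suc k) < x" "real k / 2 ^ n \<le> gen x"
    "gen x \<le> real (Suc k) / 2 ^ n"
proof -
  obtain K where K: "pw (u n) K < x"
    using exists_pw_less assms(1) by blast
  define k where "k = (LEAST k. pw (u n) (Suc k) < x)"
  \<comment> \<open>Since \<open>pw (u n) 0 = b\<close> is at least \<open>x\<close>, the exponent
    \<open>K\<close> is positive and \<open>K - 1\<close> witnesses the search for
    \<open>k\<close>.\<close>
  have "K \<noteq> 0" using K assms by (metis funpow_0 not_less)
  then have 1: "pw (u n) (Suc k) < x"
    unfolding k_def using LeastI[of "\<lambda>k. pw (u n) (Suc k) < x" "K - 1"] K by fastforce
  have 2: "x \<le> pw (u n) k"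
  proof (cases k)
    case 0 then show ?thesis using assms by auto
  next
    case (Suc j)
    then show ?thesis using not_less_Least[of j "\<lambda>k. pw (u n) (Suc k) < x"] unfolding k_def
      by fastforce
  qed
  have "real k / 2 ^ n \<in> degs x" using 2 unfolding degs_def by auto
  then have "real k / 2 ^ n \<le> gen x" by (rule gen_upper[OF assms(1)])
  moreover have "gen x \<le> real (Suc k) / 2 ^ n"
    by (rule gen_least[OF assms(2)]) (rule degs_lessD[OF assms(1) 1])
  ultimately show ?thesis using that 1 2 by blast
qed

text \<open>The slack \<open>2 / 2 ^ n\<close> is the rounding error of two dyadic approximations at
  level \<open>n\<close>, one for each factor of a product.\<close>

lemma le_if_le_add_inverse_power:
  assumes "\<And>n. c \<le> d + 2 / 2 ^ n"
  shows "c \<le> (d :: real)"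
proof (rule LIMSEQ_le_const)
  have "(\<lambda>n. 2 * (1 / 2) ^ n :: real) \<longlonglongrightarrow> 2 * 0"
    by (intro tendsto_mult tendsto_const LIMSEQ_power_zero) auto
  then have "(\<lambda>n. d + 2 * (1 / 2) ^ n) \<longlonglongrightarrow> d + 2 * 0"
    by (rule tendsto_add[OF tendsto_const])
  then show "(\<lambda>n. d + 2 * (1 / 2) ^ n) \<longlonglongrightarrow> d" by simp
  show "\<exists>N. \<forall>n\<ge>N. c \<le> d + 2 * (1 / 2) ^ n"
    using assms by (auto simp: power_one_over divide_simps)
qed

text \<open>\<open>x\<close> and \<open>y\<close> are bounded below by powers of \<open>u n\<close>
  with exponents \<open>Suc i\<close> and \<open>Suc j\<close>, so the power with the summed
  exponent is at most \<open>z\<close>. The assumption \<open>a < z\<close> admits the weak case of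
  \<open>pw_less_cancel\<close>.\<close>

lemma gen_le:
  assumes x: "a < x" "x \<le> b" and y: "a < y" "y \<le> b" and z: "a < z" "z \<le> b"
    and le: "x \<odot> y \<le> z"
  shows "gen z \<le> gen x + gen y"
proof (rule le_if_le_add_inverse_power)
  fix n
  obtain i where i: "pw (u n) (Suc i) < x" "real i / 2 ^ n \<le> gen x" using gen_approx[OF x] by metis
  obtain j where j: "pw (u n) (Suc j) < y" "real j / 2 ^ n \<le> gen y" using gen_approx[OF y] by metis
  have "pw (u n) (Suc i + Suc j) \<le> x \<odot> y"
    unfolding pw_add[OF u_in] using i j x y
    by (intro mono) (use pw_closed[OF u_in[of n], of "Suc i"] pw_closed[OF u_in[of n], of "Suc j"] in \<open>auto simp del: funpow.simps\<close>)
  then have *: "pw (u n) (Suc i + Suc j) \<le> z" using le by simp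
  have "d \<le> real (Suc i + Suc j) / 2 ^ n" if d: "d \<in> degs z" for d
  proof -
    obtain k m where k: "d = real k / 2 ^ m" "z \<le> pw (u m) k"
      using d unfolding degs_def by auto
    have "pw (u (n + m)) (2 ^ m * (Suc i + Suc j)) \<le> pw (u (n + m)) (2 ^ n * k)"
      "a < pw (u (n + m)) (2 ^ n * k)"
      unfolding pw_u_shift pw_u_shift' using k(2) * z(1) by simp_all
    then have "2 ^ n * k \<le> 2 ^ m * (Suc i + Suc j)"
      by (intro pw_less_cancel[OF u_le(1) u_bounds(2)] disjI2 conjI)
    then have "real (2 ^ n * k) \<le> real (2 ^ m * (Suc i + Suc j))"
      by (rule of_nat_mono)
    then show ?thesis
      unfolding k(1) by (simp only: dyadic_le_iff)
  qed
  from gen_least[OF z(2) this] have "gen z \<le> real (Suc i + Suc j) / 2 ^ n" .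
  also have "\<dots> = real i / 2 ^ n + real j / 2 ^ n + 2 / 2 ^ n"
    by (simp add: field_simps)
  finally show "gen z \<le> gen x + gen y + 2 / 2 ^ n" using i j by linarith
qed

text \<open>Strictness comes from the cofactor \<open>w\<close> with
  \<open>(x \<odot> y) \<odot> w = z\<close>: it lies below some \<open>u n0\<close> and so adds
  \<open>1 / 2 ^ n0\<close> to the exponent, an amount that does not depend on the precision
  \<open>n\<close>.\<close>

lemma gen_add_less:
  assumes x: "a < x" "x \<le> b" and y: "a < y" "y \<le> b" and z: "a < z" "z \<le> b"
    and less: "z < x \<odot> y"
  shows "gen x + gen y < gen z"
proof -
  have xy: "x \<odot> y \<in> {a..b}" using closed x y by auto
  obtain w where w: "w \<in> {a..b}" "(x \<odot> y) \<odot> w = z"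
    using divides[of z "x \<odot> y"] xy z less by auto
  have "w \<noteq> b" using w less unit[OF xy] commute[OF xy, of b] a_less_b by auto
  then obtain n0 where n0: "w \<le> u n0" using u_eventually_ge[of w] w by auto
  have "gen x + gen y + 1 / 2 ^ n0 \<le> gen z"
  proof (rule le_if_le_add_inverse_power)
    fix n
    obtain i where i: "x \<le> pw (u (n0 + n)) i" "gen x \<le> real (Suc i) / 2 ^ (n0 + n)"
      using gen_approx[OF x] by metis
    obtain j where j: "y \<le> pw (u (n0 + n)) j" "gen y \<le> real (Suc j) / 2 ^ (n0 + n)"
      using gen_approx[OF y] by metis
    have "x \<odot> y \<le> pw (u (n0 + n)) (i + j)"
      unfolding pw_add[OF u_in] using i j x y
      by (intro mono) (use pw_closed[OF u_in[of "n0 + n"], of i] pw_closed[OF u_in[of "n0 + n"], of j] in auto)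
    \<comment> \<open>The bound \<open>u n0\<close> of \<open>w\<close> is the power of
      \<open>u (n0 + n)\<close> with exponent \<open>2 ^ n\<close>.\<close>
    then have "(x \<odot> y) \<odot> w \<le> pw (u (n0 + n)) (i + j + 2 ^ n)"
      unfolding pw_add[OF u_in[of "n0 + n"], of "i + j" "2 ^ n"] u_shift
      by (intro mono) (use n0 w xy pw_closed[OF u_in[of "n0 + n"], of "i + j"] in auto)
    then have "real (i + j + 2 ^ n) / 2 ^ (n0 + n) \<in> degs z"
      unfolding degs_def w(2) by blast
    then have "real (i + j + 2 ^ n) / 2 ^ (n0 + n) \<le> gen z"
      by (rule gen_upper[OF z(1)])
    moreover have "real (i + j + 2 ^ n) / 2 ^ (n0 + n) =
      real (Suc i) / 2 ^ (n0 + n) + real (Suc j) / 2 ^ (n0 + n) - 2 / 2 ^ (n0 + n) + 1 / 2 ^ n0"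
      by (simp add: field_simps power_add)
    moreover have "2 / 2 ^ (n0 + n) \<le> (2::real) / 2 ^ n"
      by (intro divide_left_mono power_increasing) auto
    ultimately show "gen x + gen y + 1 / 2 ^ n0 \<le> gen z + 2 / 2 ^ n"
      using i(2) j(2) by linarith
  qed
  moreover have "(0::real) < 1 / 2 ^ n0" by simp
  ultimately show ?thesis by linarith
qed

lemma gen_rel:
  assumes "x \<in> {a<..b}" "y \<in> {a<..b}" "z \<in> {a<..b}"
  shows "x \<odot> y \<le> z \<longleftrightarrow> gen z \<le> gen x + gen y"
  using gen_le[of x y z] gen_add_less[of x y z] assms by force

lemma gen_top: "gen b = 0"
proof (rule antisym)
  have "d \<le> 0" if d: "d \<in> degs b" for d
  proof -
    obtain k n where k: "d = real k / 2 ^ n" "b \<le> pw (u n) k"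
      using d unfolding degs_def by auto
    have "k \<le> 0"
      using pw_less_cancel[of "u n" 0 k] u_bounds[of n] k(2) a_less_b by auto
    then show ?thesis using k by simp
  qed
  then show "gen b \<le> 0" by (intro gen_least) auto
  show "0 \<le> gen b" using gen_upper[OF a_less_b degs_zero] by auto
qed

lemma gen_le_iff:
  assumes "x \<in> {a<..b}" "z \<in> {a<..b}"
  shows "x \<le> z \<longleftrightarrow> gen z \<le> gen x"
  using gen_rel[of x b z] gen_top assms unit[of x] commute[of x b] by auto

text \<open>The constant 2 comes from \<open>pw (u n) 2 < u n\<close>. Only the convergence of the
  bound to 0 matters.\<close>

lemma gen_u_le: "gen (u n) \<le> 2 / 2 ^ n"
proof (rule gen_least)
  have "pw (u n) 2 < u n"
    using nonidem[OF u_bounds] pw_add[OF u_in[of n], of 1 1] pw_one[OF u_in[of n]]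
    by (metis one_add_one)
  then show "d \<le> 2 / 2 ^ n" if "d \<in> degs (u n)" for d
    using degs_lessD[OF u_bounds(1) _ that, where n = n and K = 2] by simp
qed (use u_bounds less_imp_le in auto)

lemma eventually_gen_u_less:
  assumes "0 < e"
  shows "eventually (\<lambda>n. gen (u n) < e) sequentially"
proof -
  have "(\<lambda>n. 2 * (1 / 2) ^ n :: real) \<longlonglongrightarrow> 2 * 0"
    by (intro tendsto_mult tendsto_const LIMSEQ_power_zero) auto
  then have "eventually (\<lambda>n. 2 * (1 / 2) ^ n < e) sequentially"
    using order_tendstoD(2) assms by fastforce
  then show ?thesis
  proof (rule eventually_mono)
    fix n assume "2 * (1 / 2) ^ n < e"
    then show "gen (u n) < e" using gen_u_le[of n] by (simp add: power_one_over)
  qed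
qed

lemma gen_surj:
  assumes x: "a < x" "x \<le> b" and s: "0 \<le> s" "s \<le> gen x"
  obtains p where "p \<in> {a<..b}" "gen p = s"
proof -
  define X where "X = {y \<in> {a<..b}. s \<le> gen y}"
  have X: "x \<in> X" "bdd_above X" using x s by (auto simp: X_def)
  define p where "p = Sup X"
  have "x \<le> p" unfolding p_def using X by (rule cSup_upper)
  have "p \<le> b" unfolding p_def using X(1) by (intro cSup_least) (auto simp: X_def)
  have p: "p \<in> {a<..b}" using \<open>x \<le> p\<close> \<open>p \<le> b\<close> x by auto
  have "\<not> s < gen p"
  proof
    assume *: "s < gen p"
    then have "p < b" using gen_top s p by (cases "p = b") auto
    have "eventually (\<lambda>n. gen (u n) < gen p - s \<and> p < u n) sequentially"
      using eventually_gen_u_less[of "gen p - s"] * order_tendstoD(1)[OF u_tendsto \<open>p < b\<close>]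
      by (auto intro: eventually_conj)
    then obtain n where n: "gen (u n) < gen p - s" "p < u n"
      using eventually_happens'[OF sequentially_bot] by blast
    obtain y where y: "y \<in> {a..b}" "u n \<odot> y = p"
      using divides[of p "u n"] p n by auto
    have "p \<le> y" using mul_le[OF y(1) u_in, of n] y commute[OF u_in y(1), of n] by simp
    moreover have "y \<noteq> p"
      using mul_less[of p "u n"] p u_bounds[of n] y commute[OF u_in y(1), of n] by auto
    ultimately have "p < y" "y \<in> {a<..b}" using p y by auto
    have "gen p \<le> gen (u n) + gen y"
      using gen_rel[of "u n" y p] y \<open>y \<in> {a<..b}\<close> p u_bounds[of n] by auto
    then have "y \<in> X" unfolding X_def using \<open>y \<in> {a<..b}\<close> n by auto
    then show False using cSup_upper[OF _ X(2)] \<open>p < y\<close> p_def by fastforce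
  qed
  moreover have "\<not> gen p < s"
  proof
    assume *: "gen p < s"
    have "(\<lambda>n. p \<odot> u n) \<longlonglongrightarrow> p \<odot> b"
      by (rule tendsto_mul) (use u_tendsto p u_in in auto)
    also have "p \<odot> b = p" using unit[of p] commute[of p b] p by auto
    finally have "eventually (\<lambda>n. a < p \<odot> u n) sequentially"
      using order_tendstoD(1) p by fastforce
    then have "eventually (\<lambda>n. gen (u n) < s - gen p \<and> a < p \<odot> u n) sequentially"
      using eventually_gen_u_less[of "s - gen p"] * by (auto intro: eventually_conj)
    then obtain n where n: "gen (u n) < s - gen p" "a < p \<odot> u n"
      using eventually_happens'[OF sequentially_bot] by blast
    define y where "y = p \<odot> u n"
    have y: "y < p" "y \<in> {a<..b}"
      unfolding y_def using mul_less[of p "u n"] p u_bounds[of n] n by auto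
    have "gen y \<le> gen p + gen (u n)"
      using gen_rel[of p "u n" y] y p u_bounds[of n] y_def by auto
    then have "gen y < s" using n by linarith
    then have "z \<le> y" if "z \<in> X" for z
      using that gen_le_iff[of y z] y unfolding X_def by force
    then have "p \<le> y" unfolding p_def using X(1) by (intro cSup_least) auto
    then show False using y by auto
  qed
  ultimately show ?thesis using p that by force
qed

section \<open>Range and normalisation of the generator\<close>

lemma gen_pos: "x \<in> {a<..<b} \<Longrightarrow> 0 < gen x"
  using gen_le_iff[of b x] gen_top a_less_b by fastforce

lemma exists_gen_greater: "x \<in> {a<..b} \<Longrightarrow> \<exists>y\<in>{a<..<b}. gen x < gen y"
  using gen_le_iff[of x "(a + x) / 2"] by (intro bexI[of _ "(a + x) / 2"]) (auto simp: not_le[symmetric])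

lemma inj_gen: "inj_on gen {a<..b}"
  by (rule inj_onI) (metis antisym gen_le_iff order_refl)

lemma gen_image_unbounded:
  assumes "\<And>c. \<exists>x\<in>{a<..<b}. c \<le> gen x"
  shows "gen ` {a<..<b} = {0<..}"
proof (intro equalityI subsetI)
  fix s :: real assume s: "s \<in> {0<..}"
  obtain x where x: "x \<in> {a<..<b}" "s \<le> gen x" using assms by blast
  obtain p where p: "p \<in> {a<..b}" "gen p = s"
    using gen_surj[of x s] x s by auto
  have "p \<noteq> b" using p s gen_top by auto
  then show "s \<in> gen ` {a<..<b}" using p by auto
qed (use gen_pos in auto)

text \<open>The supremum \<open>L\<close> is not attained, because below each point of the interval
  there is another with a larger value; all smaller positive values are attained by
  \<open>gen_surj\<close>.\<close>

lemma gen_image_bounded: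
  assumes "\<And>x. x \<in> {a<..<b} \<Longrightarrow> gen x \<le> c"
  obtains L where "0 < L" "gen ` {a<..<b} = {0<..<L}"
proof -
  define L where "L = Sup (gen ` {a<..<b})"
  have bdd: "bdd_above (gen ` {a<..<b})" using assms by (rule bdd_aboveI2)
  have up: "gen x < L" if x: "x \<in> {a<..<b}" for x
  proof -
    obtain y where "y \<in> {a<..<b}" "gen x < gen y" using exists_gen_greater[of x] x by auto
    then show ?thesis unfolding L_def using cSup_upper[OF _ bdd] by fastforce
  qed
  have "gen ` {a<..<b} = {0<..<L}"
  proof (intro equalityI subsetI)
    fix s assume s: "s \<in> {0<..<L}"
    then obtain x where x: "x \<in> {a<..<b}" "s < gen x"
      using less_cSup_iff[OF _ bdd, of s] a_less_b unfolding L_def by auto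
    obtain p where p: "p \<in> {a<..b}" "gen p = s"
      using gen_surj[of x s] x s by auto
    have "p \<noteq> b" using p s gen_top by auto
    then show "s \<in> gen ` {a<..<b}" using p by auto
  qed (use gen_pos up in auto)
  moreover have "0 < L"
    using up[of "(a + b) / 2"] gen_pos[of "(a + b) / 2"] a_less_b by auto
  ultimately show ?thesis using that by blast
qed

end

context archimedean_interval
begin

lemma roots_exist:
  obtains u where "archimedean_roots (\<odot>) a b u"
proof -
  define P where "P x \<longleftrightarrow> a < x \<and> x < b" for x
  obtain u where u: "\<And>n. P (u n)" "\<And>n. u (Suc n) \<odot> u (Suc n) = u n"
    using dependent_nat_choice[of "\<lambda>_. P" "\<lambda>_ x y. y \<odot> y = x"] dense[OF a_less_b] root_exists
    unfolding P_def by metis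
  show ?thesis
    by (rule that[of u]) (unfold_locales, use u in \<open>auto simp: P_def\<close>)
qed

text \<open>\<open>nil\<close> says that the square of some interior point is the bottom, which
  holds exactly if the generator is bounded. In that case dividing by the supremum of its values
  makes the range independent of the interval.\<close>

lemma additive_generator:
  defines "nil \<equiv> \<exists>r\<in>{a<..<b}. \<forall>s\<in>{a<..<b}. r \<odot> r \<le> s"
  obtains g :: "real \<Rightarrow> real" where
    "bij_betw g {a<..<b} (if nil then {0<..<1} else {0<..})"
    "\<And>x y. x \<in> {a<..<b} \<Longrightarrow> y \<in> {a<..<b} \<Longrightarrow> x \<le> y \<longleftrightarrow> g y \<le> g x"
    "\<And>x y z. x \<in> {a<..<b} \<Longrightarrow> y \<in> {a<..<b} \<Longrightarrow> z \<in> {a<..<b} \<Longrightarrow> x \<odot> y \<le> z \<longleftrightarrow> g z \<le> g x + g y"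
proof -
  obtain u where "archimedean_roots (\<odot>) a b u" by (rule roots_exist)
  then interpret archimedean_roots "(\<odot>)" a b u .
  have sub: "x \<in> {a<..<b} \<Longrightarrow> x \<in> {a<..b}" for x by auto
  have inj: "inj_on gen {a<..<b}" by (rule inj_on_subset[OF inj_gen]) auto
  show ?thesis
  proof (cases nil)
    case False
    have "\<exists>x\<in>{a<..<b}. c \<le> gen x" for c
    proof (rule ccontr)
      assume c: "\<not> (\<exists>x\<in>{a<..<b}. c \<le> gen x)"
      then obtain L where L: "0 < L" "gen ` {a<..<b} = {0<..<L}"
        using gen_image_bounded[of c] by (metis linear)
      \<comment> \<open>A point with value \<open>L / 2\<close> has a square below every interior
        point, so a bounded generator forces \<open>nil\<close>.\<close>
      then have "L / 2 \<in> gen ` {a<..<b}" by auto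
      then obtain r where r: "r \<in> {a<..<b}" "gen r = L / 2" by auto
      have "r \<odot> r \<le> s" if s: "s \<in> {a<..<b}" for s
      proof -
        have "gen s \<in> {0<..<L}" using L(2) s by blast
        then show ?thesis using gen_rel[of r r s] r s by auto
      qed
      with r False show False unfolding nil_def by blast
    qed
    then have "gen ` {a<..<b} = {0<..}" by (rule gen_image_unbounded)
    then have "bij_betw gen {a<..<b} (if nil then {0<..<1} else {0<..})"
      using False inj by (simp add: bij_betw_def)
    then show ?thesis
      by (rule that) (rule gen_le_iff gen_rel; erule sub)+
  next
    case True
    then obtain r where r: "r \<in> {a<..<b}" "\<And>s. s \<in> {a<..<b} \<Longrightarrow> r \<odot> r \<le> s"
      unfolding nil_def by blast
    have "gen s \<le> gen r + gen r" if "s \<in> {a<..<b}" for s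
      using gen_rel[of r r s] r that by auto
    then obtain L where L: "0 < L" "gen ` {a<..<b} = {0<..<L}"
      using gen_image_bounded by metis
    define g where "g x = gen x / L" for x
    have "g ` {a<..<b} = (\<lambda>x. x / L) ` {0<..<L}"
      unfolding L(2)[symmetric] g_def by auto
    also have "\<dots> = {0<..<1}"
    proof (intro equalityI subsetI)
      fix y :: real assume "y \<in> {0<..<1}"
      then have "y * L \<in> {0<..<L}" "y = y * L / L" using L(1) by simp_all
      then show "y \<in> (\<lambda>x. x / L) ` {0<..<L}" by (rule rev_image_eqI)
    qed (use L(1) in auto)
    finally have "bij_betw g {a<..<b} (if nil then {0<..<1} else {0<..})"
      using inj L(1) True by (auto simp: bij_betw_def g_def inj_on_def)
    moreover have "g y \<le> g x \<longleftrightarrow> gen y \<le> gen x" "g z \<le> g x + g y \<longleftrightarrow> gen z \<le> gen x + gen y" for x y z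
      using L(1) by (simp_all add: g_def divide_le_cancel flip: add_divide_distrib)
    ultimately show ?thesis
      by (intro that[of g]) (simp_all only: gen_le_iff[OF sub sub] gen_rel[OF sub sub sub])
  qed
qed

end

section \<open>Extension of order isomorphisms from dense sets\<close>

definition dense_in_unit :: "real set \<Rightarrow> bool" where
  "dense_in_unit D \<longleftrightarrow> D \<subseteq> {0..1} \<and> (\<forall>x y. 0 \<le> x \<and> x < y \<and> y \<le> 1 \<longrightarrow> (\<exists>d\<in>D. x < d \<and> d < y))"

text \<open>The inserted 0 keeps the supremum well defined where no point of \<open>D\<close> lies
  at or below \<open>x\<close>. It changes no other value, since \<open>h\<close> is used with
  values in the unit interval.\<close>

definition monotone_ext :: "real set \<Rightarrow> (real \<Rightarrow> real) \<Rightarrow> real \<Rightarrow> real" where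
  "monotone_ext D h x = Sup (insert 0 (h ` {d \<in> D. d \<le> x}))"

lemma monotone_ext:
  assumes "dense_in_unit D" "h ` D \<subseteq> {0..1}" "strict_mono_on D h"
  shows monotone_ext_in: "monotone_ext D h x \<in> {0..1}"
    and monotone_ext_upper: "d \<in> D \<Longrightarrow> d \<le> x \<Longrightarrow> h d \<le> monotone_ext D h x"
    and monotone_ext_least: "0 \<le> c \<Longrightarrow> (\<And>d. d \<in> D \<Longrightarrow> d \<le> x \<Longrightarrow> h d \<le> c) \<Longrightarrow> monotone_ext D h x \<le> c"
    and monotone_ext_eq: "d \<in> D \<Longrightarrow> monotone_ext D h d = h d"
    and monotone_ext_less: "x \<in> {0..1} \<Longrightarrow> y \<in> {0..1} \<Longrightarrow> x < y \<Longrightarrow> monotone_ext D h x < monotone_ext D h y"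
proof -
  have bdd: "bdd_above (insert 0 (h ` {d \<in> D. d \<le> x}))" for x
    using assms(2) by (intro bdd_aboveI[of _ 1]) auto
  show upper: "h d \<le> monotone_ext D h x" if "d \<in> D" "d \<le> x" for d x
    unfolding monotone_ext_def using that bdd by (intro cSup_upper) auto
  show least: "monotone_ext D h x \<le> c" if "0 \<le> c" "\<And>d. d \<in> D \<Longrightarrow> d \<le> x \<Longrightarrow> h d \<le> c" for c x
    unfolding monotone_ext_def using that by (intro cSup_least) auto
  have "0 \<le> monotone_ext D h x" unfolding monotone_ext_def using bdd by (intro cSup_upper) auto
  moreover have "monotone_ext D h x \<le> 1" using assms(2) by (intro least) auto
  ultimately show "monotone_ext D h x \<in> {0..1}" by simp
  show eq: "monotone_ext D h d = h d" if d: "d \<in> D" for d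
  proof (rule antisym)
    have "h d' \<le> h d" if "d' \<in> D" "d' \<le> d" for d'
      using strict_mono_onD[OF assms(3), of d' d] that d by (cases "d' = d") simp_all
    moreover have "0 \<le> h d" using assms(2) d by auto
    ultimately show "monotone_ext D h d \<le> h d" by (intro least) auto
  qed (use upper d in auto)
  show "monotone_ext D h x < monotone_ext D h y" if "x \<in> {0..1}" "y \<in> {0..1}" "x < y" for x y
  proof -
    obtain d where d: "d \<in> D" "x < d" "d < y"
      using assms(1) \<open>x \<in> {0..1}\<close> \<open>y \<in> {0..1}\<close> \<open>x < y\<close> unfolding dense_in_unit_def by (meson atLeastAtMost_iff)
    have "0 \<le> d" "d < y" "y \<le> 1" using d \<open>x \<in> {0..1}\<close> \<open>y \<in> {0..1}\<close> by auto
    \<comment> \<open>One point of \<open>D\<close> would give only a weak inequality: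
      \<open>h d\<close> bounds the value at \<open>x\<close> from above, \<open>h d'\<close> bounds
      the value at \<open>y\<close> from below, and \<open>h d < h d'\<close>.\<close>
    then obtain d' where d': "d' \<in> D" "d < d'" "d' < y"
      using assms(1) unfolding dense_in_unit_def by meson
    have "h d'' \<le> h d" if "d'' \<in> D" "d'' \<le> x" for d''
      using strict_mono_onD[OF assms(3), of d'' d] that d by simp
    moreover have "0 \<le> h d" using assms(2) d by auto
    ultimately have "monotone_ext D h x \<le> h d" by (intro least) auto
    also have "h d < h d'" by (rule strict_mono_onD[OF assms(3) d(1) d'(1) d'(2)])
    also have "h d' \<le> monotone_ext D h y" by (rule upper) (use d' in auto)
    finally show ?thesis .
  qed
qed

text \<open>If the composite missed \<open>y\<close>, some \<open>e\<close> in \<open>D'\<close>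
  would lie strictly between \<open>y\<close> and its image. Strict monotonicity of both extensions,
  applied at \<open>h' e\<close> and \<open>e\<close>, contradicts this.\<close>

lemma monotone_ext_inverse:
  assumes "dense_in_unit D" "dense_in_unit D'"
    and "h ` D = D'" "h' ` D' = D" "strict_mono_on D h" "strict_mono_on D' h'"
    and "\<And>d. d \<in> D' \<Longrightarrow> h (h' d) = d"
    and y: "y \<in> {0..1}"
  shows "monotone_ext D h (monotone_ext D' h' y) = y"
proof (rule ccontr)
  have sub: "h ` D \<subseteq> {0..1}" "h' ` D' \<subseteq> {0..1}"
    using assms(1-4) unfolding dense_in_unit_def by auto
  note h = monotone_ext[OF assms(1) sub(1) assms(5)] and h' = monotone_ext[OF assms(2) sub(2) assms(6)]
  define p where "p = monotone_ext D' h' y"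
  have p: "p \<in> {0..1}" unfolding p_def by (rule h'(1))
  have q: "monotone_ext D h p \<in> {0..1}" by (rule h(1))
  assume "monotone_ext D h (monotone_ext D' h' y) \<noteq> y"
  then consider "monotone_ext D h p < y" | "y < monotone_ext D h p" unfolding p_def by linarith
  then show False
  proof cases
    case 1
    then obtain e where e: "e \<in> D'" "monotone_ext D h p < e" "e < y"
      using assms(2) y q unfolding dense_in_unit_def by (meson atLeastAtMost_iff)
    have e1: "h' e \<in> D" "e \<in> {0..1}" using e assms(2,4) unfolding dense_in_unit_def by auto
    have "h' e \<in> {0..1}" using e1 assms(1) unfolding dense_in_unit_def by auto
    have "h' e < p" using h'(5)[OF e1(2) y e(3)] h'(4)[OF e(1)] unfolding p_def by simp
    then have "monotone_ext D h (h' e) < monotone_ext D h p"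
      by (intro h(5)) (use p \<open>h' e \<in> {0..1}\<close> in auto)
    then show False using h(4)[OF e1(1)] assms(7)[OF e(1)] e by simp
  next
    case 2
    then obtain e where e: "e \<in> D'" "e < monotone_ext D h p" "y < e"
      using assms(2) y q unfolding dense_in_unit_def by (meson atLeastAtMost_iff)
    have e1: "h' e \<in> D" "e \<in> {0..1}" using e assms(2,4) unfolding dense_in_unit_def by auto
    have "h' e \<in> {0..1}" using e1 assms(1) unfolding dense_in_unit_def by auto
    have "p < h' e" using h'(5)[OF y e1(2) e(3)] h'(4)[OF e(1)] unfolding p_def by simp
    then have "monotone_ext D h p < monotone_ext D h (h' e)"
      by (intro h(5)) (use p \<open>h' e \<in> {0..1}\<close> in auto)
    then show False using h(4)[OF e1(1)] assms(7)[OF e(1)] e by simp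
  qed
qed

lemma order_iso_extends:
  assumes D: "dense_in_unit D" "dense_in_unit D'"
    and h: "bij_betw h D D'" "strict_mono_on D h"
  obtains \<phi> where "bij_betw \<phi> {0..1} {0..1}" "strict_mono_on {0..1} \<phi>" "\<And>d. d \<in> D \<Longrightarrow> \<phi> d = h d"
proof -
  define h' where "h' = inv_into D h"
  have bij': "bij_betw h' D' D" unfolding h'_def by (rule bij_betw_inv_into[OF h(1)])
  have inv: "h (h' e) = e" if "e \<in> D'" for e
    unfolding h'_def using h(1) that by (simp add: bij_betw_inv_into_right)
  have inv': "h' (h d) = d" if "d \<in> D" for d
    unfolding h'_def using h(1) that by (simp add: bij_betw_inv_into_left)
  have sm': "strict_mono_on D' h'"
  proof (rule strict_mono_onI)
    fix e1 e2 assume e: "e1 \<in> D'" "e2 \<in> D'" "e1 < e2"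
    then have "h' e1 \<in> D" "h' e2 \<in> D" using bij' by (auto simp: bij_betw_def)
    then have "h' e2 \<le> h' e1 \<Longrightarrow> h (h' e2) \<le> h (h' e1)"
      using strict_mono_onD[OF h(2), of "h' e2" "h' e1"] by (cases "h' e2 = h' e1") simp_all
    then show "h' e1 < h' e2" using e inv by fastforce
  qed
  have im: "h ` D = D'" "h' ` D' = D" using h bij' by (auto simp: bij_betw_def)
  have sub: "h ` D \<subseteq> {0..1}" "h' ` D' \<subseteq> {0..1}"
    using im D unfolding dense_in_unit_def by auto
  note ex = monotone_ext[OF D(1) sub(1) h(2)] and ex' = monotone_ext[OF D(2) sub(2) sm']
  have "bij_betw (monotone_ext D h) {0..1} {0..1}"
    by (rule bij_betw_byWitness[where f' = "monotone_ext D' h'"])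
       (use monotone_ext_inverse[OF D im h(2) sm' inv] monotone_ext_inverse[OF D(2,1) im(2,1) sm' h(2) inv']
          ex(1) ex'(1) in blast)+
  moreover have "strict_mono_on {0..1} (monotone_ext D h)"
    by (rule strict_mono_onI) (rule ex(5))
  ultimately show ?thesis using that ex(4) by blast
qed

section \<open>Components of a continuous t-norm\<close>

definition rat_enum :: "nat \<Rightarrow> real" where
  "rat_enum = from_nat_into (\<rat> \<inter> {0<..<1})"

lemma bij_betw_rat_enum: "bij_betw rat_enum UNIV (\<rat> \<inter> {0<..<1})"
proof -
  have "infinite (range (\<lambda>n::nat. 1 / (real n + 2)))"
    by (rule range_inj_infinite) (auto simp: inj_on_def)
  moreover have "range (\<lambda>n::nat. 1 / (real n + 2)) \<subseteq> \<rat> \<inter> {0<..<1}"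
    by auto
  ultimately have "infinite (\<rat> \<inter> {0<..<1::real})"
    using finite_subset by blast
  then show ?thesis
    unfolding rat_enum_def by (intro bij_betw_from_nat_into countable_Int1 countable_rat)
qed

lemma rat_enum_bounds: "0 < rat_enum n" "rat_enum n < 1"
  using bij_betw_rat_enum by (auto simp: bij_betw_def)

lemma rat_enum_eq_iff [simp]: "rat_enum m = rat_enum n \<longleftrightarrow> m = n"
  using bij_betw_rat_enum by (auto simp: bij_betw_def inj_on_def)

lemma rat_enum_dense:
  assumes "0 \<le> x" "x < y" "y \<le> 1"
  obtains n where "x < rat_enum n" "rat_enum n < y"
proof -
  obtain r where r: "r \<in> \<rat>" "x < r" "r < y" using Rats_dense_in_real[OF assms(2)] by blast
  then have "r \<in> range rat_enum" using assms bij_betw_rat_enum by (auto simp: bij_betw_def)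
  then show ?thesis using r that by auto
qed

text \<open>The interval is closed so that, by compactness, the strict alternative holds with a
  positive margin. This makes the predicate testable at rational points
  (\<open>uniform_on_rat_iff\<close>).\<close>

definition uniform_on :: "(real \<times> real \<Rightarrow> real) \<Rightarrow> real \<Rightarrow> real \<Rightarrow> bool" where
  "uniform_on f c d \<longleftrightarrow> (\<forall>z\<in>{c..d}. f (z, z) < z) \<or> (\<forall>z\<in>{c..d}. f (z, z) = z)"

text \<open>The points \<^term>\<open>x\<close> with \<^term>\<open>conn f x x\<close> form a dense open set; its connected components
  are the summands of \<^term>\<open>f\<close> together with the components of the interior of the set of idempotents.\<close>

definition conn :: "(real \<times> real \<Rightarrow> real) \<Rightarrow> real \<Rightarrow> real \<Rightarrow> bool" where
  "conn f x y \<longleftrightarrow> (\<exists>m n. rat_enum m < x \<and> rat_enum m < y \<and> x < rat_enum n \<and> y < rat_enum n \<and>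
     uniform_on f (rat_enum m) (rat_enum n))"

lemma uniform_on_Un:
  assumes "uniform_on f c d" "uniform_on f c' d'" "y \<in> {c..d}" "y \<in> {c'..d'}"
  shows "uniform_on f (min c c') (max d d')"
proof -
  have *: "{min c c'..max d d'} \<subseteq> {c..d} \<union> {c'..d'}"
    using assms(3,4) by auto
  show ?thesis
  proof (cases "f (y, y) < y")
    case True
    then have "\<forall>z\<in>{c..d}. f (z, z) < z" "\<forall>z\<in>{c'..d'}. f (z, z) < z"
      using assms unfolding uniform_on_def by (metis less_irrefl)+
    then show ?thesis using * unfolding uniform_on_def by blast
  next
    case False
    then have "\<forall>z\<in>{c..d}. f (z, z) = z" "\<forall>z\<in>{c'..d'}. f (z, z) = z"
      using assms unfolding uniform_on_def by metis+
    then show ?thesis using * unfolding uniform_on_def by blast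
  qed
qed

lemma conn_bounds:
  assumes "conn f x y"
  shows "0 < x" "x < 1" "0 < y" "y < 1"
  using assms rat_enum_bounds less_trans unfolding conn_def by metis+

lemma conn_sym: "conn f x y \<Longrightarrow> conn f y x"
  unfolding conn_def by blast

lemma conn_refl: "conn f x y \<Longrightarrow> conn f x x"
  unfolding conn_def by blast

lemma conn_trans:
  assumes "conn f x y" "conn f y z"
  shows "conn f x z"
proof -
  obtain m n where 1: "rat_enum m < x" "rat_enum m < y" "x < rat_enum n" "y < rat_enum n"
    "uniform_on f (rat_enum m) (rat_enum n)" using assms(1) unfolding conn_def by blast
  obtain m' n' where 2: "rat_enum m' < y" "rat_enum m' < z" "y < rat_enum n'" "z < rat_enum n'"
    "uniform_on f (rat_enum m') (rat_enum n')" using assms(2) unfolding conn_def by blast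
  obtain k where k: "rat_enum k = min (rat_enum m) (rat_enum m')" by (metis min_def)
  obtain l where l: "rat_enum l = max (rat_enum n) (rat_enum n')" by (metis max_def)
  have "uniform_on f (rat_enum k) (rat_enum l)"
    unfolding k l by (rule uniform_on_Un[OF 1(5) 2(5), of y]) (use 1 2 in auto)
  then show ?thesis unfolding conn_def using 1 2 k l by (intro exI[of _ k] exI[of _ l]) auto
qed

lemma conn_between: "conn f x y \<Longrightarrow> x \<le> z \<Longrightarrow> z \<le> y \<Longrightarrow> conn f x z"
  unfolding conn_def by (meson le_less_trans less_le_trans)

lemma conn_open:
  assumes "conn f x y"
  obtains m n where "rat_enum m < y" "y < rat_enum n" "\<And>z. rat_enum m < z \<Longrightarrow> z < rat_enum n \<Longrightarrow> conn f x z"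
  using assms unfolding conn_def by blast

text \<open>Components are convex, so two different ones compare the same way at all their points.
  This permits replacing points by representatives.\<close>

lemma conn_order:
  assumes "conn f x x'" "conn f y y'" "\<not> conn f x y" "x < y"
  shows "x' < y'"
proof (rule ccontr)
  assume n: "\<not> x' < y'"
  have "x < y'"
  proof (rule ccontr)
    assume "\<not> x < y'"
    then have "conn f y' x" using conn_between[OF conn_sym[OF assms(2)], of x] assms(4) by simp
    then show False using assms conn_trans conn_sym by blast
  qed
  then have "conn f x y'" using conn_between[OF assms(1), of y'] n by simp
  then show False using assms conn_trans conn_sym by blast
qed

lemma conn_uniform:
  assumes "conn f x y"
  shows "f (x, x) = x \<longleftrightarrow> f (y, y) = y"
  using assms unfolding conn_def uniform_on_def by (metis atLeastAtMost_iff less_imp_le less_irrefl)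

text \<open>An end point lying in any component would have a neighbourhood in that component. The
  neighbourhood meets the interval, so the end point would belong to its own open interval.\<close>

lemma component_interval:
  assumes "conn f x x"
  obtains a b where "{y. conn f x y} = {a<..<b}" "a < b" "0 \<le> a" "b \<le> 1" "\<not> conn f a a" "\<not> conn f b b"
proof -
  define S where "S = {y. conn f x y}"
  have x: "x \<in> S" using assms by (simp add: S_def)
  have bdd: "bdd_above S" "bdd_below S"
    using conn_bounds(3,4) unfolding S_def by (auto intro!: bdd_aboveI[of _ 1] bdd_belowI[of _ 0] less_imp_le)
  define a b where "a = Inf S" and "b = Sup S"
  have S: "S = {a<..<b}"
  proof (intro equalityI subsetI)
    fix y assume "y \<in> S"
    then obtain m n where mn: "rat_enum m < y" "y < rat_enum n"
      "\<And>z. rat_enum m < z \<Longrightarrow> z < rat_enum n \<Longrightarrow> conn f x z"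
      using conn_open[of f x y] unfolding S_def by blast
    obtain z z' where "rat_enum m < z" "z < y" "y < z'" "z' < rat_enum n"
      using dense mn by meson
    then have "z \<in> S" "z' \<in> S" unfolding S_def using mn by auto
    then have "a \<le> z" "z' \<le> b" unfolding a_def b_def using bdd by (auto intro: cInf_lower cSup_upper)
    then show "y \<in> {a<..<b}" using \<open>z < y\<close> \<open>y < z'\<close> by auto
  next
    fix y assume y: "y \<in> {a<..<b}"
    then obtain s t where st: "s \<in> S" "s < y" "t \<in> S" "y < t"
      using cInf_less_iff[OF _ bdd(2), of y] less_cSup_iff[OF _ bdd(1), of y] x
      unfolding a_def b_def by auto
    then have "conn f s t" unfolding S_def using conn_sym conn_trans by blast
    then have "conn f s y" using conn_between st by simp
    then show "y \<in> S" using st conn_trans unfolding S_def by blast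
  qed
  have "a < b" using x S by auto
  moreover have "0 \<le> a" unfolding a_def using x conn_bounds(3)
    by (intro cInf_greatest) (auto simp: S_def intro: less_imp_le)
  moreover have "b \<le> 1" unfolding b_def using x conn_bounds(4)
    by (intro cSup_least) (auto simp: S_def intro: less_imp_le)
  moreover have "\<not> conn f a a"
  proof
    assume "conn f a a"
    then obtain n where n: "a < rat_enum n" "\<And>z. a < z \<Longrightarrow> z < rat_enum n \<Longrightarrow> conn f a z"
      using conn_open[of f a a] by (metis less_trans)
    obtain z where z: "a < z" "z < min b (rat_enum n)" using dense[of a "min b (rat_enum n)"] n \<open>a < b\<close> by auto
    then have "z \<in> S" "conn f a z" using n S by auto
    then have "a \<in> S" unfolding S_def using conn_trans conn_sym by blast
    then show False using S by auto
  qed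
  moreover have "\<not> conn f b b"
  proof
    assume "conn f b b"
    then obtain m where n: "rat_enum m < b" "\<And>z. rat_enum m < z \<Longrightarrow> z < b \<Longrightarrow> conn f b z"
      using conn_open[of f b b] by (metis less_trans)
    obtain z where z: "max a (rat_enum m) < z" "z < b" using dense[of "max a (rat_enum m)" b] n \<open>a < b\<close> by auto
    then have "z \<in> S" "conn f b z" using n S by auto
    then have "b \<in> S" unfolding S_def using conn_trans conn_sym by blast
    then show False using S by auto
  qed
  ultimately show ?thesis using that S unfolding S_def by blast
qed

text \<open>0 stands for idempotent, 1 for nilpotent, 2 for strict. Nilpotency is tested at
  rationals for the sake of measurability in \<open>f\<close>; \<open>nilpotent_iff\<close> gives
  the form with real witnesses.\<close>

definition lab :: "(real \<times> real \<Rightarrow> real) \<Rightarrow> real \<Rightarrow> nat" where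
  "lab f x = (if f (x, x) = x then 0
     else if \<exists>m. conn f x (rat_enum m) \<and>
       (\<forall>n. conn f x (rat_enum n) \<longrightarrow> f (rat_enum m, rat_enum m) \<le> rat_enum n) then 1
     else 2)"

section \<open>A t-norm inside and between its components\<close>

locale tnorm =
  fixes f :: "real \<times> real \<Rightarrow> real"
  assumes tnorm: "continuous_tnorm f"
begin

lemma range: "x \<in> {0..1} \<Longrightarrow> y \<in> {0..1} \<Longrightarrow> f (x, y) \<in> {0..1}"
  and cont: "continuous_on unit_square f"
  and assoc: "x \<in> {0..1} \<Longrightarrow> y \<in> {0..1} \<Longrightarrow> z \<in> {0..1} \<Longrightarrow> f (f (x, y), z) = f (x, f (y, z))"
  and commute: "x \<in> {0..1} \<Longrightarrow> y \<in> {0..1} \<Longrightarrow> f (x, y) = f (y, x)"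
  and unit: "x \<in> {0..1} \<Longrightarrow> f (1, x) = x"
  and mono: "x \<in> {0..1} \<Longrightarrow> x' \<in> {0..1} \<Longrightarrow> y \<in> {0..1} \<Longrightarrow> y' \<in> {0..1} \<Longrightarrow> x \<le> x' \<Longrightarrow> y \<le> y' \<Longrightarrow>
    f (x, y) \<le> f (x', y')"
  using tnorm unfolding continuous_tnorm_def by (blast | blast dest: funcset_mem)+

lemma le_left: "x \<in> {0..1} \<Longrightarrow> y \<in> {0..1} \<Longrightarrow> f (x, y) \<le> x"
  using mono[of x x y 1] unit[of x] commute[of x 1] by auto

lemma zero: "x \<in> {0..1} \<Longrightarrow> f (0, x) = 0"
  using le_left[of 0 x] range[of 0 x] by auto

lemma cont_line: "e \<in> {0..1} \<Longrightarrow> continuous_on {0..1} (\<lambda>z. f (e, z))"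
  by (rule continuous_on_compose2[OF cont, of _ "\<lambda>z. (e, z)"]) (auto intro!: continuous_intros)

lemma cont_diag: "continuous_on {0..1} (\<lambda>z. f (z, z))"
  by (rule continuous_on_compose2[OF cont, of _ "\<lambda>z. (z, z)"]) (auto intro!: continuous_intros)

text \<open>By continuity \<open>x\<close> is a multiple \<open>f (e, z)\<close> of the idempotent
  \<open>e\<close>, so \<open>e\<close> fixes \<open>x\<close>, and by monotonicity so does every
  \<open>y\<close> above \<open>e\<close>.\<close>

lemma idem_absorb:
  assumes "f (e, e) = e" "0 \<le> x" "x \<le> e" "e \<le> y" "y \<le> 1"
  shows "f (x, y) = x"
proof -
  have e: "e \<in> {0..1}" "x \<in> {0..1}" "y \<in> {0..1}" using assms by auto
  obtain z where z: "0 \<le> z" "z \<le> 1" "f (e, z) = x"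
    using IVT'[of "\<lambda>z. f (e, z)" 0 x 1] cont_line[OF e(1)] zero[OF e(1)] unit[OF e(1)]
      commute[of e 0] commute[of e 1] e assms by auto
  have "f (e, x) = x"
    using assoc[of e e z] e z assms by auto
  then have "x \<le> f (x, y)"
    using mono[of x x e y] commute[of e x] e assms by auto
  then show ?thesis using le_left[of x y] e by simp
qed

lemma conn_if_not_idem:
  assumes x: "x \<in> {0..1}" "f (x, x) \<noteq> x"
  shows "conn f x x"
proof -
  have "x \<noteq> 0" "x \<noteq> 1" using x zero[of 0] unit[of 1] by auto
  then have x01: "0 < x" "x < 1" using x by auto
  have less: "f (x, x) < x" using le_left[of x x] x by auto
  have "continuous_on {0..1} (\<lambda>z. z - f (z, z))" by (intro continuous_intros cont_diag)
  then obtain e where e: "e > 0" "\<And>z. z \<in> {0..1} \<Longrightarrow> dist z x < e \<Longrightarrow>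
      dist (z - f (z, z)) (x - f (x, x)) < x - f (x, x)"
    using x less unfolding continuous_on_iff by (metis diff_gt_0_iff_gt)
  obtain m where m: "max 0 (x - e) < rat_enum m" "rat_enum m < x"
    using rat_enum_dense[of "max 0 (x - e)" x] x01 e by auto
  obtain n where n: "x < rat_enum n" "rat_enum n < min 1 (x + e)"
    using rat_enum_dense[of x "min 1 (x + e)"] x01 e by auto
  have "f (z, z) < z" if "z \<in> {rat_enum m..rat_enum n}" for z
  proof -
    have "z \<in> {0..1}" "\<bar>z - x\<bar> < e" using that m n rat_enum_bounds[of m] rat_enum_bounds[of n] by auto
    then show ?thesis using e(2)[of z] by (simp add: dist_real_def abs_less_iff)
  qed
  then show ?thesis unfolding conn_def uniform_on_def using m n by blast
qed

text \<open>An interval without non-idempotents lies in the interior of the idempotents, and every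
  non-idempotent point lies in a component by continuity.\<close>

lemma dense_conn: "dense_in_unit {x. conn f x x}"
  unfolding dense_in_unit_def
proof (intro conjI allI impI)
  show "{x. conn f x x} \<subseteq> {0..1}" using conn_bounds(1,2)[THEN less_imp_le] by auto
  fix x y :: real assume xy: "0 \<le> x \<and> x < y \<and> y \<le> 1"
  show "\<exists>d\<in>{x. conn f x x}. x < d \<and> d < y"
  proof (cases "\<forall>z. x < z \<and> z < y \<longrightarrow> f (z, z) = z")
    case True
    obtain m where m: "x < rat_enum m" "rat_enum m < y" using rat_enum_dense xy by blast
    obtain n where n: "rat_enum m < rat_enum n" "rat_enum n < y"
      using rat_enum_dense[of "rat_enum m" y] m xy less_imp_le[OF rat_enum_bounds(1)] by blast
    obtain z where z: "rat_enum m < z" "z < rat_enum n" using dense n by blast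
    have "uniform_on f (rat_enum m) (rat_enum n)"
      unfolding uniform_on_def using True m n by auto
    then have "conn f z z" unfolding conn_def using z by blast
    then show ?thesis using z m n by (intro bexI[of _ z]) auto
  next
    case False
    then obtain z where z: "x < z" "z < y" "f (z, z) \<noteq> z" by blast
    then show ?thesis using conn_if_not_idem[of z] xy by (intro bexI[of _ z]) auto
  qed
qed

lemma component_bounds:
  assumes "conn f x x"
  obtains a b where "{y. conn f x y} = {a<..<b}" "a < b" "0 \<le> a" "b \<le> 1" "f (a, a) = a" "f (b, b) = b"
    "\<not> conn f a a" "\<not> conn f b b"
proof -
  obtain a b where ab: "{y. conn f x y} = {a<..<b}" "a < b" "0 \<le> a" "b \<le> 1" "\<not> conn f a a" "\<not> conn f b b"
    by (rule component_interval[OF assms])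
  moreover have "f (a, a) = a" "f (b, b) = b" using ab conn_if_not_idem[of a] conn_if_not_idem[of b] by auto
  ultimately show ?thesis using that by blast
qed

text \<open>A real \<open>s\<close> can be undercut by a rational of the same component, and a real
  \<open>r\<close> can be replaced by a smaller rational because the diagonal is monotone.\<close>

lemma nilpotent_iff:
  assumes "conn f x x"
  shows "(\<exists>m. conn f x (rat_enum m) \<and>
       (\<forall>n. conn f x (rat_enum n) \<longrightarrow> f (rat_enum m, rat_enum m) \<le> rat_enum n)) \<longleftrightarrow>
    (\<exists>r. conn f x r \<and> (\<forall>s. conn f x s \<longrightarrow> f (r, r) \<le> s))" (is "?L \<longleftrightarrow> ?R")
proof -
  obtain a b where ab: "{y. conn f x y} = {a<..<b}" "a < b" "0 \<le> a" "b \<le> 1"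
    using component_interval[OF assms] .
  have conn: "conn f x y \<longleftrightarrow> a < y \<and> y < b" for y
    using arg_cong[OF ab(1), of "\<lambda>S. y \<in> S"] by simp
  show ?thesis
  proof
    assume ?L
    then obtain m where m: "conn f x (rat_enum m)"
      "\<And>n. conn f x (rat_enum n) \<Longrightarrow> f (rat_enum m, rat_enum m) \<le> rat_enum n" by blast
    have "f (rat_enum m, rat_enum m) \<le> s" if s: "conn f x s" for s
    proof -
      have "a < s" "s < b" using s conn by auto
      then obtain n where n: "a < rat_enum n" "rat_enum n < s"
        using rat_enum_dense[of a s] ab by auto
      then have "conn f x (rat_enum n)" using s conn by auto
      then show ?thesis using m(2) n by fastforce
    qed
    then show ?R using m(1) by blast
  next
    assume ?R
    then obtain r where r: "conn f x r" "\<And>s. conn f x s \<Longrightarrow> f (r, r) \<le> s" by blast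
    have "a < r" "r < b" using r conn by auto
    then obtain m where m: "a < rat_enum m" "rat_enum m < r"
      using rat_enum_dense[of a r] ab by auto
    have "f (rat_enum m, rat_enum m) \<le> f (r, r)"
      by (rule mono) (use m \<open>r < b\<close> ab rat_enum_bounds[of m] in auto)
    moreover have "conn f x (rat_enum m)" using m conn \<open>r < b\<close> by auto
    ultimately show ?L using r(2) order_trans by blast
  qed
qed

text \<open>Idempotent components also receive a decreasing bijection onto (0,1), here an affine
  one, so that the range depends on the label alone.\<close>

lemma component_generator:
  assumes "conn f x x"
  obtains g :: "real \<Rightarrow> real" where "bij_betw g {y. conn f x y} (if lab f x = 2 then {0<..} else {0<..<1})"
    "\<And>y z. conn f x y \<Longrightarrow> conn f x z \<Longrightarrow> y \<le> z \<longleftrightarrow> g z \<le> g y"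
    "\<And>y z w. conn f x y \<Longrightarrow> conn f x z \<Longrightarrow> conn f x w \<Longrightarrow>
       f (y, z) \<le> w \<longleftrightarrow> (if lab f x = 0 then min y z \<le> w else g w \<le> g y + g z)"
proof -
  obtain a b where ab: "{y. conn f x y} = {a<..<b}" "a < b" "0 \<le> a" "b \<le> 1"
    "f (a, a) = a" "f (b, b) = b"
    by (rule component_bounds[OF assms])
  have conn: "conn f x y \<longleftrightarrow> y \<in> {a<..<b}" for y
    using arg_cong[OF ab(1), of "\<lambda>S. y \<in> S"] by simp
  have ab01: "y \<in> {0..1}" if "y \<in> {a..b}" for y using that ab by auto
  show ?thesis
  proof (cases "f (x, x) = x")
    case True
    define g where "g y = (b - y) / (b - a)" for y
    have lab: "lab f x = 0" using True by (simp add: lab_def)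
    have "bij_betw g {a<..<b} {0<..<1}"
    proof (rule bij_betw_byWitness[where f' = "\<lambda>t. b - t * (b - a)"])
      show "g ` {a<..<b} \<subseteq> {0<..<1}" unfolding g_def using ab by auto
      show "(\<lambda>t. b - t * (b - a)) ` {0<..<1} \<subseteq> {a<..<b}"
      proof clarify
        fix t :: real assume t: "t \<in> {0<..<1}"
        then have "0 < t * (b - a)" "t * (b - a) < 1 * (b - a)"
          using ab(2) by (simp, intro mult_strict_right_mono) auto
        then show "b - t * (b - a) \<in> {a<..<b}" by auto
      qed
    qed (use ab in \<open>auto simp: g_def\<close>)
    moreover have "y \<le> z \<longleftrightarrow> g z \<le> g y" for y z
      unfolding g_def using ab(2) by (simp add: divide_le_cancel)
    moreover have "f (y, z) = min y z" if "conn f x y" "conn f x z" for y z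
    proof (cases "y \<le> z")
      case le: True
      then show ?thesis using idem_absorb[of y y z] conn_uniform[OF that(1)] True conn_bounds[OF that(1)]
        conn_bounds[OF that(2)] by auto
    next
      case False
      then show ?thesis using idem_absorb[of z z y] conn_uniform[OF that(2)] True conn_bounds[OF that(1)]
        conn_bounds[OF that(2)] commute[of y z] by auto
    qed
    ultimately show ?thesis
      by (intro that[of g]) (simp_all only: lab ab(1), simp_all)
  next
    case False
    \<comment> \<open>The idempotent ends make the closed interval closed under the t-norm with unit
      \<open>b\<close>, and by \<open>conn_uniform\<close> one non-idempotent point makes all
      interior points non-idempotent.\<close>
    interpret I: archimedean_interval "\<lambda>y z. f (y, z)" a b
    proof
      show "a < b" by fact
      show "f (y, z) \<in> {a..b}" if "y \<in> {a..b}" "z \<in> {a..b}" for y z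
        using mono[of a y a z] mono[of y b z b] ab that by auto
      show "f (f (y, z), w) = f (y, f (z, w))" if "y \<in> {a..b}" "z \<in> {a..b}" "w \<in> {a..b}" for y z w
        using assoc that ab01 by blast
      show "f (y, z) = f (z, y)" if "y \<in> {a..b}" "z \<in> {a..b}" for y z
        using commute that ab01 by blast
      show "f (b, y) = y" if "y \<in> {a..b}" for y
        using idem_absorb[of b y b] commute[of b y] that ab by auto
      show "f (y, z) \<le> f (y', z')" if "y \<in> {a..b}" "y' \<in> {a..b}" "z \<in> {a..b}" "z' \<in> {a..b}"
        "y \<le> y'" "z \<le> z'" for y y' z z'
        using that ab01 by (intro mono) auto
      have "continuous_on ({a..b} \<times> {a..b}) f"
        by (rule continuous_on_subset[OF cont]) (use ab01 in blast)
      then show "continuous_on ({a..b} \<times> {a..b}) (\<lambda>p. f (fst p, snd p))" by simp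
      show "f (y, y) < y" if "a < y" "y < b" for y
      proof -
        have "conn f x y" using conn that by auto
        then have "f (y, y) \<noteq> y" using conn_uniform False by blast
        then show ?thesis using le_left[of y y] ab01[of y] that by auto
      qed
    qed
    define N where "N \<longleftrightarrow> (\<exists>r\<in>{a<..<b}. \<forall>s\<in>{a<..<b}. f (r, r) \<le> s)"
    have lab: "lab f x = (if N then 1 else 2)"
      unfolding N_def lab_def nilpotent_iff[OF assms] using False by (simp add: conn Bex_def Ball_def)
    obtain g :: "real \<Rightarrow> real" where g: "bij_betw g {a<..<b} (if N then {0<..<1} else {0<..})"
      "\<And>x y. x \<in> {a<..<b} \<Longrightarrow> y \<in> {a<..<b} \<Longrightarrow> x \<le> y \<longleftrightarrow> g y \<le> g x"
      "\<And>x y z. x \<in> {a<..<b} \<Longrightarrow> y \<in> {a<..<b} \<Longrightarrow> z \<in> {a<..<b} \<Longrightarrow> f (x, y) \<le> z \<longleftrightarrow> g z \<le> g x + g y"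
      by (rule I.additive_generator) (rule that, simp only: N_def, blast, blast)
    show ?thesis
    proof (rule that[of g])
      show "bij_betw g {y. conn f x y} (if lab f x = 2 then {0<..} else {0<..<1})"
        using g(1) unfolding lab ab(1) by (simp split: if_splits)
      show "f (y, z) \<le> w \<longleftrightarrow> (if lab f x = 0 then min y z \<le> w else g w \<le> g y + g z)"
        if "conn f x y" "conn f x z" "conn f x w" for y z w
        using g(3)[of y z w] that unfolding lab conn by simp
      show "y \<le> z \<longleftrightarrow> g z \<le> g y" if "conn f x y" "conn f x z" for y z
        using g(2) that unfolding conn by blast
    qed
  qed
qed

text \<open>The right end point of the component of \<open>x\<close> is an idempotent between
  \<open>x\<close> and \<open>y\<close>.\<close>

lemma not_conn_min:
  assumes "conn f x x" "conn f y y" "\<not> conn f x y" "x < y"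
  shows "f (x, y) = x"
proof -
  obtain a b where ab: "{y. conn f x y} = {a<..<b}" "a < b" "0 \<le> a" "b \<le> 1"
    "f (a, a) = a" "f (b, b) = b"
    by (rule component_bounds[OF assms(1)])
  have conn: "conn f x y \<longleftrightarrow> y \<in> {a<..<b}" for y
    using arg_cong[OF ab(1), of "\<lambda>S. y \<in> S"] by simp
  have "x \<in> {a<..<b}" "y \<notin> {a<..<b}" using assms conn by auto
  then show ?thesis using idem_absorb[of b x y] ab assms(4) conn_bounds(1,4)[OF assms(1)]
      conn_bounds(1,4)[OF assms(2)] by auto
qed

text \<open>The product stays between the left end point \<open>a\<close> and \<open>x\<close>. It
  may equal \<open>a\<close>, but \<open>z\<close> may not, since end points lie in no component; so
  \<open>z\<close> is below the product or above the whole component.\<close>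

lemma conn_le_outside:
  assumes "conn f x y" "conn f z z" "\<not> conn f x z"
  shows "f (x, y) \<le> z \<longleftrightarrow> x < z"
proof -
  have xx: "conn f x x" using conn_refl assms by blast
  obtain a b where ab: "{y. conn f x y} = {a<..<b}" "a < b" "0 \<le> a" "b \<le> 1"
    "f (a, a) = a" "f (b, b) = b" "\<not> conn f a a"
    by (rule component_bounds[OF xx])
  have conn: "conn f x y \<longleftrightarrow> y \<in> {a<..<b}" for y
    using arg_cong[OF ab(1), of "\<lambda>S. y \<in> S"] by simp
  have in_ab: "x \<in> {a<..<b}" "y \<in> {a<..<b}" "z \<notin> {a<..<b}" "z \<noteq> a" using assms xx conn ab(7) by auto
  have "f (x, y) \<le> x" using le_left[of x y] in_ab ab by auto
  moreover have "a \<le> f (x, y)" using mono[of a x a y] ab in_ab by auto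
  ultimately show ?thesis using in_ab by auto
qed

end

text \<open>One generator is followed by the inverse of the other; equal labels give both the range
  \<open>T\<close>.\<close>

lemma component_iso:
  assumes "continuous_tnorm f" "continuous_tnorm f'" "conn f x x" "conn f' x' x'" "lab f x = lab f' x'"
  obtains \<psi> where "bij_betw \<psi> {y. conn f x y} {y. conn f' x' y}"
    "\<And>y z. conn f x y \<Longrightarrow> conn f x z \<Longrightarrow> y \<le> z \<longleftrightarrow> \<psi> y \<le> \<psi> z"
    "\<And>y z w. conn f x y \<Longrightarrow> conn f x z \<Longrightarrow> conn f x w \<Longrightarrow> f (y, z) \<le> w \<longleftrightarrow> f' (\<psi> y, \<psi> z) \<le> \<psi> w"
proof -
  interpret A: tnorm f by standard fact
  interpret B: tnorm f' by standard fact
  define T where "T = (if lab f x = 2 then {0<..} else {0<..<1::real})"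
  obtain g :: "real \<Rightarrow> real" where g: "bij_betw g {y. conn f x y} T"
    "\<And>y z. conn f x y \<Longrightarrow> conn f x z \<Longrightarrow> y \<le> z \<longleftrightarrow> g z \<le> g y"
    "\<And>y z w. conn f x y \<Longrightarrow> conn f x z \<Longrightarrow> conn f x w \<Longrightarrow>
       f (y, z) \<le> w \<longleftrightarrow> (if lab f x = 0 then min y z \<le> w else g w \<le> g y + g z)"
    by (rule A.component_generator[OF assms(3), folded T_def]) (rule that, assumption, blast, blast)
  obtain g' :: "real \<Rightarrow> real" where g': "bij_betw g' {y. conn f' x' y} T"
    "\<And>y z. conn f' x' y \<Longrightarrow> conn f' x' z \<Longrightarrow> y \<le> z \<longleftrightarrow> g' z \<le> g' y"
    "\<And>y z w. conn f' x' y \<Longrightarrow> conn f' x' z \<Longrightarrow> conn f' x' w \<Longrightarrow>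
       f' (y, z) \<le> w \<longleftrightarrow> (if lab f x = 0 then min y z \<le> w else g' w \<le> g' y + g' z)"
    by (rule B.component_generator[OF assms(4), folded assms(5), folded T_def]) (rule that, assumption, blast, blast)
  define k where "k = inv_into {y. conn f' x' y} g'"
  define \<psi> where "\<psi> y = k (g y)" for y
  have k: "bij_betw k T {y. conn f' x' y}" unfolding k_def by (rule bij_betw_inv_into[OF g'(1)])
  have gk: "g' (k t) = t" if "t \<in> T" for t
    unfolding k_def by (rule bij_betw_inv_into_right[OF g'(1) that])
  have bij: "bij_betw \<psi> {y. conn f x y} {y. conn f' x' y}"
    using bij_betw_trans[OF g(1) k] unfolding \<psi>_def o_def .
  have in_comp: "conn f' x' (\<psi> y)" if "conn f x y" for y
    using bij_betwE[OF bij] that by blast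
  have g\<psi>: "g' (\<psi> y) = g y" if "conn f x y" for y
    unfolding \<psi>_def using gk bij_betwE[OF g(1)] that by blast
  have le: "y \<le> z \<longleftrightarrow> \<psi> y \<le> \<psi> z" if "conn f x y" "conn f x z" for y z
    using g(2)[OF that] g'(2)[OF in_comp in_comp, OF that] g\<psi> that by simp
  have "f (y, z) \<le> w \<longleftrightarrow> f' (\<psi> y, \<psi> z) \<le> \<psi> w" if "conn f x y" "conn f x z" "conn f x w" for y z w
  proof (cases "lab f x = 0")
    case True
    then show ?thesis
      using g(3)[OF that] g'(3)[OF in_comp in_comp in_comp, OF that] le[OF that(1,3)] le[OF that(2,3)]
      by (simp add: min_le_iff_disj)
  next
    case False
    then show ?thesis
      using g(3)[OF that] g'(3)[OF in_comp in_comp in_comp, OF that] g\<psi> that by simp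
  qed
  then show ?thesis using that bij le by blast
qed

section \<open>Rational representatives and gluing of component isomorphisms\<close>

definition reps :: "(real \<times> real \<Rightarrow> real) \<Rightarrow> nat set" where
  "reps f = {n. conn f (rat_enum n) (rat_enum n) \<and> (\<forall>m<n. \<not> conn f (rat_enum m) (rat_enum n))}"

definition rep :: "(real \<times> real \<Rightarrow> real) \<Rightarrow> real \<Rightarrow> nat" where
  "rep f x = (LEAST n. conn f x (rat_enum n))"

lemma conn_rep:
  assumes "conn f x x"
  shows "conn f x (rat_enum (rep f x))"
proof -
  obtain a b where "{y. conn f x y} = {a<..<b}" "a < b" "0 \<le> a" "b \<le> 1"
    using component_interval[OF assms] .
  moreover obtain n where "a < rat_enum n" "rat_enum n < b"
    using rat_enum_dense[of a b] calculation by blast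
  ultimately have "conn f x (rat_enum n)" by (metis greaterThanLessThan_iff mem_Collect_eq)
  then show ?thesis unfolding rep_def by (rule LeastI)
qed

lemma conn_cong: "conn f x y \<Longrightarrow> conn f x z \<longleftrightarrow> conn f y z"
  using conn_trans conn_sym by blast

lemma rep_cong: "conn f x y \<Longrightarrow> rep f x = rep f y"
  unfolding rep_def by (simp add: conn_cong[of f x y])

lemma rep_in_reps:
  assumes "conn f x x"
  shows "rep f x \<in> reps f"
proof -
  have c: "conn f x (rat_enum (rep f x))" by (rule conn_rep[OF assms])
  moreover have "\<not> conn f (rat_enum m) (rat_enum (rep f x))" if "m < rep f x" for m
    using not_less_Least[of m "\<lambda>n. conn f x (rat_enum n)"] that c conn_cong conn_sym
    unfolding rep_def by blast
  ultimately show ?thesis unfolding reps_def using conn_refl conn_sym by blast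
qed

lemma reps_eqI: "m \<in> reps f \<Longrightarrow> n \<in> reps f \<Longrightarrow> conn f (rat_enum m) (rat_enum n) \<Longrightarrow> m = n"
  unfolding reps_def using conn_sym by (metis (mono_tags, lifting) linorder_neqE_nat mem_Collect_eq)

lemma conn_reps: "n \<in> reps f \<Longrightarrow> conn f (rat_enum n) (rat_enum n)"
  unfolding reps_def by blast

lemma rep_eqI:
  assumes "n \<in> reps f" "conn f (rat_enum n) x"
  shows "rep f x = n"
proof (rule reps_eqI[OF _ assms(1)])
  have x: "conn f x x" using assms conn_sym conn_refl by blast
  then show "rep f x \<in> reps f" by (rule rep_in_reps)
  show "conn f (rat_enum (rep f x)) (rat_enum n)"
    using conn_rep[OF x] assms conn_sym conn_trans by blast
qed

definition comp_iso :: "(real \<times> real \<Rightarrow> real) \<Rightarrow> (real \<times> real \<Rightarrow> real) \<Rightarrow> (nat \<Rightarrow> nat) \<Rightarrow> bool" where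
  "comp_iso f f' \<pi> \<longleftrightarrow> bij_betw \<pi> (reps f) (reps f') \<and>
     (\<forall>m\<in>reps f. \<forall>n\<in>reps f. rat_enum m < rat_enum n \<longleftrightarrow> rat_enum (\<pi> m) < rat_enum (\<pi> n)) \<and>
     (\<forall>n\<in>reps f. lab f (rat_enum n) = lab f' (rat_enum (\<pi> n)))"

lemma comp_isoI:
  assumes "bij_betw \<pi> (reps f) (reps f')"
    and "\<And>m n. m \<in> reps f \<Longrightarrow> n \<in> reps f \<Longrightarrow> rat_enum m < rat_enum n \<Longrightarrow> rat_enum (\<pi> m) < rat_enum (\<pi> n)"
    and "\<And>n. n \<in> reps f \<Longrightarrow> lab f (rat_enum n) = lab f' (rat_enum (\<pi> n))"
  shows "comp_iso f f' \<pi>"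
  unfolding comp_iso_def
proof (intro conjI ballI assms iffI)
  fix m n assume mn: "m \<in> reps f" "n \<in> reps f" "rat_enum (\<pi> m) < rat_enum (\<pi> n)"
  then have "m \<noteq> n" "\<not> rat_enum n < rat_enum m" using assms(2)[of n m] by auto
  then show "rat_enum m < rat_enum n" by (metis linorder_neqE rat_enum_eq_iff)
qed

lemma order_iso_unit:
  assumes "bij_betw \<phi> {0..1} {0..1::real}" "strict_mono_on {0..1::real} \<phi>"
  shows "continuous_on {0..1} \<phi>" "\<phi> 0 = 0" "\<phi> 1 = 1"
proof -
  have le: "\<phi> x \<le> \<phi> y" if "x \<in> {0..1}" "y \<in> {0..1}" "x \<le> y" for x y
    using strict_mono_onD[OF assms(2), of x y] that by (cases "x = y") simp_all
  have im: "\<phi> x \<in> {0..1}" if "x \<in> {0..1}" for x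
    using bij_betwE[OF assms(1)] that by blast
  have "0 \<in> \<phi> ` {0..1}" "1 \<in> \<phi> ` {0..1}"
    using bij_betw_imp_surj_on[OF assms(1)] by simp_all
  then obtain p q where p: "p \<in> {0..1}" "\<phi> p = 0" and q: "q \<in> {0..1}" "\<phi> q = 1"
    by (elim imageE) simp
  show "\<phi> 0 = 0" using le[of 0 p] im[of 0] p by auto
  show "\<phi> 1 = 1" using le[of q 1] im[of 1] q by auto
  \<comment> \<open>Extending by the identity gives a monotone map of the real line onto itself, to
    which the continuity criterion for monotone maps with open image applies.\<close>
  define \<Phi> where "\<Phi> x = (if x \<in> {0..1} then \<phi> x else x)" for x
  have "\<Phi> ` UNIV = UNIV"
  proof (intro equalityI subsetI)
    fix y :: real
    show "y \<in> \<Phi> ` UNIV"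
    proof (cases "y \<in> {0..1}")
      case True
      then have "y \<in> \<phi> ` {0..1}" by (simp add: bij_betw_imp_surj_on[OF assms(1)])
      then obtain x where "x \<in> {0..1}" "y = \<phi> x" by (elim imageE)
      then have "y = \<Phi> x" by (simp add: \<Phi>_def)
      then show ?thesis by blast
    next
      case False
      then have "y = \<Phi> y" by (auto simp: \<Phi>_def)
      then show ?thesis by blast
    qed
  qed simp
  moreover have "\<Phi> x \<le> \<Phi> y" if "x \<le> y" for x y
    using that le[of x y] im[of x] im[of y] unfolding \<Phi>_def by (auto split: if_splits)
  ultimately have "continuous_on UNIV \<Phi>"
    by (intro continuous_onI_mono) simp_all
  then have "continuous_on {0..1} \<Phi>" by (rule continuous_on_subset) simp
  then show "continuous_on {0..1} \<phi>"
    by (rule continuous_on_eq) (simp add: \<Phi>_def)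
qed

lemma dense_in_unit_closure:
  assumes "dense_in_unit D"
  shows "closure D = {0..1}"
proof
  show "closure D \<subseteq> {0..1}" using assms by (intro closure_minimal) (auto simp: dense_in_unit_def)
  have "{0<..<1} \<subseteq> closure D"
  proof
    fix x :: real assume x: "x \<in> {0<..<1}"
    show "x \<in> closure D"
      unfolding closure_approachable
    proof (intro allI impI)
      fix e :: real assume "0 < e"
      then have "0 \<le> x \<and> x < min 1 (x + e) \<and> min 1 (x + e) \<le> 1" using x by auto
      then obtain d where "d \<in> D" "x < d" "d < min 1 (x + e)"
        using assms unfolding dense_in_unit_def by meson
      then show "\<exists>y\<in>D. dist y x < e" by (intro bexI[of _ d]) (auto simp: dist_real_def)
    qed
  qed
  then have "closure {0<..<1} \<subseteq> closure D" by (rule closure_minimal) simp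
  then show "{0..1} \<subseteq> closure D" by (subst (asm) closure_greaterThanLessThan) simp_all
qed

lemma dense_in_unitE:
  assumes "dense_in_unit D" "0 \<le> x" "x < y" "y \<le> 1"
  obtains d where "d \<in> D" "x < d" "d < y"
  using assms unfolding dense_in_unit_def by meson

text \<open>The two candidates for the image of a product have the same position relative to every
  point of \<open>D'\<close>, so by density they agree for factors in \<open>D\<close>. Continuity
  of both sides then extends the equation to the closure of \<open>D \<times> D\<close>.\<close>

lemma dense_extension_hom:
  assumes "continuous_tnorm f" "continuous_tnorm f'"
    and D: "dense_in_unit D" "dense_in_unit D'"
    and h: "bij_betw h D D'" "strict_mono_on D h"
    and rel: "\<And>x y z. x \<in> D \<Longrightarrow> y \<in> D \<Longrightarrow> z \<in> D \<Longrightarrow> f (x, y) \<le> z \<longleftrightarrow> f' (h x, h y) \<le> h z"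
  shows "tnorm_isomorphic f f'"
proof -
  interpret A: tnorm f by standard fact
  interpret B: tnorm f' by standard fact
  obtain \<phi> where \<phi>: "bij_betw \<phi> {0..1} {0..1}" "strict_mono_on {0..1} \<phi>" "\<And>d. d \<in> D \<Longrightarrow> \<phi> d = h d"
    using order_iso_extends[OF D h] by blast
  have im: "\<phi> x \<in> {0..1}" if "x \<in> {0..1}" for x
    using bij_betwE[OF \<phi>(1)] that by blast
  have D01: "x \<in> {0..1}" if "x \<in> D" for x using that D(1) unfolding dense_in_unit_def by blast
  have le: "x \<le> y \<longleftrightarrow> \<phi> x \<le> \<phi> y" if "x \<in> {0..1}" "y \<in> {0..1}" for x y
    using strict_mono_on_leD[OF \<phi>(2)] strict_mono_onD[OF \<phi>(2)] that by (meson linorder_not_less)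
  have hom: "\<phi> (f (x, y)) = f' (\<phi> x, \<phi> y)" if xy: "x \<in> D" "y \<in> D" for x y
  proof -
    define p p' where "p = \<phi> (f (x, y))" and "p' = f' (\<phi> x, \<phi> y)"
    have p: "p \<in> {0..1}" "p' \<in> {0..1}"
      unfolding p_def p'_def by (intro im A.range B.range D01 xy)+
    have iff: "p \<le> z \<longleftrightarrow> p' \<le> z" if z: "z \<in> D'" for z
    proof -
      have "z \<in> h ` D" using z by (simp add: bij_betw_imp_surj_on[OF h(1)])
      then obtain w where w: "w \<in> D" "h w = z" by (elim imageE) simp
      have "p \<le> z \<longleftrightarrow> f (x, y) \<le> w"
        unfolding p_def using le[OF A.range[OF D01 D01, OF xy] D01[OF w(1)]] \<phi>(3) w by simp
      also have "\<dots> \<longleftrightarrow> p' \<le> z"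
        unfolding p'_def using rel[OF xy w(1)] \<phi>(3) xy w by simp
      finally show ?thesis .
    qed
    have "\<not> p < p'"
    proof
      assume "p < p'"
      then obtain z where "z \<in> D'" "p < z" "z < p'" using dense_in_unitE[OF D(2), of p p'] p by auto
      then show False using iff[of z] by auto
    qed
    moreover have "\<not> p' < p"
    proof
      assume "p' < p"
      then obtain z where "z \<in> D'" "p' < z" "z < p" using dense_in_unitE[OF D(2), of p' p] p by auto
      then show False using iff[of z] by auto
    qed
    ultimately show ?thesis unfolding p_def p'_def by simp
  qed
  have "continuous_on {0..1} \<phi>" by (rule order_iso_unit[OF \<phi>(1,2)])
  then have c1: "continuous_on unit_square (\<lambda>p. \<phi> (f p))"
    by (rule continuous_on_compose2[OF _ A.cont]) (use A.range in auto)
  have "continuous_on unit_square (\<lambda>p. (\<phi> (fst p), \<phi> (snd p)))"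
    by (intro continuous_on_Pair continuous_on_compose2[OF \<open>continuous_on {0..1} \<phi>\<close>] continuous_intros) auto
  then have c2: "continuous_on unit_square (\<lambda>p. f' (\<phi> (fst p), \<phi> (snd p)))"
    by (rule continuous_on_compose2[OF B.cont]) (use im in auto)
  have cl: "closure (D \<times> D) = unit_square"
    by (simp add: closure_Times dense_in_unit_closure[OF D(1)])
  have "\<phi> (f p) - f' (\<phi> (fst p), \<phi> (snd p)) = 0" if "p \<in> closure (D \<times> D)" for p
    by (rule continuous_constant_on_closure[where S = "D \<times> D"])
      (use that c1 c2 hom in \<open>auto simp: cl intro!: continuous_on_diff\<close>)
  then have "\<phi> (f (x, y)) = f' (\<phi> x, \<phi> y)" if "x \<in> {0..1}" "y \<in> {0..1}" for x y
    using that unfolding cl by fastforce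
  then show ?thesis
    unfolding tnorm_isomorphic_def using \<phi>(1) le by blast
qed

lemma comp_iso_imp_isomorphic:
  assumes "continuous_tnorm f" "continuous_tnorm f'" "comp_iso f f' \<pi>"
  shows "tnorm_isomorphic f f'"
proof -
  interpret A: tnorm f by standard fact
  interpret B: tnorm f' by standard fact
  define C where "C n = {y. conn f (rat_enum n) y}" for n
  define C' where "C' n = {y. conn f' (rat_enum n) y}" for n
  have \<pi>: "bij_betw \<pi> (reps f) (reps f')"
    and \<pi>_less: "\<And>m n. m \<in> reps f \<Longrightarrow> n \<in> reps f \<Longrightarrow> rat_enum m < rat_enum n \<Longrightarrow> rat_enum (\<pi> m) < rat_enum (\<pi> n)"
    and \<pi>_lab: "\<And>n. n \<in> reps f \<Longrightarrow> lab f (rat_enum n) = lab f' (rat_enum (\<pi> n))"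
    using assms(3) unfolding comp_iso_def by blast+
  have \<pi>_in: "\<pi> n \<in> reps f'" if "n \<in> reps f" for n
    using bij_betwE[OF \<pi>] that by blast
  have "\<exists>\<psi>. bij_betw \<psi> (C n) (C' (\<pi> n)) \<and> (\<forall>y\<in>C n. \<forall>z\<in>C n. y \<le> z \<longleftrightarrow> \<psi> y \<le> \<psi> z) \<and>
      (\<forall>y\<in>C n. \<forall>z\<in>C n. \<forall>w\<in>C n. f (y, z) \<le> w \<longleftrightarrow> f' (\<psi> y, \<psi> z) \<le> \<psi> w)" if n: "n \<in> reps f" for n
    by (rule component_iso[OF assms(1,2) conn_reps[OF n] conn_reps[OF \<pi>_in[OF n]] \<pi>_lab[OF n]])
      (auto simp: C_def C'_def)
  then obtain \<psi> where \<psi>: "\<And>n. n \<in> reps f \<Longrightarrow> bij_betw (\<psi> n) (C n) (C' (\<pi> n))"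
    "\<And>n y z. n \<in> reps f \<Longrightarrow> y \<in> C n \<Longrightarrow> z \<in> C n \<Longrightarrow> y \<le> z \<longleftrightarrow> \<psi> n y \<le> \<psi> n z"
    "\<And>n y z w. n \<in> reps f \<Longrightarrow> y \<in> C n \<Longrightarrow> z \<in> C n \<Longrightarrow> w \<in> C n \<Longrightarrow>
      f (y, z) \<le> w \<longleftrightarrow> f' (\<psi> n y, \<psi> n z) \<le> \<psi> n w"
    by metis
  define D D' where "D = {x. conn f x x}" and "D' = {x. conn f' x x}"
  define h where "h x = \<psi> (rep f x) x" for x
  have rep: "rep f x \<in> reps f" "x \<in> C (rep f x)" if "x \<in> D" for x
    using that rep_in_reps conn_rep conn_sym unfolding D_def C_def by blast+
  have h_in: "conn f' (rat_enum (\<pi> (rep f x))) (h x)" if "x \<in> D" for x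
    using bij_betwE[OF \<psi>(1)[OF rep(1)[OF that]]] rep(2)[OF that] unfolding h_def C'_def by blast
  have hD': "h x \<in> D'" if "x \<in> D" for x
    using h_in[OF that] conn_sym conn_refl unfolding D'_def by blast
  have rep_eq: "rep f x = rep f y \<longleftrightarrow> conn f x y" if "x \<in> D" "y \<in> D" for x y
  proof
    assume "rep f x = rep f y"
    then have "conn f x (rat_enum (rep f x))" "conn f y (rat_enum (rep f x))"
      using conn_rep[of f x] conn_rep[of f y] that unfolding D_def by simp_all
    then show "conn f x y" by (rule conn_trans[OF _ conn_sym])
  qed (rule rep_cong)
  have h_conn: "conn f' (h x) (h y) \<longleftrightarrow> conn f x y" if xy: "x \<in> D" "y \<in> D" for x y
  proof
    assume "conn f' (h x) (h y)"
    then have "conn f' (rat_enum (\<pi> (rep f x))) (rat_enum (\<pi> (rep f y)))"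
      by (rule conn_trans[OF conn_trans[OF h_in[OF xy(1)]] conn_sym[OF h_in[OF xy(2)]]])
    then have "\<pi> (rep f x) = \<pi> (rep f y)"
      by (rule reps_eqI[OF \<pi>_in[OF rep(1)[OF xy(1)]] \<pi>_in[OF rep(1)[OF xy(2)]]])
    then have "rep f x = rep f y"
      using bij_betw_imp_inj_on[OF \<pi>] rep(1) xy by (auto dest: inj_onD)
    then show "conn f x y" using rep_eq xy by blast
  next
    assume "conn f x y"
    then have "rep f x = rep f y" by (rule rep_cong)
    then show "conn f' (h x) (h y)"
      using conn_trans[OF conn_sym[OF h_in[OF xy(1)]]] h_in[OF xy(2)] by simp
  qed
  have h_less: "h x < h y" if xy: "x \<in> D" "y \<in> D" "x < y" for x y
  proof (cases "conn f x y")
    case True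
    then have eq: "rep f y = rep f x" using rep_cong by metis
    then have "y \<in> C (rep f x)" using rep(2)[OF xy(2)] by simp
    then show ?thesis
      using \<psi>(2)[OF rep(1)[OF xy(1)], of y x] rep(2)[OF xy(1)] xy(3) unfolding h_def eq by auto
  next
    case False
    have "rat_enum (rep f x) < rat_enum (rep f y)"
      by (rule conn_order[OF _ _ False xy(3)]) (use conn_rep xy D_def in auto)
    then have less: "rat_enum (\<pi> (rep f x)) < rat_enum (\<pi> (rep f y))"
      using \<pi>_less rep(1) xy by blast
    have "\<not> conn f' (rat_enum (\<pi> (rep f x))) (rat_enum (\<pi> (rep f y)))"
      using False h_conn[OF xy(1,2)] conn_trans[OF conn_trans[OF conn_sym[OF h_in[OF xy(1)]]] h_in[OF xy(2)]]
      by blast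
    then show ?thesis by (rule conn_order[OF h_in[OF xy(1)] h_in[OF xy(2)] _ less])
  qed
  have mono: "strict_mono_on D h" by (rule strict_mono_onI) (rule h_less)
  have "bij_betw h D D'"
    unfolding bij_betw_def
  proof (intro conjI equalityI subsetI)
    show "inj_on h D" by (rule strict_mono_on_imp_inj_on[OF mono])
    fix y assume "y \<in> D'"
    then have y: "conn f' y y" unfolding D'_def by simp
    have "rep f' y \<in> \<pi> ` reps f"
      using rep_in_reps[OF y] bij_betw_imp_surj_on[OF \<pi>] by simp
    then obtain n where n: "n \<in> reps f" "rep f' y = \<pi> n" by (elim imageE) simp
    have "y \<in> C' (\<pi> n)"
      using conn_rep[OF y] conn_sym unfolding C'_def n(2) by blast
    then have "y \<in> \<psi> n ` C n"
      using bij_betw_imp_surj_on[OF \<psi>(1)[OF n(1)]] by simp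
    then obtain x where x: "x \<in> C n" "y = \<psi> n x" by (elim imageE)
    then have "rep f x = n" using rep_eqI[OF n(1)] unfolding C_def by blast
    moreover have "x \<in> D" using x conn_sym conn_refl unfolding C_def D_def by blast
    ultimately show "y \<in> h ` D" using x unfolding h_def by blast
  qed (use hD' in blast)
  \<comment> \<open>If all three points share a component, its \<open>\<psi>\<close> decides. If
    only \<open>z\<close> lies elsewhere, the comparison reduces to \<open>x < z\<close>. If
    \<open>x\<close> and \<open>y\<close> lie in different components, the product is
    \<open>x\<close>. The case \<open>y < x\<close> follows by commutativity.\<close>
  moreover have "f (x, y) \<le> z \<longleftrightarrow> f' (h x, h y) \<le> h z" if xyz: "x \<in> D" "y \<in> D" "z \<in> D" "x \<le> y" for x y z
  proof (cases "conn f x y")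
    case True
    show ?thesis
    proof (cases "conn f x z")
      case z: True
      then have eq: "rep f y = rep f x" "rep f z = rep f x" using True rep_cong by metis+
      then have "y \<in> C (rep f x)" "z \<in> C (rep f x)" using rep(2) xyz by metis+
      then show ?thesis
        using \<psi>(3)[OF rep(1)[OF xyz(1)] rep(2)[OF xyz(1)]] unfolding h_def eq by blast
    next
      case False
      have "f (x, y) \<le> z \<longleftrightarrow> x < z"
        using A.conn_le_outside[OF True _ False] xyz D_def by blast
      moreover have "f' (h x, h y) \<le> h z \<longleftrightarrow> h x < h z"
        using B.conn_le_outside[of "h x" "h y" "h z"] h_conn xyz True False hD' D'_def by blast
      moreover have "x < z \<longleftrightarrow> h x < h z"
        using h_less[of x z] h_less[of z x] xyz by (cases x z rule: linorder_cases) auto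
      ultimately show ?thesis by simp
    qed
  next
    case False
    then have less: "x < y" using xyz D_def by (cases "x = y") auto
    have "f (x, y) = x"
      by (rule A.not_conn_min[OF _ _ False less]) (use xyz D_def in auto)
    moreover have "f' (h x, h y) = h x"
      by (rule B.not_conn_min[OF _ _ _ h_less]) (use xyz hD' D'_def h_conn False less in auto)
    moreover have "x \<le> z \<longleftrightarrow> h x \<le> h z"
      using h_less[of x z] h_less[of z x] xyz by (cases x z rule: linorder_cases) auto
    ultimately show ?thesis by simp
  qed
  then have "f (x, y) \<le> z \<longleftrightarrow> f' (h x, h y) \<le> h z" if xyz: "x \<in> D" "y \<in> D" "z \<in> D" for x y z
  proof (cases "x \<le> y")
    case False
    have "f (x, y) = f (y, x)"
      by (rule A.commute) (use xyz conn_bounds(1,2)[THEN less_imp_le] D_def in auto)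
    moreover have "f' (h x, h y) = f' (h y, h x)"
      by (rule B.commute) (use hD'[OF xyz(1)] hD'[OF xyz(2)] conn_bounds(1,2)[THEN less_imp_le] D'_def in auto)
    moreover have "f (y, x) \<le> z \<longleftrightarrow> f' (h y, h x) \<le> h z"
      using \<open>\<And>x y z. x \<in> D \<Longrightarrow> y \<in> D \<Longrightarrow> z \<in> D \<Longrightarrow> x \<le> y \<Longrightarrow> _\<close>[of y x z] xyz False by simp
    ultimately show ?thesis by simp
  qed (use xyz in blast)
  ultimately show ?thesis
    by (intro dense_extension_hom[OF assms(1,2) A.dense_conn B.dense_conn, folded D_def D'_def]) (use mono in blast)+
qed

section \<open>Invariance of components and labels under isomorphism\<close>

definition tnorm_hom_iso :: "(real \<times> real \<Rightarrow> real) \<Rightarrow> (real \<times> real \<Rightarrow> real) \<Rightarrow> (real \<Rightarrow> real) \<Rightarrow> bool" where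
  "tnorm_hom_iso f g \<phi> \<longleftrightarrow> bij_betw \<phi> {0..1} {0..1} \<and>
     (\<forall>x\<in>{0..1}. \<forall>y\<in>{0..1}. x \<le> y \<longleftrightarrow> \<phi> x \<le> \<phi> y) \<and>
     (\<forall>x\<in>{0..1}. \<forall>y\<in>{0..1}. \<phi> (f (x, y)) = g (\<phi> x, \<phi> y))"

lemma tnorm_isomorphic_iff: "tnorm_isomorphic f g \<longleftrightarrow> (\<exists>\<phi>. tnorm_hom_iso f g \<phi>)"
  unfolding tnorm_isomorphic_def tnorm_hom_iso_def ..

lemma tnorm_hom_isoD:
  assumes "tnorm_hom_iso f g \<phi>"
  shows "x \<in> {0..1} \<Longrightarrow> \<phi> x \<in> {0..1}"
    "x \<in> {0..1} \<Longrightarrow> y \<in> {0..1} \<Longrightarrow> \<phi> x \<le> \<phi> y \<longleftrightarrow> x \<le> y"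
    "x \<in> {0..1} \<Longrightarrow> y \<in> {0..1} \<Longrightarrow> \<phi> x < \<phi> y \<longleftrightarrow> x < y"
    "x \<in> {0..1} \<Longrightarrow> y \<in> {0..1} \<Longrightarrow> \<phi> (f (x, y)) = g (\<phi> x, \<phi> y)"
    "y \<in> {0..1} \<Longrightarrow> \<exists>x\<in>{0..1}. y = \<phi> x"
proof -
  note a = assms[unfolded tnorm_hom_iso_def]
  show "x \<in> {0..1} \<Longrightarrow> \<phi> x \<in> {0..1}" using a bij_betwE by blast
  show le: "\<phi> x \<le> \<phi> y \<longleftrightarrow> x \<le> y" if "x \<in> {0..1}" "y \<in> {0..1}" for x y using a that by blast
  show "\<phi> x < \<phi> y \<longleftrightarrow> x < y" if "x \<in> {0..1}" "y \<in> {0..1}" using le[OF that(2,1)] by linarith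
  show "x \<in> {0..1} \<Longrightarrow> y \<in> {0..1} \<Longrightarrow> \<phi> (f (x, y)) = g (\<phi> x, \<phi> y)" using a by blast
  show "\<exists>x\<in>{0..1}. y = \<phi> x" if "y \<in> {0..1}"
  proof -
    have "y \<in> \<phi> ` {0..1}" using a that bij_betw_imp_surj_on by metis
    then show ?thesis by blast
  qed
qed

lemma tnorm_hom_iso_inv:
  assumes "continuous_tnorm f" "tnorm_hom_iso f g \<phi>"
  defines "\<phi>' \<equiv> inv_into {0..1} \<phi>"
  shows "tnorm_hom_iso g f \<phi>'" "x \<in> {0..1} \<Longrightarrow> \<phi>' (\<phi> x) = x" "x \<in> {0..1} \<Longrightarrow> \<phi> (\<phi>' x) = x"
proof -
  interpret A: tnorm f by standard fact
  note a = assms(2)[unfolded tnorm_hom_iso_def] and d = tnorm_hom_isoD[OF assms(2)]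
  have bij: "bij_betw \<phi>' {0..1} {0..1}" unfolding \<phi>'_def using a bij_betw_inv_into by blast
  show l: "\<phi>' (\<phi> x) = x" if "x \<in> {0..1}" for x
    unfolding \<phi>'_def using a that bij_betw_inv_into_left by metis
  show r: "\<phi> (\<phi>' x) = x" if "x \<in> {0..1}" for x
    unfolding \<phi>'_def using a that bij_betw_inv_into_right by metis
  have in01: "\<phi>' x \<in> {0..1}" if "x \<in> {0..1}" for x using bij_betwE[OF bij] that by blast
  have "x \<le> y \<longleftrightarrow> \<phi>' x \<le> \<phi>' y" if "x \<in> {0..1}" "y \<in> {0..1}" for x y
    using d(2)[OF in01 in01, OF that] r that by simp
  moreover have "\<phi>' (g (x, y)) = f (\<phi>' x, \<phi>' y)" if "x \<in> {0..1}" "y \<in> {0..1}" for x y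
    using d(4)[OF in01 in01, OF that] r l[OF A.range[OF in01 in01, OF that]] that by simp
  ultimately show "tnorm_hom_iso g f \<phi>'" unfolding tnorm_hom_iso_def using bij by blast
qed

text \<open>The images of the rational bounds need not be rational. New rational bounds are chosen
  between these images and the two points; the smaller interval inherits uniformity.\<close>

lemma conn_transfer:
  assumes "continuous_tnorm f" "tnorm_hom_iso f g \<phi>" "conn f x y"
  shows "conn g (\<phi> x) (\<phi> y)"
proof -
  interpret A: tnorm f by standard fact
  note d = tnorm_hom_isoD[OF assms(2)]
  obtain m n where mn: "rat_enum m < x" "rat_enum m < y" "x < rat_enum n" "y < rat_enum n"
    "uniform_on f (rat_enum m) (rat_enum n)"
    using assms(3) unfolding conn_def by blast
  have xy: "x \<in> {0..1}" "y \<in> {0..1}" using conn_bounds[OF assms(3)] by auto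
  have q: "rat_enum k \<in> {0..1}" for k using rat_enum_bounds[of k] by auto
  have "0 \<le> \<phi> (rat_enum m)" "\<phi> (rat_enum n) \<le> 1" using d(1)[OF q] by auto
  have "\<phi> (rat_enum m) < min (\<phi> x) (\<phi> y)" "max (\<phi> x) (\<phi> y) < \<phi> (rat_enum n)"
    using mn d(3)[OF q xy(1)] d(3)[OF q xy(2)] d(3)[OF xy(1) q] d(3)[OF xy(2) q] by simp_all
  moreover have "min (\<phi> x) (\<phi> y) \<le> 1" "0 \<le> max (\<phi> x) (\<phi> y)" using d(1) xy by (auto simp: min_def max_def)
  ultimately have lt: "\<phi> (rat_enum m) < min (\<phi> x) (\<phi> y)" "max (\<phi> x) (\<phi> y) < \<phi> (rat_enum n)"
    and le: "min (\<phi> x) (\<phi> y) \<le> 1" "0 \<le> max (\<phi> x) (\<phi> y)" .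
  obtain m' where m': "\<phi> (rat_enum m) < rat_enum m'" "rat_enum m' < min (\<phi> x) (\<phi> y)"
    by (rule rat_enum_dense[OF \<open>0 \<le> \<phi> (rat_enum m)\<close> lt(1) le(1)])
  obtain n' where n': "max (\<phi> x) (\<phi> y) < rat_enum n'" "rat_enum n' < \<phi> (rat_enum n)"
    by (rule rat_enum_dense[OF le(2) lt(2) \<open>\<phi> (rat_enum n) \<le> 1\<close>])
  have *: "\<exists>w\<in>{rat_enum m..rat_enum n}. w \<in> {0..1} \<and> z = \<phi> w" if z: "z \<in> {rat_enum m'..rat_enum n'}" for z
  proof -
    have "z \<in> {0..1}" using z q[of m'] q[of n'] by auto
    then obtain w where w: "w \<in> {0..1}" "z = \<phi> w" using d(5) by blast
    then have "\<phi> (rat_enum m) < \<phi> w" "\<phi> w < \<phi> (rat_enum n)" using z m' n' by auto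
    then show ?thesis using w d(3)[OF q w(1)] d(3)[OF w(1) q] by (intro bexI[of _ w]) simp_all
  qed
  have "uniform_on g (rat_enum m') (rat_enum n')"
    using mn(5)
    unfolding uniform_on_def
  proof (elim disjE)
    assume u: "\<forall>z\<in>{rat_enum m..rat_enum n}. f (z, z) < z"
    have "g (z, z) < z" if z: "z \<in> {rat_enum m'..rat_enum n'}" for z
    proof -
      obtain w where w: "w \<in> {rat_enum m..rat_enum n}" "w \<in> {0..1}" "z = \<phi> w" using *[OF z] by blast
      then show ?thesis using u d(4)[of w w] d(3)[OF A.range[of w w], of w] by auto
    qed
    then show "(\<forall>z\<in>{rat_enum m'..rat_enum n'}. g (z, z) < z) \<or> (\<forall>z\<in>{rat_enum m'..rat_enum n'}. g (z, z) = z)" by blast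
  next
    assume u: "\<forall>z\<in>{rat_enum m..rat_enum n}. f (z, z) = z"
    have "g (z, z) = z" if z: "z \<in> {rat_enum m'..rat_enum n'}" for z
    proof -
      obtain w where w: "w \<in> {rat_enum m..rat_enum n}" "w \<in> {0..1}" "z = \<phi> w" using *[OF z] by blast
      then show ?thesis using u d(4)[of w w] by auto
    qed
    then show "(\<forall>z\<in>{rat_enum m'..rat_enum n'}. g (z, z) < z) \<or> (\<forall>z\<in>{rat_enum m'..rat_enum n'}. g (z, z) = z)" by blast
  qed
  then show ?thesis unfolding conn_def using m' n' by auto
qed

lemma nilpotent_transfer:
  assumes "continuous_tnorm f" "continuous_tnorm g" "tnorm_hom_iso f g \<phi>"
    and "\<exists>r. conn f x r \<and> (\<forall>s. conn f x s \<longrightarrow> f (r, r) \<le> s)"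
  shows "\<exists>r. conn g (\<phi> x) r \<and> (\<forall>s. conn g (\<phi> x) s \<longrightarrow> g (r, r) \<le> s)"
proof -
  interpret A: tnorm f by standard fact
  note d = tnorm_hom_isoD[OF assms(3)]
  define \<phi>' where "\<phi>' = inv_into {0..1} \<phi>"
  note i = tnorm_hom_iso_inv[OF assms(1,3), folded \<phi>'_def]
  obtain r where r: "conn f x r" "\<And>s. conn f x s \<Longrightarrow> f (r, r) \<le> s" using assms(4) by blast
  have r01: "x \<in> {0..1}" "r \<in> {0..1}" using conn_bounds[OF r(1)] by auto
  show ?thesis
  proof (intro exI conjI allI impI)
    show "conn g (\<phi> x) (\<phi> r)" by (rule conn_transfer[OF assms(1,3) r(1)])
    fix s assume s: "conn g (\<phi> x) s"
    have s01: "s \<in> {0..1}" using conn_bounds[OF s] by auto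
    have "conn f (\<phi>' (\<phi> x)) (\<phi>' s)" by (rule conn_transfer[OF assms(2) i(1) s])
    then have "f (r, r) \<le> \<phi>' s" using r(2) i(2) r01 by simp
    then have "\<phi> (f (r, r)) \<le> \<phi> (\<phi>' s)"
      using d(2)[OF A.range[OF r01(2,2)] tnorm_hom_isoD(1)[OF i(1) s01]] by simp
    then show "g (\<phi> r, \<phi> r) \<le> s" using d(4) r01 i(3)[OF s01] by simp
  qed
qed

text \<open>An isomorphism need not preserve rationals, so both labels are first brought into the
  form with real witnesses by \<open>nilpotent_iff\<close>.\<close>

lemma lab_transfer:
  assumes "continuous_tnorm f" "continuous_tnorm g" "tnorm_hom_iso f g \<phi>" "conn f x x"
  shows "lab f x = lab g (\<phi> x)"
proof -
  interpret A: tnorm f by standard fact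
  interpret B: tnorm g by standard fact
  note d = tnorm_hom_isoD[OF assms(3)]
  define \<phi>' where "\<phi>' = inv_into {0..1} \<phi>"
  note i = tnorm_hom_iso_inv[OF assms(1,3), folded \<phi>'_def]
  have x: "x \<in> {0..1}" using conn_bounds[OF assms(4)] by auto
  have "f (x, x) = x \<longleftrightarrow> g (\<phi> x, \<phi> x) = \<phi> x"
    using d(4)[OF x x] d(2)[OF A.range[OF x x] x] d(2)[OF x A.range[OF x x]] by force
  moreover have "(\<exists>r. conn f x r \<and> (\<forall>s. conn f x s \<longrightarrow> f (r, r) \<le> s)) \<longleftrightarrow>
      (\<exists>r. conn g (\<phi> x) r \<and> (\<forall>s. conn g (\<phi> x) s \<longrightarrow> g (r, r) \<le> s))"
    using nilpotent_transfer[OF assms(1-3), of x] nilpotent_transfer[OF assms(2,1) i(1), of "\<phi> x"] i(2)[OF x]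
    by metis
  ultimately show ?thesis
    unfolding lab_def A.nilpotent_iff[OF assms(4)] B.nilpotent_iff[OF conn_transfer[OF assms(1,3,4)]]
    by simp
qed

lemma isomorphic_imp_comp_iso:
  assumes "continuous_tnorm f" "continuous_tnorm g" "tnorm_hom_iso f g \<phi>"
  shows "comp_iso f g (\<lambda>n. rep g (\<phi> (rat_enum n)))"
proof -
  define \<phi>' where "\<phi>' = inv_into {0..1} \<phi>"
  note i = tnorm_hom_iso_inv[OF assms(1,3), folded \<phi>'_def] and d = tnorm_hom_isoD[OF assms(3)]
  note tr = conn_transfer[OF assms(1,3)] and tr' = conn_transfer[OF assms(2) i(1)]
  have q: "rat_enum k \<in> {0..1}" for k using rat_enum_bounds[of k] by auto
  have in_reps: "rep g (\<phi> (rat_enum n)) \<in> reps g" if "n \<in> reps f" for n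
    by (rule rep_in_reps[OF tr[OF conn_reps[OF that]]])
  have in_reps': "rep f (\<phi>' (rat_enum n)) \<in> reps f" if "n \<in> reps g" for n
    by (rule rep_in_reps[OF tr'[OF conn_reps[OF that]]])
  have inv: "rep f (\<phi>' (rat_enum (rep g (\<phi> (rat_enum n))))) = n" if n: "n \<in> reps f" for n
  proof (rule rep_eqI[OF n])
    have "conn f (\<phi>' (\<phi> (rat_enum n))) (\<phi>' (rat_enum (rep g (\<phi> (rat_enum n)))))"
      by (rule tr'[OF conn_rep[OF tr[OF conn_reps[OF n]]]])
    then show "conn f (rat_enum n) (\<phi>' (rat_enum (rep g (\<phi> (rat_enum n)))))" using i(2) q by simp
  qed
  have inv': "rep g (\<phi> (rat_enum (rep f (\<phi>' (rat_enum n))))) = n" if n: "n \<in> reps g" for n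
  proof (rule rep_eqI[OF n])
    have "conn g (\<phi> (\<phi>' (rat_enum n))) (\<phi> (rat_enum (rep f (\<phi>' (rat_enum n)))))"
      by (rule tr[OF conn_rep[OF tr'[OF conn_reps[OF n]]]])
    then show "conn g (rat_enum n) (\<phi> (rat_enum (rep f (\<phi>' (rat_enum n)))))" using i(3) q by simp
  qed
  show ?thesis
  proof (rule comp_isoI)
    show "bij_betw (\<lambda>n. rep g (\<phi> (rat_enum n))) (reps f) (reps g)"
      by (rule bij_betw_byWitness[where f' = "\<lambda>n. rep f (\<phi>' (rat_enum n))"])
        (use inv inv' in_reps in_reps' in auto)
  next
    fix m n assume mn: "m \<in> reps f" "n \<in> reps f" "rat_enum m < rat_enum n"
    show "rat_enum (rep g (\<phi> (rat_enum m))) < rat_enum (rep g (\<phi> (rat_enum n)))"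
    proof (rule conn_order)
      show "\<phi> (rat_enum m) < \<phi> (rat_enum n)" using mn d(3)[OF q q] by simp
      show "\<not> conn g (\<phi> (rat_enum m)) (\<phi> (rat_enum n))"
      proof
        assume "conn g (\<phi> (rat_enum m)) (\<phi> (rat_enum n))"
        then have "conn f (rat_enum m) (rat_enum n)" using tr' i(2) q by metis
        then show False using reps_eqI mn by blast
      qed
    qed (rule conn_rep[OF tr[OF conn_reps[OF mn(1)]]] conn_rep[OF tr[OF conn_reps[OF mn(2)]]])+
  next
    fix n assume n: "n \<in> reps f"
    interpret B: tnorm g by standard fact
    let ?y = "\<phi> (rat_enum n)"
    have c: "conn g ?y (rat_enum (rep g ?y))" by (rule conn_rep[OF tr[OF conn_reps[OF n]]])
    have "lab g ?y = lab g (rat_enum (rep g ?y))"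
      unfolding lab_def conn_uniform[OF c] conn_cong[OF c] ..
    then show "lab f (rat_enum n) = lab g (rat_enum (rep g ?y))"
      using lab_transfer[OF assms conn_reps[OF n]] by simp
  qed
qed

lemma tnorm_isomorphic_iff_comp_iso:
  assumes "continuous_tnorm f" "continuous_tnorm g"
  shows "tnorm_isomorphic f g \<longleftrightarrow> (\<exists>\<pi>. comp_iso f g \<pi>)"
  using comp_iso_imp_isomorphic[OF assms] isomorphic_imp_comp_iso[OF assms] tnorm_isomorphic_iff by blast

section \<open>Coding labelled orders as linear orders\<close>

text \<open>The points 0 to \<open>Suc k\<close> form \<open>k + 1\<close> covering pairs, from
  which \<open>k\<close> can be read off. There is at least one pair even for \<open>k = 0\<close>,
  so each block has a recognisable start. The ray has no least element, so the chain stops at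
  \<open>Suc k\<close>, and no greatest one, so no covering pair leads into the next block.\<close>

definition block :: "nat \<Rightarrow> rat set" where
  "block k = of_nat ` {..Suc k} \<union> {of_nat (Suc k)<..}"

definition block_sum :: "nat set \<Rightarrow> (nat \<Rightarrow> nat) \<Rightarrow> (nat \<times> rat) set" where
  "block_sum R L = Sigma R (\<lambda>n. block (L n))"

definition lex_less :: "nat \<times> rat \<Rightarrow> nat \<times> rat \<Rightarrow> bool" where
  "lex_less s t \<longleftrightarrow> rat_enum (fst s) < rat_enum (fst t) \<or> (fst s = fst t \<and> snd s < snd t)"

lemma lex_less_irrefl: "\<not> lex_less s s"
  and lex_less_trans: "lex_less s t \<Longrightarrow> lex_less t v \<Longrightarrow> lex_less s v"
  and lex_less_total: "s \<noteq> t \<Longrightarrow> lex_less s t \<or> lex_less t s"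
proof -
  show "\<not> lex_less s s" by (simp add: lex_less_def)
  show "lex_less s t \<Longrightarrow> lex_less t v \<Longrightarrow> lex_less s v" unfolding lex_less_def by auto
  show "lex_less s t \<or> lex_less t s" if "s \<noteq> t"
  proof (cases "fst s = fst t")
    case True
    then show ?thesis using that unfolding lex_less_def by (metis linorder_neqE prod_eqI)
  next
    case False
    then have "rat_enum (fst s) \<noteq> rat_enum (fst t)" by simp
    then show ?thesis unfolding lex_less_def by linarith
  qed
qed

lemma block_no_max: "x \<in> block k \<Longrightarrow> x + 1 \<in> block k"
  unfolding block_def
proof (elim UnE imageE)
  fix i assume i: "x = of_nat i" "i \<in> {..Suc k}"
  then have x1: "x + 1 = of_nat (Suc i)" by simp
  show "x + 1 \<in> of_nat ` {..Suc k} \<union> {of_nat (Suc k)<..}"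
  proof (cases "i = Suc k")
    case True then show ?thesis unfolding x1 by simp
  next
    case False
    then have "Suc i \<in> {..Suc k}" using i by simp
    then show ?thesis unfolding x1 by blast
  qed
qed auto

lemma of_nat_in_block: "i \<le> Suc k \<Longrightarrow> of_nat i \<in> block k"
  unfolding block_def by blast

lemma infinite_block: "infinite (block k)"
proof -
  have "infinite ((\<lambda>n. of_nat (Suc k) + of_nat (Suc n)) ` (UNIV :: nat set) :: rat set)"
    by (rule range_inj_infinite) (auto simp: inj_on_def)
  moreover have "(\<lambda>n. of_nat (Suc k) + of_nat (Suc n)) ` (UNIV :: nat set) \<subseteq> block k"
    by (auto simp: block_def)
  ultimately show ?thesis using finite_subset by blast
qed

section \<open>Recovering blocks and labels from covering pairs\<close>

definition covers :: "(nat \<times> rat) set \<Rightarrow> nat \<times> rat \<Rightarrow> nat \<times> rat \<Rightarrow> bool" where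
  "covers A s t \<longleftrightarrow> s \<in> A \<and> t \<in> A \<and> lex_less s t \<and> \<not> (\<exists>v\<in>A. lex_less s v \<and> lex_less v t)"

text \<open>A covering pair cannot leave its block, since \<open>x + 1\<close> would lie in between,
  and cannot start at or above \<open>Suc (L n)\<close>, from where on the block is densely
  ordered.\<close>

lemma covers_iff:
  assumes "n \<in> R"
  shows "covers (block_sum R L) (n, x) t \<longleftrightarrow>
    (\<exists>i\<le>L n. x = of_nat i \<and> t = (n, of_nat (Suc i)))"
proof
  assume c: "covers (block_sum R L) (n, x) t"
  obtain m y where t: "t = (m, y)" by fastforce
  have x: "x \<in> block (L n)" and y: "y \<in> block (L m)" "m \<in> R" and less: "lex_less (n, x) (m, y)"
    and no: "\<And>v. v \<in> block_sum R L \<Longrightarrow> lex_less (n, x) v \<Longrightarrow> \<not> lex_less v (m, y)"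
    using c unfolding covers_def t block_sum_def by auto
  have "n = m"
  proof (rule ccontr)
    assume "n \<noteq> m"
    then have "lex_less (n, x + 1) (m, y)" using less unfolding lex_less_def by auto
    moreover have "lex_less (n, x) (n, x + 1)" unfolding lex_less_def by simp
    moreover have "(n, x + 1) \<in> block_sum R L" using block_no_max[OF x] assms unfolding block_sum_def by simp
    ultimately show False using no by blast
  qed
  then have xy: "x < y" "y \<in> block (L n)" using less y unfolding lex_less_def by auto
  have no': "\<not> (x < v \<and> v < y)" if "v \<in> block (L n)" for v
    using no[of "(n, v)"] that assms \<open>n = m\<close> unfolding block_sum_def lex_less_def by auto
  have nlt: "\<not> of_nat (Suc (L n)) \<le> x"
  proof
    assume le: "of_nat (Suc (L n)) \<le> x"
    obtain v where v: "x < v" "v < y" using dense[OF xy(1)] by blast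
    then have "v \<in> block (L n)" using le unfolding block_def by auto
    then show False using no' v by blast
  qed
  then obtain i where i: "x = of_nat i" "i \<le> L n" using x unfolding block_def by auto
  have "of_nat (Suc i) \<in> block (L n)" by (rule of_nat_in_block) (use i in simp)
  then have "\<not> (of_nat (Suc i) < y)" using no'[of "of_nat (Suc i)"] i by auto
  moreover have "\<not> y < of_nat (Suc i)"
  proof
    assume lt: "y < of_nat (Suc i)"
    have "y \<notin> {of_nat (Suc (L n))<..}" using lt i by (auto simp: not_less intro: order_trans[OF less_imp_le])
    then obtain j where "y = of_nat j" using xy(2) unfolding block_def by blast
    then show False using lt xy(1) i(1) by simp
  qed
  ultimately have "y = of_nat (Suc i)" by linarith
  then show "\<exists>i\<le>L n. x = of_nat i \<and> t = (n, of_nat (Suc i))" using i t \<open>n = m\<close> by blast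
next
  assume "\<exists>i\<le>L n. x = of_nat i \<and> t = (n, of_nat (Suc i))"
  then obtain i where i: "i \<le> L n" "x = of_nat i" "t = (n, of_nat (Suc i))" by blast
  have "(n, x) \<in> block_sum R L" "t \<in> block_sum R L"
    using i assms of_nat_in_block[of i "L n"] of_nat_in_block[of "Suc i" "L n"] unfolding block_sum_def by simp_all
  moreover have "lex_less (n, x) t" using i unfolding lex_less_def by simp
  moreover have "\<not> (lex_less (n, x) v \<and> lex_less v t)" if v: "v \<in> block_sum R L" for v
  proof
    assume "lex_less (n, x) v \<and> lex_less v t"
    then have v': "fst v = n" "of_nat i < snd v" "snd v < of_nat (Suc i)"
      using i unfolding lex_less_def by auto
    have "snd v \<in> block (L n)" using v v'(1) unfolding block_sum_def by auto
    then consider j where "snd v = of_nat j" | "of_nat (Suc (L n)) < snd v"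
      unfolding block_def by blast
    then show False
    proof cases
      case 1 then show ?thesis using v' by simp
    next
      case 2
      have "(of_nat (Suc i) :: rat) \<le> of_nat (Suc (L n))" using i by simp
      then show ?thesis using 2 v'(3) by linarith
    qed
  qed
  ultimately show "covers (block_sum R L) (n, x) t" unfolding covers_def by blast
qed

text \<open>An order-theoretic description of the point 0 of a block
  (\<open>head_iff\<close>).\<close>

definition head :: "(nat \<times> rat) set \<Rightarrow> nat \<times> rat \<Rightarrow> bool" where
  "head A s \<longleftrightarrow> (\<exists>t. covers A s t) \<and> \<not> (\<exists>t. covers A t s)"

lemma head_iff: "head (block_sum R L) s \<longleftrightarrow> (\<exists>n\<in>R. s = (n, 0))"
proof
  assume h: "head (block_sum R L) s"
  obtain n x where s: "s = (n, x)" by fastforce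
  obtain t where t: "covers (block_sum R L) (n, x) t" using h unfolding head_def s by blast
  then have n: "n \<in> R" unfolding covers_def block_sum_def by blast
  obtain i where i: "i \<le> L n" "x = of_nat i" using t unfolding covers_iff[OF n] by blast
  have "i = 0"
  proof (rule ccontr)
    assume "i \<noteq> 0"
    then obtain j where "i = Suc j" using not0_implies_Suc by blast
    then have "covers (block_sum R L) (n, of_nat j) s" unfolding covers_iff[OF n] s using i by simp
    then show False using h unfolding head_def by blast
  qed
  then show "\<exists>n\<in>R. s = (n, 0)" using i s n by simp
next
  assume "\<exists>n\<in>R. s = (n, 0)"
  then obtain n where n: "n \<in> R" "s = (n, 0)" by blast
  have "covers (block_sum R L) (n, 0) (n, of_nat (Suc 0))"
    unfolding covers_iff[OF n(1)] by (intro exI[of _ 0]) simp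
  moreover have "\<not> covers (block_sum R L) (m, x) (n, 0)" for m x
  proof
    assume c: "covers (block_sum R L) (m, x) (n, 0)"
    then have m: "m \<in> R" unfolding covers_def block_sum_def by blast
    show False using c unfolding covers_iff[OF m] by (auto simp del: of_nat_Suc simp: of_nat_0_eq_iff)
  qed
  ultimately show "head (block_sum R L) s" unfolding head_def n(2) by (metis surj_pair)
qed

definition lex_iso :: "(nat \<times> rat) set \<Rightarrow> (nat \<times> rat) set \<Rightarrow> (nat \<times> rat \<Rightarrow> nat \<times> rat) \<Rightarrow> bool" where
  "lex_iso A B h \<longleftrightarrow> bij_betw h A B \<and> (\<forall>s\<in>A. \<forall>t\<in>A. lex_less s t \<longleftrightarrow> lex_less (h s) (h t))"

lemma lex_iso_inv:
  assumes "lex_iso A B h"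
  shows "lex_iso B A (inv_into A h)"
proof -
  have bij: "bij_betw h A B" using assms unfolding lex_iso_def by blast
  have "lex_less s t \<longleftrightarrow> lex_less (inv_into A h s) (inv_into A h t)" if "s \<in> B" "t \<in> B" for s t
  proof -
    have "inv_into A h s \<in> A" "inv_into A h t \<in> A"
      using bij_betwE[OF bij_betw_inv_into[OF bij]] that by blast+
    then show ?thesis using assms bij_betw_inv_into_right[OF bij] that unfolding lex_iso_def by metis
  qed
  then show ?thesis unfolding lex_iso_def using bij_betw_inv_into[OF bij] by blast
qed

lemma lex_iso_covers:
  assumes "lex_iso A B h" "covers A s t"
  shows "covers B (h s) (h t)"
proof -
  have bij: "bij_betw h A B" and less: "\<And>s t. s \<in> A \<Longrightarrow> t \<in> A \<Longrightarrow> lex_less s t \<longleftrightarrow> lex_less (h s) (h t)"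
    using assms(1) unfolding lex_iso_def by blast+
  have st: "s \<in> A" "t \<in> A" "lex_less s t" "\<And>v. v \<in> A \<Longrightarrow> lex_less s v \<Longrightarrow> \<not> lex_less v t"
    using assms(2) unfolding covers_def by blast+
  have "\<not> (lex_less (h s) v \<and> lex_less v (h t))" if v: "v \<in> B" for v
  proof -
    have "v \<in> h ` A" using v bij_betw_imp_surj_on[OF bij] by simp
    then obtain w where "w \<in> A" "v = h w" by (elim imageE)
    then show ?thesis using st less by blast
  qed
  then show ?thesis unfolding covers_def using st less bij_betwE[OF bij] by blast
qed

lemma lex_iso_head:
  assumes "lex_iso A B h" "head A s"
  shows "head B (h s)"
proof -
  have bij: "bij_betw h A B" using assms(1) unfolding lex_iso_def by blast
  obtain t where t: "covers A s t" using assms(2) unfolding head_def by blast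
  have s: "s \<in> A" using t unfolding covers_def by blast
  have "\<not> covers B v (h s)" for v
  proof
    assume "covers B v (h s)"
    then have "covers A (inv_into A h v) (inv_into A h (h s))" by (rule lex_iso_covers[OF lex_iso_inv[OF assms(1)]])
    then have "covers A (inv_into A h v) s" using bij_betw_inv_into_left[OF bij s] by simp
    then show False using assms(2) unfolding head_def by blast
  qed
  then show ?thesis using lex_iso_covers[OF assms(1) t] unfolding head_def by blast
qed

text \<open>Heads and covering pairs are invariant, so the image of the chain above
  \<open>(n, 0)\<close> is determined step by step. The inequality of labels is enough, because the
  inverse isomorphism supplies the other one.\<close>

lemma lex_iso_block:
  assumes h: "lex_iso (block_sum R L) (block_sum R' L') h" and n: "n \<in> R"
  obtains m where "m \<in> R'" "h (n, 0) = (m, 0)" "L n \<le> L' m"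
proof -
  have "head (block_sum R L) (n, 0)" unfolding head_iff using n by blast
  then have "head (block_sum R' L') (h (n, 0))" by (rule lex_iso_head[OF h])
  then obtain m where m: "m \<in> R'" "h (n, 0) = (m, 0)" unfolding head_iff by blast
  have step: "i \<le> Suc (L n) \<Longrightarrow> h (n, of_nat i) = (m, of_nat i) \<and> i \<le> Suc (L' m)" for i
  proof (induction i)
    case 0 then show ?case using m by simp
  next
    case (Suc i)
    then have IH: "h (n, of_nat i) = (m, of_nat i)" by simp
    have "covers (block_sum R L) (n, of_nat i) (n, of_nat (Suc i))"
      unfolding covers_iff[OF n] using Suc.prems by (intro exI[of _ i]) simp
    then have "covers (block_sum R' L') (m, of_nat i) (h (n, of_nat (Suc i)))"
      using lex_iso_covers[OF h] IH by metis
    then obtain j where "j \<le> L' m" "(of_nat i :: rat) = of_nat j" "h (n, of_nat (Suc i)) = (m, of_nat (Suc j))"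
      unfolding covers_iff[OF m(1)] by blast
    then show ?case by simp
  qed
  have "L n \<le> L' m" using step[of "Suc (L n)"] by simp
  then show ?thesis using that m by blast
qed

lemma lex_iso_block_sum_iff:
  "(\<exists>h. lex_iso (block_sum R L) (block_sum R' L') h) \<longleftrightarrow>
   (\<exists>\<pi>. bij_betw \<pi> R R' \<and> (\<forall>m\<in>R. \<forall>n\<in>R. rat_enum m < rat_enum n \<longleftrightarrow> rat_enum (\<pi> m) < rat_enum (\<pi> n)) \<and>
     (\<forall>n\<in>R. L n = L' (\<pi> n)))"
proof
  assume "\<exists>h. lex_iso (block_sum R L) (block_sum R' L') h"
  then obtain h where h: "lex_iso (block_sum R L) (block_sum R' L') h" by blast
  define k where "k = inv_into (block_sum R L) h"
  have k: "lex_iso (block_sum R' L') (block_sum R L) k" unfolding k_def by (rule lex_iso_inv[OF h])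
  have bij: "bij_betw h (block_sum R L) (block_sum R' L')" using h unfolding lex_iso_def by blast
  have zero: "(n, 0) \<in> block_sum R L" if "n \<in> R" for n R L
    using that of_nat_in_block[of 0 "L n"] unfolding block_sum_def by simp
  have kh: "k (h (n, 0)) = (n, 0)" if "n \<in> R" for n
    unfolding k_def by (rule bij_betw_inv_into_left[OF bij zero[OF that]])
  have hk: "h (k (n, 0)) = (n, 0)" if "n \<in> R'" for n
    unfolding k_def by (rule bij_betw_inv_into_right[OF bij zero[OF that]])
  define \<pi> where "\<pi> n = fst (h (n, 0))" for n
  define \<rho> where "\<rho> n = fst (k (n, 0))" for n
  have \<pi>: "\<pi> n \<in> R' \<and> h (n, 0) = (\<pi> n, 0) \<and> L n \<le> L' (\<pi> n)" if n: "n \<in> R" for n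
    by (rule lex_iso_block[OF h n]) (simp add: \<pi>_def)
  have \<rho>: "\<rho> n \<in> R \<and> k (n, 0) = (\<rho> n, 0) \<and> L' n \<le> L (\<rho> n)" if n: "n \<in> R'" for n
    by (rule lex_iso_block[OF k n]) (simp add: \<rho>_def)
  have \<rho>\<pi>: "\<rho> (\<pi> n) = n" if n: "n \<in> R" for n
    using \<pi>[OF n] kh[OF n] by (simp add: \<rho>_def)
  have \<pi>\<rho>: "\<pi> (\<rho> n) = n" if n: "n \<in> R'" for n
    using \<rho>[OF n] hk[OF n] by (simp add: \<pi>_def)
  have "bij_betw \<pi> R R'"
    by (rule bij_betw_byWitness[where f' = \<rho>]) (use \<pi> \<rho> \<rho>\<pi> \<pi>\<rho> in auto)
  moreover have "rat_enum m < rat_enum n \<longleftrightarrow> rat_enum (\<pi> m) < rat_enum (\<pi> n)" if "m \<in> R" "n \<in> R" for m n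
  proof -
    have "lex_less (m, 0) (n, 0) \<longleftrightarrow> lex_less (h (m, 0)) (h (n, 0))"
      using h zero that unfolding lex_iso_def by blast
    then show ?thesis using \<pi>[OF that(1)] \<pi>[OF that(2)] unfolding lex_less_def by simp
  qed
  moreover have "L n = L' (\<pi> n)" if n: "n \<in> R" for n
    using \<pi>[OF n] \<rho>[of "\<pi> n"] \<rho>\<pi>[OF n] by force
  ultimately show "\<exists>\<pi>. bij_betw \<pi> R R' \<and> (\<forall>m\<in>R. \<forall>n\<in>R. rat_enum m < rat_enum n \<longleftrightarrow> rat_enum (\<pi> m) < rat_enum (\<pi> n)) \<and>
     (\<forall>n\<in>R. L n = L' (\<pi> n))" by blast
next
  assume "\<exists>\<pi>. bij_betw \<pi> R R' \<and> (\<forall>m\<in>R. \<forall>n\<in>R. rat_enum m < rat_enum n \<longleftrightarrow> rat_enum (\<pi> m) < rat_enum (\<pi> n)) \<and>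
     (\<forall>n\<in>R. L n = L' (\<pi> n))"
  then obtain \<pi> where \<pi>: "bij_betw \<pi> R R'" "\<And>m n. m \<in> R \<Longrightarrow> n \<in> R \<Longrightarrow> rat_enum m < rat_enum n \<longleftrightarrow> rat_enum (\<pi> m) < rat_enum (\<pi> n)"
    "\<And>n. n \<in> R \<Longrightarrow> L n = L' (\<pi> n)" by blast
  define h where "h s = (\<pi> (fst s), snd s :: rat)" for s
  define k where "k s = (inv_into R \<pi> (fst s), snd s :: rat)" for s
  have inj: "\<pi> m = \<pi> n \<longleftrightarrow> m = n" if "m \<in> R" "n \<in> R" for m n
    using bij_betw_imp_inj_on[OF \<pi>(1)] that by (auto dest: inj_onD)
  have "bij_betw h (block_sum R L) (block_sum R' L')"
  proof (rule bij_betw_byWitness[where f' = k])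
    have inv_in: "inv_into R \<pi> n \<in> R" if "n \<in> R'" for n
      using bij_betwE[OF bij_betw_inv_into[OF \<pi>(1)]] that by blast
    show "h ` block_sum R L \<subseteq> block_sum R' L'"
      using \<pi>(3) bij_betwE[OF \<pi>(1)] unfolding block_sum_def h_def by auto
    show "k ` block_sum R' L' \<subseteq> block_sum R L"
      using \<pi>(3)[OF inv_in] inv_in bij_betw_inv_into_right[OF \<pi>(1)] unfolding block_sum_def k_def by auto
  qed (auto simp: block_sum_def h_def k_def bij_betw_inv_into_left[OF \<pi>(1)] bij_betw_inv_into_right[OF \<pi>(1)])
  moreover have "lex_less s t \<longleftrightarrow> lex_less (h s) (h t)" if "s \<in> block_sum R L" "t \<in> block_sum R L" for s t
    using that \<pi>(2)[of "fst s" "fst t"] inj[of "fst s" "fst t"] unfolding block_sum_def lex_less_def h_def by auto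
  ultimately show "\<exists>h. lex_iso (block_sum R L) (block_sum R' L') h" unfolding lex_iso_def by blast
qed

section \<open>The linear order attached to a t-norm\<close>

definition dec :: "nat \<Rightarrow> nat \<times> rat" where
  "dec = from_nat_into UNIV"

lemma bij_dec: "bij dec"
  unfolding dec_def by (rule bij_betw_from_nat_into) (auto simp: finite_prod infinite_UNIV_char_0)

definition code_set :: "(real \<times> real \<Rightarrow> real) \<Rightarrow> nat set" where
  "code_set f = dec -` block_sum (reps f) (\<lambda>n. lab f (rat_enum n))"

text \<open>The block sum is a subset of \<open>nat \<times> rat\<close> that varies with
  \<open>f\<close>. Enumerating its infinite preimage under the fixed bijection \<open>dec\<close>
  moves its order to all natural numbers.\<close>

definition order_of :: "(real \<times> real \<Rightarrow> real) \<Rightarrow> nat \<times> nat \<Rightarrow> bool" where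
  "order_of f p = lex_less (dec (enumerate (code_set f) (fst p))) (dec (enumerate (code_set f) (snd p)))"

lemma infinite_code_set:
  assumes "continuous_tnorm f"
  shows "infinite (code_set f)"
proof
  interpret tnorm f by standard fact
  obtain x where "conn f x x" using dense_in_unitE[OF dense_conn, of 0 1] by auto
  then have n: "rep f x \<in> reps f" by (rule rep_in_reps)
  have "infinite (Pair (rep f x) ` block (lab f (rat_enum (rep f x))))"
    by (subst finite_image_iff) (auto simp: infinite_block inj_on_def)
  moreover assume "finite (code_set f)"
  then have "finite (dec ` code_set f)" by simp
  then have "finite (block_sum (reps f) (\<lambda>n. lab f (rat_enum n)))"
    unfolding code_set_def using bij_dec by (simp add: surj_image_vimage_eq bij_is_surj)
  then have "finite (Pair (rep f x) ` block (lab f (rat_enum (rep f x))))"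
    by (rule rev_finite_subset) (use n in \<open>auto simp: block_sum_def\<close>)
  ultimately show False by blast
qed

lemma bij_betw_dec_enumerate:
  assumes "continuous_tnorm f"
  shows "bij_betw (\<lambda>i. dec (enumerate (code_set f) i)) UNIV (block_sum (reps f) (\<lambda>n. lab f (rat_enum n)))"
proof -
  have "bij_betw dec (code_set f) (block_sum (reps f) (\<lambda>n. lab f (rat_enum n)))"
    unfolding code_set_def bij_betw_def using bij_dec
    by (auto simp: surj_image_vimage_eq bij_is_surj intro: inj_on_subset[OF bij_is_inj])
  from bij_betw_trans[OF bij_enumerate[OF infinite_code_set[OF assms]] this]
  show ?thesis by (simp add: o_def)
qed

lemma order_of_in_LO:
  assumes "continuous_tnorm f"
  shows "order_of f \<in> LO"
proof -
  have inj: "inj (\<lambda>i. dec (enumerate (code_set f) i))"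
    using bij_betw_imp_inj_on[OF bij_betw_dec_enumerate[OF assms]] .
  have "irreflp (curry (order_of f))" by (rule irreflpI) (simp add: order_of_def lex_less_irrefl)
  moreover have "transp (curry (order_of f))"
    by (rule transpI) (simp add: order_of_def, erule (1) lex_less_trans)
  moreover have "totalp (curry (order_of f))"
  proof (rule totalpI)
    fix i j :: nat assume "i \<noteq> j"
    then have "dec (enumerate (code_set f) i) \<noteq> dec (enumerate (code_set f) j)"
      using inj by (auto dest: injD)
    then show "curry (order_of f) i j \<or> curry (order_of f) j i"
      using lex_less_total by (simp add: order_of_def)
  qed
  ultimately show ?thesis unfolding LO_def by blast
qed

lemma LO_isomorphic_order_of_iff:
  assumes "continuous_tnorm f" "continuous_tnorm g"
  shows "LO_isomorphic (order_of f) (order_of g) \<longleftrightarrow> tnorm_isomorphic f g"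
proof -
  define A where "A = block_sum (reps f) (\<lambda>n. lab f (rat_enum n))"
  define B where "B = block_sum (reps g) (\<lambda>n. lab g (rat_enum n))"
  define E where "E i = dec (enumerate (code_set f) i)" for i
  define E' where "E' i = dec (enumerate (code_set g) i)" for i
  have E: "bij_betw E UNIV A" unfolding E_def A_def by (rule bij_betw_dec_enumerate[OF assms(1)])
  have E': "bij_betw E' UNIV B" unfolding E'_def B_def by (rule bij_betw_dec_enumerate[OF assms(2)])
  have f: "order_of f (i, j) \<longleftrightarrow> lex_less (E i) (E j)" for i j by (simp add: order_of_def E_def)
  have g: "order_of g (i, j) \<longleftrightarrow> lex_less (E' i) (E' j)" for i j by (simp add: order_of_def E'_def)
  have "LO_isomorphic (order_of f) (order_of g) \<longleftrightarrow> (\<exists>h. lex_iso A B h)"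
  proof
    assume "LO_isomorphic (order_of f) (order_of g)"
    then obtain \<pi> where \<pi>: "bij \<pi>" "\<And>i j. lex_less (E i) (E j) \<longleftrightarrow> lex_less (E' (\<pi> i)) (E' (\<pi> j))"
      unfolding LO_isomorphic_def f g by blast
    define h where "h = (E' \<circ> \<pi>) \<circ> inv_into UNIV E"
    have "bij_betw h A B"
      unfolding h_def by (rule bij_betw_trans[OF bij_betw_inv_into[OF E] bij_betw_trans[OF \<pi>(1) E']])
    moreover have "lex_less s t \<longleftrightarrow> lex_less (h s) (h t)" if "s \<in> A" "t \<in> A" for s t
      using \<pi>(2)[of "inv_into UNIV E s" "inv_into UNIV E t"] bij_betw_inv_into_right[OF E] that
      by (simp add: h_def)
    ultimately show "\<exists>h. lex_iso A B h" unfolding lex_iso_def by blast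
  next
    assume "\<exists>h. lex_iso A B h"
    then obtain h where h: "bij_betw h A B" "\<And>s t. s \<in> A \<Longrightarrow> t \<in> A \<Longrightarrow> lex_less s t \<longleftrightarrow> lex_less (h s) (h t)"
      unfolding lex_iso_def by blast
    define \<pi> where "\<pi> = inv_into UNIV E' \<circ> (h \<circ> E)"
    have hE: "bij_betw (h \<circ> E) UNIV B" by (rule bij_betw_trans[OF E h(1)])
    have "bij \<pi>"
      unfolding \<pi>_def by (rule bij_betw_trans[OF hE bij_betw_inv_into[OF E']])
    moreover have "E' (\<pi> i) = h (E i)" for i
      using bij_betw_inv_into_right[OF E', of "h (E i)"] bij_betwE[OF hE] by (simp add: \<pi>_def)
    then have "order_of f (i, j) \<longleftrightarrow> order_of g (\<pi> i, \<pi> j)" for i j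
      unfolding f g using h(2) bij_betwE[OF E] by simp
    ultimately show "LO_isomorphic (order_of f) (order_of g)" unfolding LO_isomorphic_def by blast
  qed
  also have "\<dots> \<longleftrightarrow> tnorm_isomorphic f g"
    unfolding A_def B_def lex_iso_block_sum_iff tnorm_isomorphic_iff_comp_iso[OF assms] comp_iso_def ..
  finally show ?thesis .
qed

section \<open>Measurability of the coding\<close>

lemma openin_tnorm_space:
  "openin tnorm_space U \<longleftrightarrow> U \<subseteq> topspace tnorm_space \<and>
     (\<forall>f\<in>U. \<exists>r>0. \<forall>g\<in>topspace tnorm_space. (SUP p\<in>unit_square. \<bar>f p - g p\<bar>) < r \<longrightarrow> g \<in> U)"
proof -
  interpret Metric_space "mspace tnorm_metric" "mdist tnorm_metric"
    by (rule Metric_space_mspace_mdist)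
  have top: "topspace tnorm_space = mspace tnorm_metric" by (simp add: tnorm_space_def)
  have "mball f r \<subseteq> U \<longleftrightarrow> (\<forall>g\<in>mspace tnorm_metric. (SUP p\<in>unit_square. \<bar>f p - g p\<bar>) < r \<longrightarrow> g \<in> U)"
    if "f \<in> mspace tnorm_metric" for f r
  proof -
    have "g \<in> mball f r \<longleftrightarrow> g \<in> mspace tnorm_metric \<and> (SUP p\<in>unit_square. \<bar>f p - g p\<bar>) < r" for g
      using that by (auto simp: mdist_tnorm_metric)
    then show ?thesis by blast
  qed
  then have "openin mtopology U \<longleftrightarrow> U \<subseteq> mspace tnorm_metric \<and>
     (\<forall>f\<in>U. \<exists>r>0. \<forall>g\<in>mspace tnorm_metric. (SUP p\<in>unit_square. \<bar>f p - g p\<bar>) < r \<longrightarrow> g \<in> U)"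
    unfolding openin_mtopology by (meson subsetD)
  then show ?thesis unfolding top by (simp add: tnorm_space_def mtopology_of_def)
qed

lemma in_tnorm_space: "f \<in> topspace tnorm_space \<Longrightarrow> continuous_tnorm f"
  by (simp add: topspace_tnorm_space)

lemma tnorm_le_SUP:
  assumes "f \<in> topspace tnorm_space" "g \<in> topspace tnorm_space" "p \<in> unit_square"
  shows "\<bar>f p - g p\<bar> \<le> (SUP p\<in>unit_square. \<bar>f p - g p\<bar>)"
proof (rule cSUP_upper[OF assms(3)])
  interpret A: tnorm f by standard (rule in_tnorm_space[OF assms(1)])
  interpret B: tnorm g by standard (rule in_tnorm_space[OF assms(2)])
  show "bdd_above ((\<lambda>p. \<bar>f p - g p\<bar>) ` unit_square)"
  proof (rule bdd_aboveI2[of _ _ 1])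
    fix p assume "p \<in> unit_square"
    then have "f p \<in> {0..1}" "g p \<in> {0..1}"
      using A.range[of "fst p" "snd p"] B.range[of "fst p" "snd p"] by auto
    then show "\<bar>f p - g p\<bar> \<le> 1" by auto
  qed
qed

text \<open>Evaluation at a point is 1-Lipschitz for the sup metric, hence continuous.\<close>

lemma measurable_eval:
  assumes "p \<in> unit_square"
  shows "(\<lambda>f. f p) \<in> borel_measurable (borel_of_topology tnorm_space)"
proof (rule borel_measurableI)
  fix V :: "real set" assume V: "open V"
  have "openin tnorm_space ((\<lambda>f. f p) -` V \<inter> topspace tnorm_space)"
    unfolding openin_tnorm_space
  proof (intro conjI ballI)
    fix f assume f: "f \<in> (\<lambda>f. f p) -` V \<inter> topspace tnorm_space"
    then obtain r where r: "r > 0" "\<And>y. dist y (f p) < r \<Longrightarrow> y \<in> V"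
      using V unfolding open_dist by blast
    show "\<exists>r>0. \<forall>g\<in>topspace tnorm_space. (SUP p\<in>unit_square. \<bar>f p - g p\<bar>) < r \<longrightarrow>
        g \<in> (\<lambda>f. f p) -` V \<inter> topspace tnorm_space"
    proof (intro exI[of _ r] conjI ballI impI)
      fix g assume g: "g \<in> topspace tnorm_space" "(SUP p\<in>unit_square. \<bar>f p - g p\<bar>) < r"
      then have "\<bar>f p - g p\<bar> < r" using tnorm_le_SUP[of f g p] f assms by simp
      then have "g p \<in> V" using r(2)[of "g p"] by (simp add: dist_real_def abs_minus_commute)
      then show "g \<in> (\<lambda>f. f p) -` V \<inter> topspace tnorm_space" using g by simp
    qed (use r in simp)
  qed simp
  then show "(\<lambda>f. f p) -` V \<inter> space (borel_of_topology tnorm_space) \<in> sets (borel_of_topology tnorm_space)"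
    unfolding sets_borel_of_topology space_borel_of_topology by (intro sigma_sets.Basic) simp
qed

lemma rat_enum_closure:
  assumes "rat_enum m < rat_enum n"
  shows "{rat_enum m..rat_enum n} \<subseteq> closure {rat_enum j | j. rat_enum m \<le> rat_enum j \<and> rat_enum j \<le> rat_enum n}"
    (is "_ \<subseteq> closure ?S")
proof -
  have "{rat_enum m<..<rat_enum n} \<subseteq> closure ?S"
  proof
    fix x assume x: "x \<in> {rat_enum m<..<rat_enum n}"
    show "x \<in> closure ?S"
      unfolding closure_approachable
    proof (intro allI impI)
      fix e :: real assume "0 < e"
      then have *: "0 \<le> x" "x < min (rat_enum n) (x + e)" "min (rat_enum n) (x + e) \<le> 1"
        using x rat_enum_bounds[of m] rat_enum_bounds[of n] by auto
      obtain j where "x < rat_enum j" "rat_enum j < min (rat_enum n) (x + e)"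
        by (rule rat_enum_dense[OF *])
      then show "\<exists>y\<in>?S. dist y x < e" using x by (intro bexI[of _ "rat_enum j"]) (auto simp: dist_real_def)
    qed
  qed
  then have "closure {rat_enum m<..<rat_enum n} \<subseteq> closure ?S" by (rule closure_minimal) simp
  then show ?thesis using assms by (subst (asm) closure_greaterThanLessThan) simp_all
qed

text \<open>A strict inequality at the rational points alone would not pass to their closure. On the
  compact interval the gap \<open>z - f (z, z)\<close> attains its minimum, so strictness comes with
  a margin \<open>1 / Suc k\<close>, and the weak inequality with this margin does pass to the
  closure.\<close>

lemma (in tnorm) uniform_on_rat_iff:
  "uniform_on f (rat_enum m) (rat_enum n) \<longleftrightarrow>
    (\<exists>k. \<forall>j. rat_enum m \<le> rat_enum j \<and> rat_enum j \<le> rat_enum n \<longrightarrow>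
       f (rat_enum j, rat_enum j) \<le> rat_enum j - 1 / Suc k) \<or>
    (\<forall>j. rat_enum m \<le> rat_enum j \<and> rat_enum j \<le> rat_enum n \<longrightarrow> f (rat_enum j, rat_enum j) = rat_enum j)"
    (is "_ \<longleftrightarrow> ?A \<or> ?B")
proof -
  define I where "I = {rat_enum m..rat_enum n}"
  define S where "S = {rat_enum j | j. rat_enum m \<le> rat_enum j \<and> rat_enum j \<le> rat_enum n}"
  have cl: "closure S = I"
  proof
    show "closure S \<subseteq> I" unfolding S_def I_def by (intro closure_minimal) auto
    show "I \<subseteq> closure S"
    proof (cases "rat_enum m < rat_enum n")
      case True then show ?thesis using rat_enum_closure unfolding S_def I_def by blast
    next
      case False
      have "I \<subseteq> S"
      proof
        fix x assume "x \<in> I"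
        then have "x = rat_enum m" using False unfolding I_def by auto
        then show "x \<in> S" using \<open>x \<in> I\<close> unfolding S_def I_def by auto
      qed
      then show ?thesis using closure_subset by blast
    qed
  qed
  have I01: "I \<subseteq> {0..1}" using rat_enum_bounds(1)[of m] rat_enum_bounds(2)[of n] unfolding I_def by auto
  have cont: "continuous_on (closure S) (\<lambda>z. z - f (z, z))"
    unfolding cl by (intro continuous_intros continuous_on_subset[OF cont_diag I01])
  have eq: "(\<forall>z\<in>I. f (z, z) = z) \<longleftrightarrow> ?B"
  proof
    assume ?B
    then have "z - f (z, z) = 0" if "z \<in> S" for z using that unfolding S_def by auto
    then have "z - f (z, z) = 0" if "z \<in> I" for z
      using continuous_constant_on_closure[OF cont, of 0 z] that unfolding cl by blast
    then show "\<forall>z\<in>I. f (z, z) = z" by fastforce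
  qed (auto simp: I_def)
  have "(\<forall>z\<in>I. f (z, z) < z) \<longleftrightarrow> ?A"
  proof
    assume less: "\<forall>z\<in>I. f (z, z) < z"
    show ?A
    proof (cases "I = {}")
      case True then show ?thesis unfolding I_def by fastforce
    next
      case False
      have "compact I" unfolding I_def by simp
      then obtain z0 where z0: "z0 \<in> I" "\<And>z. z \<in> I \<Longrightarrow> z0 - f (z0, z0) \<le> z - f (z, z)"
        using continuous_attains_inf[OF _ False cont[unfolded cl]] by blast
      have "0 < z0 - f (z0, z0)" using less z0(1) by simp
      then obtain k where "inverse (real (Suc k)) < z0 - f (z0, z0)" using reals_Archimedean by blast
      then have k: "1 / real (Suc k) \<le> z0 - f (z0, z0)" by (simp add: inverse_eq_divide)
      have "f (rat_enum j, rat_enum j) \<le> rat_enum j - 1 / Suc k"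
        if "rat_enum m \<le> rat_enum j \<and> rat_enum j \<le> rat_enum n" for j
        using z0(2)[of "rat_enum j"] k that unfolding I_def by simp
      then show ?A by blast
    qed
  next
    assume ?A
    then obtain k where k: "\<And>j. rat_enum m \<le> rat_enum j \<and> rat_enum j \<le> rat_enum n \<Longrightarrow>
       f (rat_enum j, rat_enum j) \<le> rat_enum j - 1 / Suc k" by blast
    then have S: "1 / Suc k \<le> z - f (z, z)" if "z \<in> S" for z using that unfolding S_def by force
    show "\<forall>z\<in>I. f (z, z) < z"
    proof
      fix z assume "z \<in> I"
      then have "1 / Suc k \<le> z - f (z, z)"
        unfolding cl[symmetric] by (rule continuous_ge_on_closure[OF cont _ S])
      moreover have "0 < 1 / real (Suc k)" by simp
      ultimately show "f (z, z) < z" by linarith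
    qed
  qed
  with eq show ?thesis unfolding uniform_on_def I_def by blast
qed

abbreviation tnorm_borel :: "(real \<times> real \<Rightarrow> real) measure" where
  "tnorm_borel \<equiv> borel_of_topology tnorm_space"

lemma measurable_diag [measurable]:
  "(\<lambda>f. f (rat_enum j, rat_enum j)) \<in> borel_measurable tnorm_borel"
  by (rule measurable_eval) (use rat_enum_bounds[of j] in auto)

lemma pred_uniform_on [measurable]:
  "Measurable.pred tnorm_borel (\<lambda>f. uniform_on f (rat_enum m) (rat_enum n))"
proof -
  have "Measurable.pred tnorm_borel (\<lambda>f. (\<exists>k. \<forall>j. rat_enum m \<le> rat_enum j \<and> rat_enum j \<le> rat_enum n \<longrightarrow>
       f (rat_enum j, rat_enum j) \<le> rat_enum j - 1 / Suc k) \<or>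
    (\<forall>j. rat_enum m \<le> rat_enum j \<and> rat_enum j \<le> rat_enum n \<longrightarrow> f (rat_enum j, rat_enum j) = rat_enum j))"
    by measurable
  then show ?thesis
  proof (rule measurable_cong[THEN iffD1, rotated])
    fix f assume "f \<in> space tnorm_borel"
    then interpret tnorm f by unfold_locales (simp add: in_tnorm_space)
    show "((\<exists>k. \<forall>j. rat_enum m \<le> rat_enum j \<and> rat_enum j \<le> rat_enum n \<longrightarrow>
       f (rat_enum j, rat_enum j) \<le> rat_enum j - 1 / Suc k) \<or>
    (\<forall>j. rat_enum m \<le> rat_enum j \<and> rat_enum j \<le> rat_enum n \<longrightarrow> f (rat_enum j, rat_enum j) = rat_enum j)) =
    uniform_on f (rat_enum m) (rat_enum n)"
      by (simp only: uniform_on_rat_iff)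
  qed
qed

lemma pred_conn [measurable]: "Measurable.pred tnorm_borel (\<lambda>f. conn f x y)"
  unfolding conn_def by measurable

lemma measurable_lab [measurable]:
  "(\<lambda>f. lab f (rat_enum n)) \<in> measurable tnorm_borel (count_space UNIV)"
  unfolding lab_def by measurable

lemma pred_reps [measurable]: "Measurable.pred tnorm_borel (\<lambda>f. n \<in> reps f)"
  unfolding reps_def mem_Collect_eq by measurable

lemma pred_code_set [measurable]: "Measurable.pred tnorm_borel (\<lambda>f. u \<in> code_set f)"
proof -
  \<comment> \<open>Naming the label \<open>k\<close> replaces a block that varies with
    \<open>f\<close> by a countable union over fixed blocks.\<close>
  have "u \<in> code_set f \<longleftrightarrow> fst (dec u) \<in> reps f \<and>
      (\<exists>k. lab f (rat_enum (fst (dec u))) = k \<and> snd (dec u) \<in> block k)" for f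
    unfolding code_set_def block_sum_def by (cases "dec u") auto
  then show ?thesis by simp
qed

text \<open>Reduces \<open>enumerate\<close> to membership and a count of finitely many members,
  both of which are Borel in \<open>f\<close> for \<open>code_set f\<close>.\<close>

lemma enumerate_eq_iff:
  fixes A :: "nat set"
  assumes "infinite A"
  shows "enumerate A i = u \<longleftrightarrow> u \<in> A \<and> card {w \<in> A. w < u} = i"
proof -
  have card: "card {w \<in> A. w < enumerate A i} = i" for i
  proof -
    have "{w \<in> A. w < enumerate A i} = enumerate A ` {..<i}"
    proof (intro equalityI subsetI)
      fix w assume w: "w \<in> {w \<in> A. w < enumerate A i}"
      then obtain j where "w = enumerate A j"
        using bij_betw_imp_surj_on[OF bij_enumerate[OF assms]] by (metis (no_types, lifting) imageE mem_Collect_eq)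
      then show "w \<in> enumerate A ` {..<i}" using w assms by auto
    qed (use assms enumerate_in_set in auto)
    then show ?thesis using inj_enumerate[OF assms] by (simp add: card_image inj_on_subset[OF _ subset_UNIV])
  qed
  show ?thesis
  proof
    assume "u \<in> A \<and> card {w \<in> A. w < u} = i"
    moreover obtain j where "u = enumerate A j"
      using calculation bij_betw_imp_surj_on[OF bij_enumerate[OF assms]] by (metis imageE)
    ultimately show "enumerate A i = u" using card[of j] by simp
  qed (use card enumerate_in_set[OF assms] in auto)
qed

lemma measurable_card_code_set [measurable]:
  "(\<lambda>f. card {w \<in> code_set f. w < u}) \<in> measurable tnorm_borel (count_space UNIV)"
proof (induction u)
  case (Suc u)
  have "card {w \<in> code_set f. w < Suc u} = card {w \<in> code_set f. w < u} + (if u \<in> code_set f then 1 else 0)" for f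
  proof (cases "u \<in> code_set f")
    case True
    then have "{w \<in> code_set f. w < Suc u} = insert u {w \<in> code_set f. w < u}" by auto
    then show ?thesis using True by simp
  next
    case False
    then have "{w \<in> code_set f. w < Suc u} = {w \<in> code_set f. w < u}" by (auto simp: less_Suc_eq)
    then show ?thesis using False by simp
  qed
  moreover note Suc[measurable]
  have "(\<lambda>f. card {w \<in> code_set f. w < u} + (if u \<in> code_set f then 1 else 0)) \<in> measurable tnorm_borel (count_space UNIV)"
    by measurable
  ultimately show ?case by simp
qed simp

lemma pred_order_of: "Measurable.pred tnorm_borel (\<lambda>f. order_of f p)"
proof -
  have "Measurable.pred tnorm_borel (\<lambda>f. \<exists>u v. lex_less (dec u) (dec v) \<and>
      (u \<in> code_set f \<and> card {w \<in> code_set f. w < u} = fst p) \<and>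
      (v \<in> code_set f \<and> card {w \<in> code_set f. w < v} = snd p))"
    by measurable
  then show ?thesis
  proof (rule measurable_cong[THEN iffD1, rotated])
    fix f assume "f \<in> space tnorm_borel"
    then have inf: "infinite (code_set f)" by (simp add: in_tnorm_space infinite_code_set)
    show "(\<exists>u v. lex_less (dec u) (dec v) \<and>
      (u \<in> code_set f \<and> card {w \<in> code_set f. w < u} = fst p) \<and>
      (v \<in> code_set f \<and> card {w \<in> code_set f. w < v} = snd p)) = order_of f p"
      unfolding enumerate_eq_iff[OF inf, symmetric] order_of_def by simp
  qed
qed

text \<open>Passing through \<^typ>\<open>nat\<close> makes the product type second countable, which the library does not
  know for \<^typ>\<open>bool\<close>.\<close>

lemma measurable_LO_space:
  assumes "\<And>x. x \<in> space M \<Longrightarrow> F x \<in> LO" "\<And>p. Measurable.pred M (\<lambda>x. F x p)"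
  shows "F \<in> measurable M (borel_of_topology LO_space)"
  unfolding borel_of_topology_def
proof (rule measurable_measure_of)
  show "{U. openin LO_space U} \<subseteq> Pow (topspace LO_space)" by (auto dest: openin_subset)
  show "F \<in> space M \<rightarrow> topspace LO_space" using assms(1) by (simp add: topspace_LO_space)
  fix U assume "U \<in> {U. openin LO_space U}"
  then obtain V where V: "openin (product_topology (\<lambda>_. discrete_topology UNIV) UNIV) V" "U = V \<inter> LO"
    unfolding LO_space_def openin_subtopology by blast
  have "discrete_topology (UNIV :: bool set) = euclidean"
    by (simp add: discrete_topology_unique open_discrete flip: open_openin)
  then have "openin euclidean V"
    using V(1) by (simp only: euclidean_product_topology)
  then have "open V" by (simp only: open_openin)
  have cont: "continuous_on UNIV (\<lambda>(G :: nat \<times> nat \<Rightarrow> nat) p. G p = 1)"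
  proof (rule continuous_on_coordinatewise_then_product)
    fix p :: "nat \<times> nat"
    have "continuous_on UNIV (\<lambda>n :: nat. n = 1)"
      unfolding continuous_on_open_invariant by (simp add: open_discrete)
    then show "continuous_on UNIV (\<lambda>G :: nat \<times> nat \<Rightarrow> nat. G p = 1)"
      by (rule continuous_on_compose2[OF _ continuous_on_product_coordinates]) simp
  qed
  have "(\<lambda>x. of_bool (F x p) :: nat) \<in> borel_measurable M" for p
  proof -
    have "(\<lambda>x. of_bool (F x p) :: nat) \<in> measurable M (count_space UNIV)"
      using measurable_compose[OF assms(2)[of p], of of_bool "count_space (UNIV :: nat set)"] by simp
    then show ?thesis by (simp add: measurable_def sets_borel_eq_count_space)
  qed
  then have "(\<lambda>x p. of_bool (F x p) :: nat) \<in> borel_measurable M"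
    by (rule measurable_coordinatewise_then_product)
  then have "(\<lambda>x p. of_bool (F x p) :: nat) -` ((\<lambda>G p. G p = 1) -` V) \<inter> space M \<in> sets M"
    by (rule measurable_sets) (rule borel_open[OF open_vimage[OF \<open>open V\<close> cont]])
  moreover have "(\<lambda>x p. of_bool (F x p) :: nat) -` ((\<lambda>G p. G p = 1) -` V) = F -` V"
    by (simp add: vimage_def)
  ultimately have "F -` V \<inter> space M \<in> sets M" by simp
  moreover have "F -` U \<inter> space M = F -` V \<inter> space M" unfolding V(2) using assms(1) by blast
  ultimately show "F -` U \<inter> space M \<in> sets M" by simp
qed

lemma tnorm_reducible_to_LO: "Borel_reducible tnorm_space tnorm_isomorphic LO_space LO_isomorphic"
  unfolding Borel_reducible_def
proof (intro exI conjI ballI)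
  show "order_of \<in> measurable tnorm_borel (borel_of_topology LO_space)"
    by (rule measurable_LO_space) (simp_all add: order_of_in_LO in_tnorm_space pred_order_of)
  show "tnorm_isomorphic f g \<longleftrightarrow> LO_isomorphic (order_of f) (order_of g)"
    if "f \<in> topspace tnorm_space" "g \<in> topspace tnorm_space" for f g
    by (rule LO_isomorphic_order_of_iff[symmetric]) (use that in_tnorm_space in blast)+
qed

section \<open>Ordinal sums along a linear order\<close>

definition wt :: "nat \<Rightarrow> real" where
  "wt n = (1 / 2) ^ Suc n"

lemma wt_pos [simp]: "0 < wt n" and wt_nonneg [simp]: "0 \<le> wt n"
  by (simp_all add: wt_def)

lemma wt_nonzero [simp]: "wt n \<noteq> 0"
  by (simp add: wt_def)

lemma wt_sums: "wt sums 1"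
  unfolding wt_def by (rule power_half_series)

lemma wt_shift_sums: "(\<lambda>n. wt (n + N)) sums (1 / 2) ^ N"
proof -
  have "(\<lambda>n. (1 / 2) ^ N * wt n) sums ((1 / 2) ^ N * 1)" by (intro sums_mult wt_sums)
  then show ?thesis by (simp add: wt_def power_add mult_ac)
qed

lemma summable_wt_bound:
  fixes s :: "nat \<Rightarrow> real"
  assumes "\<And>n. \<bar>s n\<bar> \<le> wt n"
  shows "summable s"
  by (rule summable_comparison_test'[OF sums_summable[OF wt_sums]]) (use assms in simp)

text \<open>Splits the series at \<open>N\<close>; the tail is dominated by that of
  \<open>wt\<close>, which is \<open>(1 / 2) ^ N\<close>. It serves the left end points with
  \<open>d = 0\<close> and the ordinal sums with \<open>d = 2 * (1 / 2) ^ N\<close>.\<close>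

lemma suminf_wt_bound:
  fixes s :: "nat \<Rightarrow> real"
  assumes "\<And>n. \<bar>s n\<bar> \<le> wt n" "\<And>n. n < N \<Longrightarrow> \<bar>s n\<bar> \<le> d"
  shows "\<bar>suminf s\<bar> \<le> real N * d + (1 / 2) ^ N"
proof -
  have "suminf s = (\<Sum>n. s (n + N)) + (\<Sum>i<N. s i)"
    by (rule suminf_split_initial_segment[OF summable_wt_bound[OF assms(1)]])
  moreover have "\<bar>\<Sum>n. s (n + N)\<bar> \<le> (\<Sum>n. wt (n + N))"
    using norm_suminf_le[of "\<lambda>n. s (n + N)", OF _ sums_summable[OF wt_shift_sums]] assms(1) by simp
  moreover have "(\<Sum>n. wt (n + N)) = (1 / 2) ^ N" by (rule sums_unique[OF wt_shift_sums, symmetric])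
  moreover have "\<bar>\<Sum>i<N. s i\<bar> \<le> (\<Sum>i<N. d)"
    by (rule order_trans[OF sum_abs sum_mono]) (use assms(2) in simp)
  ultimately show ?thesis by simp
qed

section \<open>Coordinates of a point along the intervals\<close>

definition lo :: "(nat \<times> nat \<Rightarrow> bool) \<Rightarrow> nat \<Rightarrow> real" where
  "lo r n = (\<Sum>m. if r (m, n) then wt m else 0)"

text \<open>The length of the part of interval \<open>n\<close> to the left of \<open>x\<close>; in
  these coordinates the ordinal sum acts separately on each interval.\<close>

definition coord :: "(nat \<times> nat \<Rightarrow> bool) \<Rightarrow> nat \<Rightarrow> real \<Rightarrow> real" where
  "coord r n x = max 0 (min (wt n) (x - lo r n))"

definition luk :: "nat \<Rightarrow> real \<Rightarrow> real \<Rightarrow> real" where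
  "luk n s t = max 0 (s + t - wt n)"

text \<open>Since the coordinates of \<^term>\<open>x\<close> sum up to \<^term>\<open>x\<close>, this is the ordinal sum of
  Lukasiewicz t-norms on the intervals \<^term>\<open>{lo r n..lo r n + wt n}\<close>.\<close>

definition ordsum :: "(nat \<times> nat \<Rightarrow> bool) \<Rightarrow> real \<Rightarrow> real \<Rightarrow> real" where
  "ordsum r x y = (\<Sum>n. luk n (coord r n x) (coord r n y))"

definition ordsum_tnorm :: "(nat \<times> nat \<Rightarrow> bool) \<Rightarrow> real \<times> real \<Rightarrow> real" where
  "ordsum_tnorm r = restrict (\<lambda>p. ordsum r (fst p) (snd p)) unit_square"

lemma ordsum_tnorm_eq: "x \<in> {0..1} \<Longrightarrow> y \<in> {0..1} \<Longrightarrow> ordsum_tnorm r (x, y) = ordsum r x y"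
  by (simp add: ordsum_tnorm_def)

text \<open>Characterises the coordinate sequences of points: once an interval has been entered, all
  earlier ones are full (\<open>filled_coord\<close>, \<open>coord_suminf\<close>).\<close>

definition filled :: "(nat \<times> nat \<Rightarrow> bool) \<Rightarrow> (nat \<Rightarrow> real) \<Rightarrow> bool" where
  "filled r s \<longleftrightarrow> (\<forall>n. 0 \<le> s n \<and> s n \<le> wt n) \<and> (\<forall>m n. r (m, n) \<and> 0 < s n \<longrightarrow> s m = wt m)"

lemma coord_bounds [simp]: "0 \<le> coord r n x" "coord r n x \<le> wt n"
  by (simp_all add: coord_def)

lemma luk_bounds: "a \<le> wt n \<Longrightarrow> b \<le> wt n \<Longrightarrow> 0 \<le> luk n a b \<and> luk n a b \<le> wt n"
  by (simp add: luk_def)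

lemma filled_summable: "filled r s \<Longrightarrow> summable s"
  by (rule summable_wt_bound) (simp add: filled_def)

lemma filled_suminf_bounds:
  assumes "filled r s"
  shows "suminf s \<in> {0..1}"
proof -
  have "0 \<le> suminf s" using assms by (intro suminf_nonneg filled_summable[OF assms]) (simp add: filled_def)
  moreover have "suminf s \<le> suminf wt"
    using assms by (intro suminf_le filled_summable[OF assms] sums_summable[OF wt_sums]) (simp add: filled_def)
  ultimately show ?thesis using sums_unique[OF wt_sums] by simp
qed

locale lin_order =
  fixes r :: "nat \<times> nat \<Rightarrow> bool"
  assumes r: "r \<in> LO"
begin

lemma irrefl: "\<not> r (n, n)"
  and trans: "r (k, m) \<Longrightarrow> r (m, n) \<Longrightarrow> r (k, n)"
  and total: "m \<noteq> n \<Longrightarrow> r (m, n) \<or> r (n, m)"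
  using r unfolding LO_def by (auto dest: irreflpD transpD totalpD)

lemma asym: "r (m, n) \<Longrightarrow> \<not> r (n, m)"
  using irrefl trans by blast

lemma on_order: "transp_on A (\<lambda>m n. r (m, n))" "totalp_on A (\<lambda>m n. r (m, n))"
proof -
  show "transp_on A (\<lambda>m n. r (m, n))" by (rule transp_onI) (rule trans)
  show "totalp_on A (\<lambda>m n. r (m, n))" by (rule totalp_onI) (rule total)
qed

lemma lo_summable: "summable (\<lambda>m. if r (m, n) then wt m else 0)"
  by (rule summable_wt_bound) simp

lemma single_sums: "(\<lambda>m. if m = n then c else 0) sums (c :: real)"
  using sums_single[of n "\<lambda>_. c"] by simp

lemma lo_add_sums: "(\<lambda>m. (if r (m, n) then wt m else 0) + (if m = n then c else 0)) sums (lo r n + c)"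
  unfolding lo_def by (intro sums_add summable_sums lo_summable single_sums)

lemma lo_nonneg: "0 \<le> lo r n"
  unfolding lo_def by (intro suminf_nonneg lo_summable) simp

lemma lo_le: "r (m, n) \<Longrightarrow> lo r m + wt m \<le> lo r n"
  by (rule sums_le[OF _ lo_add_sums summable_sums[OF lo_summable, folded lo_def]])
    (auto dest: trans simp: irrefl)

lemma lo_le_one: "lo r n + wt n \<le> 1"
  by (rule sums_le[OF _ lo_add_sums wt_sums]) (simp add: irrefl)

text \<open>A positive \<open>s n\<close> makes all predecessors of \<open>n\<close> full, so the
  sum is at least \<open>lo r n + s n\<close>. A value \<open>s n\<close> below \<open>wt n\<close>
  leaves nothing after \<open>n\<close>, which gives the opposite estimate.\<close>

lemma coord_suminf:
  assumes s: "filled r s"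
  shows "coord r n (suminf s) = s n"
proof -
  have b: "0 \<le> s k" "s k \<le> wt k" for k using s by (simp_all add: filled_def)
  have f: "s j = wt j" if "r (j, k)" "s k \<noteq> 0" for j k
  proof -
    have "0 < s k" using that(2) b[of k] by simp
    then show ?thesis using s that(1) unfolding filled_def by blast
  qed
  note sm = summable_sums[OF filled_summable[OF s]]
  show ?thesis
  proof (cases "s n = 0")
    case True
    have "suminf s \<le> lo r n"
    proof (rule sums_le[OF _ sm summable_sums[OF lo_summable, folded lo_def]])
      fix k
      show "s k \<le> (if r (k, n) then wt k else 0)"
      proof (cases "r (k, n)")
        case False
        have "s k = 0"
        proof (rule ccontr)
          assume "s k \<noteq> 0"
          then have "r (n, k)" using False total[of k n] True by metis
          then show False using f[of n k] \<open>s k \<noteq> 0\<close> True wt_pos[of n] by simp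
        qed
        then show ?thesis by simp
      qed (use b in simp)
    qed
    then show ?thesis using True by (simp add: coord_def)
  next
    case False
    have le: "lo r n + s n \<le> suminf s"
      by (rule sums_le[OF _ lo_add_sums sm]) (use f False b irrefl in auto)
    show ?thesis
    proof (cases "s n = wt n")
      case True then show ?thesis using le by (simp add: coord_def)
    next
      case neq: False
      have "suminf s \<le> lo r n + s n"
      proof (rule sums_le[OF _ sm lo_add_sums])
        fix k
        show "s k \<le> (if r (k, n) then wt k else 0) + (if k = n then s n else 0)"
        proof (cases "k = n \<or> s k = 0")
          case True then show ?thesis using b[of n] by (auto simp: irrefl)
        next
          case False
          then have "r (k, n)" using f[of n k] neq total[of k n] by blast
          then show ?thesis using b[of k] False by simp
        qed
      qed
      then have "suminf s = lo r n + s n" using le by simp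
      then show ?thesis using b[of n] by (simp add: coord_def)
    qed
  qed
qed

lemma filled_coord: "filled r (\<lambda>n. coord r n x)"
proof -
  have "coord r m x = wt m" if "r (m, n)" "0 < coord r n x" for m n
  proof -
    have "lo r n < x" using that(2) by (simp add: coord_def less_max_iff_disj)
    then show ?thesis using lo_le[OF that(1)] by (simp add: coord_def)
  qed
  then show ?thesis unfolding filled_def using coord_bounds by blast
qed

text \<open>Among the finitely many intervals entered by \<open>x\<close>, let \<open>m\<close> be
  the last in the order: the others precede it and together have length at most
  \<open>lo r m\<close>.\<close>

lemma sum_coord_le:
  assumes "0 \<le> x" "finite K"
  shows "(\<Sum>n\<in>K. coord r n x) \<le> x"
proof -
  define K' where "K' = {n \<in> K. 0 < coord r n x}"
  have K': "finite K'" "K' \<subseteq> K" using assms by (auto simp: K'_def)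
  have "(\<Sum>n\<in>K. coord r n x) = (\<Sum>n\<in>K'. coord r n x)"
    by (rule sum.mono_neutral_right[OF assms(2) K'(2)]) (auto simp: K'_def not_less intro: antisym)
  also have "\<dots> \<le> x"
  proof (cases "K' = {}")
    case False
    obtain m where m: "m \<in> K'" "\<And>k. k \<in> K' \<Longrightarrow> k \<noteq> m \<Longrightarrow> r (k, m)"
      using Finite_Set.bex_greatest_element[OF K'(1) False on_order] by blast
    have "(\<Sum>n\<in>K'. coord r n x) = coord r m x + (\<Sum>n\<in>K' - {m}. coord r n x)"
      using K' m by (simp add: sum.remove)
    also have "(\<Sum>n\<in>K' - {m}. coord r n x) \<le> (\<Sum>n\<in>K' - {m}. if r (n, m) then wt n else 0)"
      by (rule sum_mono) (use m in auto)
    also have "\<dots> \<le> lo r m"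
      unfolding lo_def by (rule sum_le_suminf[OF lo_summable]) (use K' in auto)
    also have "coord r m x + lo r m \<le> x"
      using m(1) unfolding K'_def coord_def by auto
    finally show ?thesis by simp
  qed (use assms in simp)
  finally show ?thesis .
qed

text \<open>The dual estimate for the lengths to the right of \<open>x\<close>: the first unfinished
  interval \<open>m\<close> precedes the others, which fit into \<open>1 - (lo r m + wt m)\<close>
  because the total length is 1.\<close>

lemma sum_cocoord_le:
  assumes "x \<le> 1" "finite K"
  shows "(\<Sum>n\<in>K. wt n - coord r n x) \<le> 1 - x"
proof -
  define K' where "K' = {n \<in> K. 0 < wt n - coord r n x}"
  have K': "finite K'" "K' \<subseteq> K" using assms by (auto simp: K'_def)
  have "(\<Sum>n\<in>K. wt n - coord r n x) = (\<Sum>n\<in>K'. wt n - coord r n x)"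
    by (rule sum.mono_neutral_right[OF assms(2) K'(2)]) (auto simp: K'_def not_less intro: antisym)
  also have "\<dots> \<le> 1 - x"
  proof (cases "K' = {}")
    case False
    obtain m where m: "m \<in> K'" "\<And>k. k \<in> K' \<Longrightarrow> k \<noteq> m \<Longrightarrow> r (m, k)"
      using Finite_Set.bex_least_element[OF K'(1) False on_order] by blast
    have S: "(\<lambda>n. wt n - ((if r (n, m) then wt n else 0) + (if n = m then wt m else 0))) sums (1 - (lo r m + wt m))"
      by (intro sums_diff wt_sums lo_add_sums)
    have "(\<Sum>n\<in>K'. wt n - coord r n x) = (wt m - coord r m x) + (\<Sum>n\<in>K' - {m}. wt n - coord r n x)"
      using K' m by (simp add: sum.remove)
    also have "(\<Sum>n\<in>K' - {m}. wt n - coord r n x) \<le>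
        (\<Sum>n\<in>K' - {m}. wt n - ((if r (n, m) then wt n else 0) + (if n = m then wt m else 0)))"
      by (rule sum_mono) (use m asym in auto)
    also have "\<dots> \<le> 1 - (lo r m + wt m)"
      unfolding sums_unique[OF S] by (rule sum_le_suminf[OF sums_summable[OF S]]) (use K' irrefl in auto)
    also have "wt m - coord r m x + (1 - (lo r m + wt m)) \<le> 1 - x"
      using m(1) unfolding K'_def coord_def by auto
    finally show ?thesis by simp
  qed (use assms in simp)
  finally show ?thesis .
qed

text \<open>A point may lie in no interval and be only a limit of them. The finite estimates from
  both sides avoid locating it.\<close>

lemma suminf_coord:
  assumes "x \<in> {0..1}"
  shows "(\<Sum>n. coord r n x) = x"
proof (rule antisym)
  note sm = filled_summable[OF filled_coord]
  show "(\<Sum>n. coord r n x) \<le> x"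
    by (rule suminf_le_const[OF sm]) (use assms in \<open>simp add: sum_coord_le\<close>)
  have S: "(\<lambda>n. wt n - coord r n x) sums (1 - (\<Sum>n. coord r n x))"
    by (intro sums_diff wt_sums summable_sums sm)
  have "1 - (\<Sum>n. coord r n x) \<le> 1 - x"
    unfolding sums_unique[OF S]
    by (rule suminf_le_const[OF sums_summable[OF S]]) (use assms in \<open>simp add: sum_cocoord_le\<close>)
  then show "x \<le> (\<Sum>n. coord r n x)" by simp
qed

text \<open>A positive Lukasiewicz product needs both coordinates positive, so both points have
  filled all earlier intervals, where the product is then full as well.\<close>

lemma filled_luk: "filled r (\<lambda>n. luk n (coord r n x) (coord r n y))"
proof -
  have "luk m (coord r m x) (coord r m y) = wt m"
    if "r (m, n)" "0 < luk n (coord r n x) (coord r n y)" for m n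
  proof -
    have "0 < coord r n x + coord r n y - wt n" using that(2) by (simp add: luk_def less_max_iff_disj)
    then have "0 < coord r n x" "0 < coord r n y"
      using coord_bounds(2)[of r n x] coord_bounds(2)[of r n y] by linarith+
    then have "coord r m x = wt m" "coord r m y = wt m"
      using filled_coord that(1) unfolding filled_def by blast+
    then show ?thesis by (simp add: luk_def)
  qed
  then show ?thesis
    unfolding filled_def using luk_bounds[OF coord_bounds(2) coord_bounds(2)] by blast
qed

lemma coord_ordsum: "coord r n (ordsum r x y) = luk n (coord r n x) (coord r n y)"
  unfolding ordsum_def by (rule coord_suminf[OF filled_luk])

lemma coord_one: "coord r n 1 = wt n"
  using lo_le_one[of n] by (simp add: coord_def)

lemma ordsum_bounds: "ordsum r x y \<in> {0..1}"
  unfolding ordsum_def by (rule filled_suminf_bounds[OF filled_luk])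

lemma continuous_ordsum: "continuous_on UNIV (\<lambda>p. ordsum r (fst p) (snd p))"
proof -
  have "uniform_limit UNIV (\<lambda>N p. \<Sum>n<N. luk n (coord r n (fst p)) (coord r n (snd p)))
      (\<lambda>p. ordsum r (fst p) (snd p)) sequentially"
    unfolding ordsum_def
    by (rule Weierstrass_m_test[OF _ sums_summable[OF wt_sums]]) (simp add: luk_bounds)
  moreover have "continuous_on UNIV (\<lambda>p. \<Sum>n<N. luk n (coord r n (fst p)) (coord r n (snd p)))" for N
    unfolding luk_def coord_def by (intro continuous_intros)
  ultimately show ?thesis
    by (intro uniform_limit_theorem[where F = sequentially]) simp_all
qed

lemma continuous_tnorm_ordsum: "continuous_tnorm (ordsum_tnorm r)"
  unfolding continuous_tnorm_def
proof (intro conjI ballI impI)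
  show "ordsum_tnorm r \<in> unit_square \<rightarrow> {0..1}"
    using ordsum_bounds by (auto simp: ordsum_tnorm_def)
  show "continuous_on unit_square (ordsum_tnorm r)"
    by (rule continuous_on_eq[OF continuous_on_subset[OF continuous_ordsum subset_UNIV]])
      (simp add: ordsum_tnorm_def)
next
  fix x y z :: real assume x: "x \<in> {0..1}" and y: "y \<in> {0..1}" and z: "z \<in> {0..1}"
  have "luk n (luk n (coord r n x) (coord r n y)) (coord r n z) =
      luk n (coord r n x) (luk n (coord r n y) (coord r n z))" for n
    using coord_bounds(2)[of r n x] coord_bounds(2)[of r n z] unfolding luk_def by linarith
  then have "ordsum r (ordsum r x y) z = ordsum r x (ordsum r y z)"
    unfolding ordsum_def[of r "ordsum r x y" z] ordsum_def[of r x "ordsum r y z"] coord_ordsum by simp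
  then show "ordsum_tnorm r (ordsum_tnorm r (x, y), z) = ordsum_tnorm r (x, ordsum_tnorm r (y, z))"
    using x y z ordsum_bounds by (simp only: ordsum_tnorm_eq)
next
  fix x y :: real assume "x \<in> {0..1}" "y \<in> {0..1}"
  then show "ordsum_tnorm r (x, y) = ordsum_tnorm r (y, x)"
    by (simp only: ordsum_tnorm_eq) (simp add: ordsum_def luk_def add.commute)
next
  fix x :: real assume x: "x \<in> {0..1}"
  have "ordsum r 1 x = (\<Sum>n. coord r n x)"
    unfolding ordsum_def coord_one luk_def by simp
  then have "ordsum r 1 x = x" using suminf_coord[OF x] by simp
  then show "ordsum_tnorm r (1, x) = x" using ordsum_tnorm_eq[of 1 x] x by simp
next
  fix p p' q q' :: real
  assume *: "p \<in> {0..1}" "p' \<in> {0..1}" "q \<in> {0..1}" "q' \<in> {0..1}" "p \<le> p' \<and> q \<le> q'"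
  have "ordsum r p q \<le> ordsum r p' q'"
    unfolding ordsum_def
  proof (rule suminf_le[OF _ filled_summable[OF filled_luk] filled_summable[OF filled_luk]])
    fix n
    have "coord r n p \<le> coord r n p'" "coord r n q \<le> coord r n q'"
      using * unfolding coord_def by auto
    then show "luk n (coord r n p) (coord r n q) \<le> luk n (coord r n p') (coord r n q')"
      unfolding luk_def by linarith
  qed
  then show "ordsum_tnorm r (p, q) \<le> ordsum_tnorm r (p', q')" using * by (simp only: ordsum_tnorm_eq)
qed

end

lemma ordsum_tnorm_in_space: "r \<in> LO \<Longrightarrow> ordsum_tnorm r \<in> topspace tnorm_space"
  using lin_order.continuous_tnorm_ordsum[OF lin_order.intro]
  by (auto simp: topspace_tnorm_space ordsum_tnorm_def)

section \<open>Continuous dependence of the ordinal sum on the order\<close>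

lemma lo_cong_dist:
  assumes "\<And>m. m < N \<Longrightarrow> r (m, n) = r' (m, n)"
  shows "\<bar>lo r n - lo r' n\<bar> \<le> (1 / 2) ^ N"
proof -
  define s where "s m = (if r (m, n) then wt m else 0) - (if r' (m, n) then wt m else 0)" for m
  have "summable (\<lambda>m. if r (m, n) then wt m else 0)" "summable (\<lambda>m. if r' (m, n) then wt m else 0)"
    by (rule summable_wt_bound, simp)+
  then have "lo r n - lo r' n = suminf s"
    unfolding lo_def s_def by (rule suminf_diff)
  also have "\<bar>\<dots>\<bar> \<le> real N * 0 + (1 / 2) ^ N"
    by (rule suminf_wt_bound) (use assms in \<open>auto simp: s_def\<close>)
  finally show ?thesis by simp
qed

text \<open>In each of the first \<open>N\<close> coordinates either argument moves by at most the
  shift of \<open>lo\<close>, that is \<open>(1 / 2) ^ N\<close>; the remaining coordinates together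
  contribute at most another \<open>(1 / 2) ^ N\<close>.\<close>

lemma ordsum_cong_dist:
  assumes "r \<in> LO" "r' \<in> LO" and eq: "\<And>m n. m < N \<Longrightarrow> n < N \<Longrightarrow> r (m, n) = r' (m, n)"
  shows "\<bar>ordsum r x y - ordsum r' x y\<bar> \<le> (2 * real N + 1) * (1 / 2) ^ N"
proof -
  interpret A: lin_order r by standard fact
  interpret B: lin_order r' by standard fact
  define s where "s n = luk n (coord r n x) (coord r n y) - luk n (coord r' n x) (coord r' n y)" for n
  have "ordsum r x y - ordsum r' x y = suminf s"
    unfolding ordsum_def s_def by (rule suminf_diff[OF filled_summable[OF A.filled_luk] filled_summable[OF B.filled_luk]])
  also have "\<bar>\<dots>\<bar> \<le> real N * (2 * (1 / 2) ^ N) + (1 / 2) ^ N"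
  proof (rule suminf_wt_bound)
    fix n
    have "0 \<le> luk n (coord r n x) (coord r n y)" "luk n (coord r n x) (coord r n y) \<le> wt n"
      "0 \<le> luk n (coord r' n x) (coord r' n y)" "luk n (coord r' n x) (coord r' n y) \<le> wt n"
      using luk_bounds[OF coord_bounds(2) coord_bounds(2)] by blast+
    then show "\<bar>s n\<bar> \<le> wt n" unfolding s_def by linarith
  next
    fix n assume "n < N"
    then have d: "\<bar>lo r n - lo r' n\<bar> \<le> (1 / 2) ^ N" by (intro lo_cong_dist eq)
    have c: "\<bar>coord r n z - coord r' n z\<bar> \<le> \<bar>lo r n - lo r' n\<bar>" for z
      unfolding coord_def by linarith
    have "\<bar>s n\<bar> \<le> \<bar>coord r n x - coord r' n x\<bar> + \<bar>coord r n y - coord r' n y\<bar>"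
      unfolding s_def luk_def by linarith
    then show "\<bar>s n\<bar> \<le> 2 * (1 / 2) ^ N" using c[of x] c[of y] d by linarith
  qed
  finally show ?thesis by (simp add: algebra_simps)
qed

lemma openin_cylinder:
  "openin LO_space {s \<in> LO. \<forall>m<N. \<forall>n<N. s (m, n) = r (m, n)}"
proof -
  define C where "C p = (if p \<in> {..<N} \<times> {..<N} then {r p} else UNIV)" for p
  have "openin (product_topology (\<lambda>_. discrete_topology UNIV) UNIV) (Pi\<^sub>E UNIV C)"
  proof -
    have "finite {p \<in> UNIV. C p \<noteq> topspace (discrete_topology UNIV)}"
      by (rule finite_subset[of _ "{..<N} \<times> {..<N}"]) (auto simp: C_def split: if_splits)
    then show ?thesis unfolding openin_PiE_gen by simp
  qed
  then have "openin LO_space (Pi\<^sub>E UNIV C \<inter> LO)"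
    unfolding LO_space_def openin_subtopology by blast
  moreover have "Pi\<^sub>E UNIV C \<inter> LO = {s \<in> LO. \<forall>m<N. \<forall>n<N. s (m, n) = r (m, n)}"
    unfolding C_def by (auto simp: PiE_iff split: if_splits)
  ultimately show ?thesis by simp
qed

lemma measurable_ordsum_tnorm:
  "ordsum_tnorm \<in> measurable (borel_of_topology LO_space) tnorm_borel"
  unfolding borel_of_topology_def[of tnorm_space]
proof (rule measurable_measure_of)
  show "{U. openin tnorm_space U} \<subseteq> Pow (topspace tnorm_space)" by (auto dest: openin_subset)
  show "ordsum_tnorm \<in> space (borel_of_topology LO_space) \<rightarrow> topspace tnorm_space"
    by (simp add: topspace_LO_space ordsum_tnorm_in_space)
  fix U assume "U \<in> {U. openin tnorm_space U}"
  then have U: "openin tnorm_space U" by simp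
  have "openin LO_space (ordsum_tnorm -` U \<inter> LO)"
    unfolding openin_subopen[of LO_space "ordsum_tnorm -` U \<inter> LO"]
  proof
    fix r assume r: "r \<in> ordsum_tnorm -` U \<inter> LO"
    then obtain e where e: "e > 0" "\<And>g. g \<in> topspace tnorm_space \<Longrightarrow>
        (SUP p\<in>unit_square. \<bar>ordsum_tnorm r p - g p\<bar>) < e \<Longrightarrow> g \<in> U"
      using U unfolding openin_tnorm_space by blast
    have "(\<lambda>N. (2 * real N + 1) * (1 / 2) ^ N) \<longlonglongrightarrow> 0" by real_asymp
    then have "eventually (\<lambda>N. (2 * real N + 1) * (1 / 2) ^ N < e) sequentially"
      using order_tendstoD(2) e(1) by blast
    then obtain N where N: "(2 * real N + 1) * (1 / 2) ^ N < e"
      using eventually_happens'[OF sequentially_bot] by blast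
    define T where "T = {s \<in> LO. \<forall>m<N. \<forall>n<N. s (m, n) = r (m, n)}"
    have "s \<in> ordsum_tnorm -` U" if s: "s \<in> T" for s
    proof -
      have "(SUP p\<in>unit_square. \<bar>ordsum_tnorm r p - ordsum_tnorm s p\<bar>) \<le> (2 * real N + 1) * (1 / 2) ^ N"
      proof (rule cSUP_least)
        fix p assume p: "p \<in> unit_square"
        have "\<bar>ordsum r (fst p) (snd p) - ordsum s (fst p) (snd p)\<bar> \<le> (2 * real N + 1) * (1 / 2) ^ N"
          by (rule ordsum_cong_dist) (use r s in \<open>auto simp: T_def\<close>)
        then show "\<bar>ordsum_tnorm r p - ordsum_tnorm s p\<bar> \<le> (2 * real N + 1) * (1 / 2) ^ N"
          using p by (simp only: ordsum_tnorm_def restrict_apply if_True)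
      qed auto
      then have "ordsum_tnorm s \<in> U"
        using N s by (intro e(2) ordsum_tnorm_in_space) (auto simp: T_def)
      then show ?thesis by simp
    qed
    moreover have "openin LO_space T" unfolding T_def by (rule openin_cylinder)
    ultimately show "\<exists>T. openin LO_space T \<and> r \<in> T \<and> T \<subseteq> ordsum_tnorm -` U \<inter> LO"
      using r by (intro exI[of _ T]) (auto simp: T_def)
  qed
  then show "ordsum_tnorm -` U \<inter> space (borel_of_topology LO_space) \<in> sets (borel_of_topology LO_space)"
    unfolding sets_borel_of_topology space_borel_of_topology topspace_LO_space
    by (intro sigma_sets.Basic) simp
qed

text \<open>Moves the interval of index \<^term>\<open>\<rho> m\<close> affinely onto the interval of index \<^term>\<open>m\<close>.\<close>

definition reindex :: "(nat \<times> nat \<Rightarrow> bool) \<Rightarrow> (nat \<Rightarrow> nat) \<Rightarrow> real \<Rightarrow> real" where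
  "reindex r \<rho> x = (\<Sum>m. wt m / wt (\<rho> m) * coord r (\<rho> m) x)"

lemma
  assumes r: "r \<in> LO" and r': "r' \<in> LO" and \<rho>: "\<And>m n. r' (m, n) \<longleftrightarrow> r (\<rho> m, \<rho> n)"
  shows filled_reindex: "filled r' (\<lambda>m. wt m / wt (\<rho> m) * coord r (\<rho> m) x)"
    and coord_reindex: "coord r' m (reindex r \<rho> x) = wt m / wt (\<rho> m) * coord r (\<rho> m) x"
    and reindex_bounds: "reindex r \<rho> x \<in> {0..1}"
    and reindex_mono: "x \<le> y \<Longrightarrow> reindex r \<rho> x \<le> reindex r \<rho> y"
    and reindex_ordsum: "reindex r \<rho> (ordsum r x y) = ordsum r' (reindex r \<rho> x) (reindex r \<rho> y)"
proof -
  interpret A: lin_order r by standard fact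
  interpret B: lin_order r' by standard fact
  show filled: "filled r' (\<lambda>m. wt m / wt (\<rho> m) * coord r (\<rho> m) x)" for x
    unfolding filled_def
  proof (intro conjI allI impI)
    fix n
    show "0 \<le> wt n / wt (\<rho> n) * coord r (\<rho> n) x" by (intro mult_nonneg_nonneg divide_nonneg_nonneg) simp_all
    have "wt n / wt (\<rho> n) * coord r (\<rho> n) x \<le> wt n / wt (\<rho> n) * wt (\<rho> n)"
      by (intro mult_left_mono divide_nonneg_nonneg) simp_all
    then show "wt n / wt (\<rho> n) * coord r (\<rho> n) x \<le> wt n" using wt_pos[of "\<rho> n"] by simp
  next
    fix m n assume *: "r' (m, n) \<and> 0 < wt n / wt (\<rho> n) * coord r (\<rho> n) x"
    then have "coord r (\<rho> n) x \<noteq> 0" by auto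
    then have "0 < coord r (\<rho> n) x" by (simp add: less_le)
    then have "coord r (\<rho> m) x = wt (\<rho> m)"
      using A.filled_coord * \<rho> unfolding filled_def by blast
    then show "wt m / wt (\<rho> m) * coord r (\<rho> m) x = wt m" using wt_pos[of "\<rho> m"] by simp
  qed
  show coord: "coord r' m (reindex r \<rho> x) = wt m / wt (\<rho> m) * coord r (\<rho> m) x" for x m
    unfolding reindex_def by (rule B.coord_suminf[OF filled])
  show "reindex r \<rho> x \<in> {0..1}" unfolding reindex_def by (rule filled_suminf_bounds[OF filled])
  show "reindex r \<rho> x \<le> reindex r \<rho> y" if "x \<le> y"
    unfolding reindex_def
  proof (rule suminf_le[OF _ filled_summable[OF filled] filled_summable[OF filled]])
    fix m
    have "coord r (\<rho> m) x \<le> coord r (\<rho> m) y" using that unfolding coord_def by auto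
    then show "wt m / wt (\<rho> m) * coord r (\<rho> m) x \<le> wt m / wt (\<rho> m) * coord r (\<rho> m) y"
      by (intro mult_left_mono divide_nonneg_nonneg) simp_all
  qed
  \<comment> \<open>The Lukasiewicz formula is positively homogeneous when the length of the
    interval is scaled along with the arguments.\<close>
  have "wt m / wt (\<rho> m) * luk (\<rho> m) a b = luk m (wt m / wt (\<rho> m) * a) (wt m / wt (\<rho> m) * b)" for m a b
  proof -
    define c where "c = wt m / wt (\<rho> m)"
    have c: "0 \<le> c" "c * wt (\<rho> m) = wt m" unfolding c_def using wt_pos[of "\<rho> m"] by simp_all
    have "c * max 0 (a + b - wt (\<rho> m)) = max (c * 0) (c * (a + b - wt (\<rho> m)))"
      by (rule max_mult_distrib_left[THEN trans]) (use c in auto)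
    then show ?thesis unfolding luk_def c_def[symmetric] using c(2) by (simp add: algebra_simps)
  qed
  then show "reindex r \<rho> (ordsum r x y) = ordsum r' (reindex r \<rho> x) (reindex r \<rho> y)"
    unfolding ordsum_def[of r'] coord unfolding reindex_def A.coord_ordsum by simp
qed

lemma reindex_inverse:
  assumes "r \<in> LO" "r' \<in> LO" "\<And>m n. r' (m, n) \<longleftrightarrow> r (\<rho> m, \<rho> n)" "\<And>n. \<rho> (\<pi> n) = n" "x \<in> {0..1}"
  shows "reindex r' \<pi> (reindex r \<rho> x) = x"
proof -
  interpret lin_order r by standard fact
  have "wt n / wt (\<pi> n) * (wt (\<pi> n) / wt n * c) = c" for n c
    using wt_pos[of n] wt_pos[of "\<pi> n"] by simp
  then show ?thesis
    unfolding reindex_def[of r'] coord_reindex[OF assms(1-3)] assms(4) using suminf_coord[OF assms(5)] by simp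
qed

lemma LO_isomorphic_imp_tnorm_isomorphic:
  assumes r: "r \<in> LO" and r': "r' \<in> LO" and iso: "LO_isomorphic r r'"
  shows "tnorm_isomorphic (ordsum_tnorm r) (ordsum_tnorm r')"
proof -
  obtain \<pi> where \<pi>: "bij \<pi>" "\<And>m n. r (m, n) \<longleftrightarrow> r' (\<pi> m, \<pi> n)"
    using iso unfolding LO_isomorphic_def by blast
  \<comment> \<open>\<open>reindex\<close> builds coordinate \<open>m\<close> of the image from
    coordinate \<open>\<rho> m\<close> of the argument, so it takes the inverse of the given
    permutation.\<close>
  define \<rho> where "\<rho> = inv \<pi>"
  have inv: "\<rho> (\<pi> n) = n" "\<pi> (\<rho> n) = n" for n
    unfolding \<rho>_def using \<pi>(1) by (simp_all add: bij_is_inj bij_is_surj surj_f_inv_f)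
  have \<rho>: "r' (m, n) \<longleftrightarrow> r (\<rho> m, \<rho> n)" for m n using \<pi>(2)[of "\<rho> m" "\<rho> n"] inv by simp
  interpret A: lin_order r by standard fact
  let ?\<phi> = "reindex r \<rho>" and ?\<psi> = "reindex r' \<pi>"
  note \<phi>_inv = reindex_inverse[OF r r' \<rho> inv(1)] and \<psi>_inv = reindex_inverse[OF r' r \<pi>(2) inv(2)]
  have "bij_betw ?\<phi> {0..1} {0..1}"
    by (rule bij_betw_byWitness[where f' = ?\<psi>])
      (use \<phi>_inv \<psi>_inv reindex_bounds[OF r r' \<rho>] reindex_bounds[OF r' r \<pi>(2)] in blast)+
  moreover have "x \<le> y \<longleftrightarrow> ?\<phi> x \<le> ?\<phi> y" if "x \<in> {0..1}" "y \<in> {0..1}" for x y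
    using reindex_mono[OF r r' \<rho>, of x y] reindex_mono[OF r' r \<pi>(2), of "?\<phi> x" "?\<phi> y"] \<phi>_inv that
    by metis
  moreover have "?\<phi> (ordsum_tnorm r (x, y)) = ordsum_tnorm r' (?\<phi> x, ?\<phi> y)" if "x \<in> {0..1}" "y \<in> {0..1}" for x y
    using that reindex_bounds[OF r r' \<rho>] by (simp only: ordsum_tnorm_eq reindex_ordsum[OF r r' \<rho>])
  ultimately show ?thesis unfolding tnorm_isomorphic_def by blast
qed

section \<open>Recovering the order from the idempotents\<close>

definition in_interval :: "(nat \<times> nat \<Rightarrow> bool) \<Rightarrow> nat \<Rightarrow> real \<Rightarrow> bool" where
  "in_interval r n x \<longleftrightarrow> lo r n < x \<and> x < lo r n + wt n"

context lin_order
begin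

text \<open>Idempotency can be checked on coordinates, and \<open>luk n t t = t\<close> holds on
  \<open>{0..wt n}\<close> only at the two ends.\<close>

lemma idempotent_iff:
  assumes "x \<in> {0..1}"
  shows "ordsum_tnorm r (x, x) = x \<longleftrightarrow> (\<forall>n. \<not> in_interval r n x)"
proof
  assume "ordsum_tnorm r (x, x) = x"
  then have fixp: "luk n (coord r n x) (coord r n x) = coord r n x" for n
    using coord_ordsum[of n x x] assms by (simp only: ordsum_tnorm_eq)
  show "\<forall>n. \<not> in_interval r n x"
  proof (intro allI notI)
    fix n assume "in_interval r n x"
    then have "coord r n x = x - lo r n" "0 < x - lo r n" "x - lo r n < wt n"
      unfolding in_interval_def coord_def by auto
    then show False using fixp[of n] unfolding luk_def by linarith
  qed
next
  assume none: "\<forall>n. \<not> in_interval r n x"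
  have "luk n (coord r n x) (coord r n x) = coord r n x" for n
  proof -
    have "x \<le> lo r n \<or> lo r n + wt n \<le> x" using none unfolding in_interval_def by (meson not_le)
    then have "coord r n x = 0 \<or> coord r n x = wt n" unfolding coord_def by auto
    then show ?thesis by (auto simp: luk_def)
  qed
  then have "ordsum r x x = x" unfolding ordsum_def using suminf_coord[OF assms] by simp
  then show "ordsum_tnorm r (x, x) = x" using assms by (simp only: ordsum_tnorm_eq)
qed

lemma in_interval_bounds: "in_interval r n x \<Longrightarrow> x \<in> {0..1}"
  using lo_nonneg[of n] lo_le_one[of n] unfolding in_interval_def by auto

lemma lo_bounds: "lo r n \<in> {0..1}"
  unfolding atLeastAtMost_iff using lo_nonneg[of n] lo_le_one[of n] wt_pos[of n] by linarith

lemma lo_idempotent: "ordsum_tnorm r (lo r n, lo r n) = lo r n"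
proof -
  have "lo r n \<in> {0..1}" by (rule lo_bounds)
  moreover have "\<not> in_interval r k (lo r n)" for k
  proof
    assume k: "in_interval r k (lo r n)"
    then have "k \<noteq> n" "\<not> r (k, n)" using lo_le[of k n] unfolding in_interval_def by auto
    then have "lo r n + wt n \<le> lo r k" using total lo_le by blast
    then show False using k wt_pos[of n] unfolding in_interval_def by linarith
  qed
  ultimately show ?thesis using idempotent_iff by blast
qed

text \<open>Uses only the order of the unit interval and idempotency, hence is invariant under
  isomorphism (\<open>separated_transfer\<close>).\<close>

definition separated :: "real \<Rightarrow> real \<Rightarrow> bool" where
  "separated x y \<longleftrightarrow> (\<exists>e\<in>{0..1}. x < e \<and> e < y \<and> ordsum_tnorm r (e, e) = e)"

text \<open>The left end point of the later interval is an idempotent strictly between the two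
  points, even if the intervals are adjacent; inside one interval there is no idempotent.\<close>

lemma separated_iff:
  assumes "in_interval r m x" "in_interval r n y"
  shows "separated x y \<longleftrightarrow> r (m, n)"
proof
  assume "r (m, n)"
  then have "x < lo r n" "lo r n < y" using lo_le[of m n] assms unfolding in_interval_def by auto
  moreover have "lo r n \<in> {0..1}" by (rule lo_bounds)
  ultimately show "separated x y" unfolding separated_def using lo_idempotent by blast
next
  assume "separated x y"
  then obtain e where e: "e \<in> {0..1}" "x < e" "e < y" "\<And>k. \<not> in_interval r k e"
    unfolding separated_def using idempotent_iff by blast
  have "m \<noteq> n" using e(2,3) e(4)[of m] assms unfolding in_interval_def by auto
  moreover have "\<not> r (n, m)"
  proof
    assume "r (n, m)"
    then have "lo r n + wt n \<le> lo r m" by (rule lo_le)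
    then show False using assms e(2,3) unfolding in_interval_def by linarith
  qed
  ultimately show "r (m, n)" using total by blast
qed

lemma in_interval_mid: "in_interval r n (lo r n + wt n / 2)"
  unfolding in_interval_def using wt_pos[of n] by simp

end

lemma separated_transfer:
  assumes "r \<in> LO" "r' \<in> LO" "tnorm_hom_iso (ordsum_tnorm r) (ordsum_tnorm r') \<phi>" "x \<in> {0..1}" "y \<in> {0..1}"
  shows "lin_order.separated r x y \<longleftrightarrow> lin_order.separated r' (\<phi> x) (\<phi> y)"
proof -
  interpret A: lin_order r by standard fact
  interpret B: lin_order r' by standard fact
  interpret T: tnorm "ordsum_tnorm r" by standard (rule A.continuous_tnorm_ordsum)
  note d = tnorm_hom_isoD[OF assms(3)]
  have idem: "ordsum_tnorm r (e, e) = e \<longleftrightarrow> ordsum_tnorm r' (\<phi> e, \<phi> e) = \<phi> e" if e: "e \<in> {0..1}" for e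
    using d(4)[OF e e] d(2)[OF T.range[OF e e] e] d(2)[OF e T.range[OF e e]] by force
  show ?thesis
  proof
    assume "A.separated x y"
    then obtain e where e: "e \<in> {0..1}" "x < e" "e < y" "ordsum_tnorm r (e, e) = e"
      unfolding A.separated_def by blast
    show "B.separated (\<phi> x) (\<phi> y)"
      unfolding B.separated_def
      using e d(1)[OF e(1)] d(3)[OF assms(4) e(1)] d(3)[OF e(1) assms(5)] idem[OF e(1)] by blast
  next
    assume "B.separated (\<phi> x) (\<phi> y)"
    then obtain e' where e': "e' \<in> {0..1}" "\<phi> x < e'" "e' < \<phi> y" "ordsum_tnorm r' (e', e') = e'"
      unfolding B.separated_def by blast
    obtain e where e: "e \<in> {0..1}" "e' = \<phi> e" using d(5)[OF e'(1)] by blast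
    show "A.separated x y"
      unfolding A.separated_def
      using e' d(3)[OF assms(4) e(1)] d(3)[OF e(1) assms(5)] idem[OF e(1)] unfolding e(2)
      using e(1) by blast
  qed
qed

lemma in_interval_transfer:
  assumes "r \<in> LO" "r' \<in> LO" "tnorm_hom_iso (ordsum_tnorm r) (ordsum_tnorm r') \<phi>" "in_interval r n x"
  shows "\<exists>m. in_interval r' m (\<phi> x)"
proof (rule ccontr)
  interpret A: lin_order r by standard fact
  interpret B: lin_order r' by standard fact
  interpret T: tnorm "ordsum_tnorm r" by standard (rule A.continuous_tnorm_ordsum)
  note d = tnorm_hom_isoD[OF assms(3)]
  have x: "x \<in> {0..1}" by (rule A.in_interval_bounds[OF assms(4)])
  assume "\<not> ?thesis"
  then have "ordsum_tnorm r' (\<phi> x, \<phi> x) = \<phi> x" using B.idempotent_iff[OF d(1)[OF x]] by blast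
  then have "ordsum_tnorm r (x, x) = x"
    using d(4)[OF x x] d(2)[OF T.range[OF x x] x] d(2)[OF x T.range[OF x x]] by force
  then show False using A.idempotent_iff[OF x] assms(4) by blast
qed

text \<open>Midpoints represent the intervals. The image of a midpoint is not idempotent, so it lies
  in a unique interval, whose index defines \<open>\<pi>\<close>; separation by idempotents carries
  the order over.\<close>

lemma tnorm_isomorphic_imp_LO_isomorphic:
  assumes r: "r \<in> LO" and r': "r' \<in> LO"
    and iso: "tnorm_isomorphic (ordsum_tnorm r) (ordsum_tnorm r')"
  shows "LO_isomorphic r r'"
proof -
  interpret A: lin_order r by standard fact
  interpret B: lin_order r' by standard fact
  obtain \<phi> where \<phi>: "tnorm_hom_iso (ordsum_tnorm r) (ordsum_tnorm r') \<phi>"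
    using iso unfolding tnorm_isomorphic_iff by blast
  define \<psi> where "\<psi> = inv_into {0..1} \<phi>"
  note \<psi> = tnorm_hom_iso_inv[OF A.continuous_tnorm_ordsum \<phi>, folded \<psi>_def]
  define mid where "mid n = lo r n + wt n / 2" for n
  define mid' where "mid' n = lo r' n + wt n / 2" for n
  have mid: "in_interval r n (mid n)" for n unfolding mid_def by (rule A.in_interval_mid)
  have mid': "in_interval r' n (mid' n)" for n unfolding mid'_def by (rule B.in_interval_mid)
  note m01 = A.in_interval_bounds[OF mid] and m01' = B.in_interval_bounds[OF mid']
  obtain \<pi> where \<pi>: "\<And>n. in_interval r' (\<pi> n) (\<phi> (mid n))"
    using in_interval_transfer[OF r r' \<phi> mid] by metis
  have hom: "r (m, n) \<longleftrightarrow> r' (\<pi> m, \<pi> n)" for m n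
    using A.separated_iff[OF mid mid, of m n] B.separated_iff[OF \<pi> \<pi>, of m n]
      separated_transfer[OF r r' \<phi> m01 m01, of m n] by blast
  have "inj \<pi>"
    by (rule injI) (metis hom A.total B.irrefl)
  \<comment> \<open>The preimage of \<open>mid' m\<close> lies in some interval \<open>n\<close>. No
    idempotent separates it from \<open>mid n\<close>, so none separates \<open>mid' m\<close> from
    the image of \<open>mid n\<close>, and totality leaves only \<open>\<pi> n = m\<close>.\<close>
  moreover have "\<exists>n. \<pi> n = m" for m
  proof -
    obtain n where n: "in_interval r n (\<psi> (mid' m))"
      using in_interval_transfer[OF r' r \<psi>(1) mid'] by blast
    have \<psi>01: "\<psi> (mid' m) \<in> {0..1}" by (rule A.in_interval_bounds[OF n])
    have "\<not> A.separated (mid n) (\<psi> (mid' m))" "\<not> A.separated (\<psi> (mid' m)) (mid n)"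
      using A.separated_iff[OF mid n] A.separated_iff[OF n mid] A.irrefl by blast+
    then have "\<not> B.separated (\<phi> (mid n)) (mid' m)" "\<not> B.separated (mid' m) (\<phi> (mid n))"
      using separated_transfer[OF r r' \<phi> m01 \<psi>01, of n] separated_transfer[OF r r' \<phi> \<psi>01 m01, of n]
        \<psi>(3)[OF m01'] by simp_all
    then have "\<not> r' (\<pi> n, m)" "\<not> r' (m, \<pi> n)"
      using B.separated_iff[OF \<pi> mid'] B.separated_iff[OF mid' \<pi>] by blast+
    then show ?thesis using B.total by blast
  qed
  ultimately have "bij \<pi>" unfolding bij_def surj_def by metis
  then show ?thesis unfolding LO_isomorphic_def using hom by blast
qed

lemma LO_reducible_to_tnorm: "Borel_reducible LO_space LO_isomorphic tnorm_space tnorm_isomorphic"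
  unfolding Borel_reducible_def topspace_LO_space
  using measurable_ordsum_tnorm LO_isomorphic_imp_tnorm_isomorphic tnorm_isomorphic_imp_LO_isomorphic
  by blast

theorem theorem4p5:
  shows "Borel_reducible tnorm_space tnorm_isomorphic LO_space LO_isomorphic \<and>
         Borel_reducible LO_space LO_isomorphic tnorm_space tnorm_isomorphic"
  using tnorm_reducible_to_LO LO_reducible_to_tnorm by blast

end
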